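(* Let $p$ be a prime and let $G$ be a finite $p$-group such that $\mathrm{cod}(G)=\{1,p,p^b,p^a\}$ where $2\le b<a$. If any of the following hold, then $G$ has nilpotence class at most $4$: (i) $|\mathrm{cd}(G)|=2$; (ii) $\mathrm{cd}(G)=\{1,p,p^2\}$; (iii) $|G:G'|=p^2$.
   Context: For an irreducible complex character $\chi$ of a finite group $G$, the codegree of $\chi$ is $\mathrm{cod}(\chi)=|G:\ker\chi|/\chi(1)$. $\mathrm{cod}(G)$ denotes the set of codegrees of the irreducible characters of $G$, and $\mathrm{cd}(G)$ denotes the set of degrees $\chi(1)$ of the irreducible characters of $G$. $G'$ is the derived subgroup of $G$. *)

theory Defs
  imports "HOL-Algebra.Algebra" "Jordan_Normal_Form.Matrix"
begin

definition mat_trace :: "complex mat \<Rightarrow> complex" where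
  "mat_trace A = (\<Sum>i\<in>{0..<dim_row A}. A $$ (i,i))"

definition is_rep :: "('g,'b) monoid_scheme \<Rightarrow> ('g \<Rightarrow> complex mat) \<Rightarrow> nat \<Rightarrow> bool" where
  "is_rep G \<rho> n \<longleftrightarrow>
     (\<forall>g\<in>carrier G. \<rho> g \<in> carrier_mat n n) \<and>
     \<rho> \<one>\<^bsub>G\<^esub> = 1\<^sub>m n \<and>
     (\<forall>g\<in>carrier G. \<forall>h\<in>carrier G. \<rho> (g \<otimes>\<^bsub>G\<^esub> h) = \<rho> g * \<rho> h)"

definition is_subspace :: "nat \<Rightarrow> complex vec set \<Rightarrow> bool" where
  "is_subspace n W \<longleftrightarrow> W \<subseteq> carrier_vec n \<and> 0\<^sub>v n \<in> W \<and>
     (\<forall>v\<in>W. \<forall>w\<in>W. v + w \<in> W) \<and> (\<forall>c. \<forall>v\<in>W. c \<cdot>\<^sub>v v \<in> W)"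

definition invariant_subspace :: "('g,'b) monoid_scheme \<Rightarrow> ('g \<Rightarrow> complex mat) \<Rightarrow> nat \<Rightarrow> complex vec set \<Rightarrow> bool" where
  "invariant_subspace G \<rho> n W \<longleftrightarrow> is_subspace n W \<and> (\<forall>g\<in>carrier G. \<forall>w\<in>W. \<rho> g *\<^sub>v w \<in> W)"

definition irr_rep :: "('g,'b) monoid_scheme \<Rightarrow> ('g \<Rightarrow> complex mat) \<Rightarrow> nat \<Rightarrow> bool" where
  "irr_rep G \<rho> n \<longleftrightarrow> is_rep G \<rho> n \<and> n > 0 \<and>
     (\<forall>W. invariant_subspace G \<rho> n W \<longrightarrow> W = {0\<^sub>v n} \<or> W = carrier_vec n)"

definition character :: "('g,'b) monoid_scheme \<Rightarrow> ('g \<Rightarrow> complex mat) \<Rightarrow> 'g \<Rightarrow> complex" where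
  "character G \<rho> = (\<lambda>g\<in>carrier G. mat_trace (\<rho> g))"

definition Irr :: "('g,'b) monoid_scheme \<Rightarrow> ('g \<Rightarrow> complex) set" where
  "Irr G = {character G \<rho> | \<rho> n. irr_rep G \<rho> n}"

definition char_ker :: "('g,'b) monoid_scheme \<Rightarrow> ('g \<Rightarrow> complex) \<Rightarrow> 'g set" where
  "char_ker G \<chi> = {g\<in>carrier G. \<chi> g = \<chi> \<one>\<^bsub>G\<^esub>}"

text \<open>cod(chi) = |G : ker chi| / chi(1), as a real number (chi(1) is a positive integer).\<close>
definition codeg :: "('g,'b) monoid_scheme \<Rightarrow> ('g \<Rightarrow> complex) \<Rightarrow> real" where
  "codeg G \<chi> = (real (card (carrier G)) / real (card (char_ker G \<chi>))) / Re (\<chi> \<one>\<^bsub>G\<^esub>)"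

definition cod :: "('g,'b) monoid_scheme \<Rightarrow> real set" where
  "cod G = codeg G ` Irr G"

definition cd :: "('g,'b) monoid_scheme \<Rightarrow> complex set" where
  "cd G = (\<lambda>\<chi>. \<chi> \<one>\<^bsub>G\<^esub>) ` Irr G"

definition p_group :: "nat \<Rightarrow> ('g,'b) monoid_scheme \<Rightarrow> bool" where
  "p_group p G \<longleftrightarrow> group G \<and> finite (carrier G) \<and> (\<exists>k. card (carrier G) = p ^ k)"

fun lcs :: "('g,'b) monoid_scheme \<Rightarrow> nat \<Rightarrow> 'g set" where
  "lcs G 0 = carrier G"
| "lcs G (Suc i) = generate G
     {x \<otimes>\<^bsub>G\<^esub> y \<otimes>\<^bsub>G\<^esub> inv\<^bsub>G\<^esub> x \<otimes>\<^bsub>G\<^esub> inv\<^bsub>G\<^esub> y | x y. x \<in> lcs G i \<and> y \<in> carrier G}"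

text \<open>G has nilpotence class at most c iff gamma_(c+1)(G) = 1.\<close>
definition nilpotent_class_le :: "('g,'b) monoid_scheme \<Rightarrow> nat \<Rightarrow> bool" where
  "nilpotent_class_le G c \<longleftrightarrow> lcs G c = {\<one>\<^bsub>G\<^esub>}"

end

theory Submission
  imports Defs "Jordan_Normal_Form.Spectral_Radius"
begin

text \<open>Write \<open>\<gamma>\<^sub>i\<close> for the lower central series, so that \<open>lcs G i\<close> is \<open>\<gamma>\<^bsub>i+1\<^esub>\<close>. Suppose that
  \<open>\<gamma>\<^sub>5 \<noteq> 1\<close>. Then there are irreducible characters \<open>\<chi>\<^sub>5, \<chi>\<^sub>4, \<chi>\<^sub>3, \<chi>\<^sub>2\<close> with strictly increasing kernels \<open>K\<^sub>i\<close>
  such that \<open>K\<^sub>i\<close> contains \<open>\<gamma>\<^bsub>i+1\<^esub>\<close> but not \<open>\<gamma>\<^sub>i\<close>: if \<open>\<gamma>\<^bsub>i-1\<^esub>\<close> were contained in \<open>K\<^sub>i \<gamma>\<^sub>i\<close>, which is central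
  modulo \<open>K\<^sub>i\<close>, then \<open>\<gamma>\<^sub>i\<close> would lie in \<open>K\<^sub>i\<close>, so some \<open>\<chi>\<^bsub>i-1\<^esub>\<close> is trivial on \<open>K\<^sub>i \<gamma>\<^sub>i\<close> but not on
  \<open>\<gamma>\<^bsub>i-1\<^esub>\<close>. Put \<open>|G : K\<^sub>i| = p^e\<^sub>i\<close> and \<open>\<chi>\<^sub>i(1) = p^f\<^sub>i\<close>. Then \<open>e\<^sub>2 < e\<^sub>3 < e\<^sub>4 < e\<^sub>5\<close>, and
  \<open>\<chi>\<^sub>i(1)\<^sup>2 |Z(G/K\<^sub>i)| \<le> |G : K\<^sub>i|\<close> gives \<open>2 f\<^sub>i < e\<^sub>i\<close>, so all four codegrees \<open>p^(e\<^sub>i - f\<^sub>i)\<close> are \<open>p^a\<close> or \<open>p^b\<close>.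

  (i) If all \<open>f\<^sub>i\<close> agree, these codegrees are distinct, which is absurd.

  (ii) If all \<open>f\<^sub>i\<close> are \<open>1\<close> or \<open>2\<close>, then \<open>e\<^sub>2 = b + 1\<close>, \<open>e\<^sub>3 = b + 2\<close>, \<open>f\<^sub>2 = 1\<close>, \<open>f\<^sub>3 = 2\<close>, and comparing the
  centers of \<open>G/K\<^sub>2\<close> and \<open>G/K\<^sub>3\<close> gives a contradiction.

  (iii) If \<open>|G : G'| = p\<^sup>2\<close>, then \<open>\<gamma>\<^sub>2/\<gamma>\<^sub>3\<close> has order \<open>p\<close> and \<open>\<chi>\<^sub>3\<close> takes \<open>\<gamma>\<^sub>3\<close> to \<open>p\<close>-th roots of unity, so
  \<open>e\<^sub>3 \<le> 4\<close>. Hence \<open>e\<^sub>2 = 3\<close>, \<open>e\<^sub>3 = 4\<close>, \<open>b = 2\<close>, \<open>a = 3\<close>, and \<open>2 f\<^sub>5 < e\<^sub>5 \<le> f\<^sub>5 + 3\<close> contradicts \<open>e\<^sub>5 \<ge> 6\<close>.\<close>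

section \<open>Subspaces and matrices\<close>

lemma mult_mat_entry:
  fixes A :: "complex mat"
  assumes "A \<in> carrier_mat a b" "B \<in> carrier_mat b c" "i < a" "j < c"
  shows "(A * B) $$ (i,j) = (\<Sum>k<b. A $$ (i,k) * B $$ (k,j))"
  using assms by (auto simp: scalar_prod_def lessThan_atLeast0)

lemma mult_mat_vec_entry:
  fixes A :: "complex mat"
  assumes "A \<in> carrier_mat a b" "v \<in> carrier_vec b" "i < a"
  shows "(A *\<^sub>v v) $ i = (\<Sum>k<b. A $$ (i,k) * v $ k)"
  using assms by (auto simp: scalar_prod_def lessThan_atLeast0)

text \<open>If \<open>n < k\<close>, padding both matrices with zeros to size \<open>k\<close> keeps
  \<open>A' * B' = 1\<close>. For square matrices this forces \<open>B' * A' = 1\<close>, but row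
  \<open>n\<close> of \<open>B'\<close> is zero.\<close>

lemma left_inverse_dim_le:
  fixes A :: "complex mat"
  assumes A: "A \<in> carrier_mat k n" and B: "B \<in> carrier_mat n k" and AB: "A * B = 1\<^sub>m k"
  shows "k \<le> n"
proof (rule ccontr)
  assume "\<not> k \<le> n"
  then have nk: "n < k" by simp
  define A' where "A' = mat k k (\<lambda>(i,j). if j < n then A $$ (i,j) else 0)"
  define B' where "B' = mat k k (\<lambda>(i,j). if i < n then B $$ (i,j) else 0)"
  have A'c: "A' \<in> carrier_mat k k" and B'c: "B' \<in> carrier_mat k k" by (auto simp: A'_def B'_def)
  have "A' * B' = A * B"
  proof (rule eq_matI)
    fix i j assume "i < dim_row (A * B)" "j < dim_col (A * B)"
    then have i: "i < k" and j: "j < k" using A B by auto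
    have "(A' * B') $$ (i,j) = (\<Sum>l<k. A' $$ (i,l) * B' $$ (l,j))"
      by (rule mult_mat_entry[OF A'c B'c i j])
    also have "\<dots> = (\<Sum>l<k. if l < n then A $$ (i,l) * B $$ (l,j) else 0)"
      using i j by (intro sum.cong) (auto simp: A'_def B'_def)
    also have "\<dots> = (\<Sum>l<n. A $$ (i,l) * B $$ (l,j))"
      using nk by (intro sum.mono_neutral_cong_right) auto
    also have "\<dots> = (A * B) $$ (i,j)" by (rule mult_mat_entry[OF A B i j, symmetric])
    finally show "(A' * B') $$ (i,j) = (A * B) $$ (i,j)" .
  qed (use A B A'c B'c in auto)
  then have "B' * A' = 1\<^sub>m k" using mat_mult_left_right_inverse[OF A'c B'c] AB by simp
  then have "(B' * A') $$ (n,n) = 1" using nk by simp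
  moreover have "(B' * A') $$ (n,n) = (\<Sum>l<k. B' $$ (n,l) * A' $$ (l,n))"
    by (rule mult_mat_entry[OF B'c A'c nk nk])
  moreover have "\<dots> = 0" using nk by (intro sum.neutral) (auto simp: B'_def)
  ultimately show False by simp
qed

lemma is_subspace_minus:
  assumes "is_subspace n W" "v \<in> W" "w \<in> W"
  shows "v - w \<in> W"
proof -
  have c: "v \<in> carrier_vec n" "w \<in> carrier_vec n" using assms by (auto simp: is_subspace_def)
  have "v - w = v + (-1) \<cdot>\<^sub>v w" using c by (intro eq_vecI) auto
  then show ?thesis using assms by (simp add: is_subspace_def)
qed

text \<open>Linear independence of the columns of \<open>B\<close> is encoded by a left inverse
  \<open>C\<close>. Subtracting from \<open>w\<close> its projection \<open>B C w\<close> leaves a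
  nonzero \<open>u\<close> in \<open>W\<close> with \<open>C u = 0\<close>, which becomes the new
  column.\<close>

lemma subspace_frame_extend:
  assumes W: "is_subspace n W"
    and B: "B \<in> carrier_mat n k" and C: "C \<in> carrier_mat k n" and CB: "C * B = 1\<^sub>m k"
    and BW: "\<forall>v\<in>carrier_vec k. B *\<^sub>v v \<in> W"
    and w: "w \<in> W" "\<And>v. v \<in> carrier_vec k \<Longrightarrow> w \<noteq> B *\<^sub>v v"
  shows "\<exists>B'\<in>carrier_mat n (Suc k). \<exists>C'\<in>carrier_mat (Suc k) n.
    C' * B' = 1\<^sub>m (Suc k) \<and> (\<forall>v\<in>carrier_vec (Suc k). B' *\<^sub>v v \<in> W)"
proof -
  have wc: "w \<in> carrier_vec n" using W w by (auto simp: is_subspace_def)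
  define u where "u = w - B *\<^sub>v (C *\<^sub>v w)"
  have Cw: "C *\<^sub>v w \<in> carrier_vec k" using C wc by auto
  have Bw: "B *\<^sub>v (C *\<^sub>v w) \<in> carrier_vec n" using mult_mat_vec_carrier[OF B Cw] .
  have uW: "u \<in> W" unfolding u_def using is_subspace_minus[OF W] w BW Cw by auto
  have uc: "u \<in> carrier_vec n" using wc Bw by (auto simp: u_def)
  have Cu: "C *\<^sub>v u = 0\<^sub>v k"
  proof -
    have "C *\<^sub>v u = C *\<^sub>v w - C *\<^sub>v (B *\<^sub>v (C *\<^sub>v w))"
      unfolding u_def by (rule mult_minus_distrib_mat_vec[OF C wc Bw])
    also have "C *\<^sub>v (B *\<^sub>v (C *\<^sub>v w)) = (C * B) *\<^sub>v (C *\<^sub>v w)"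
      by (rule assoc_mult_mat_vec[OF C B Cw, symmetric])
    also have "\<dots> = C *\<^sub>v w" using CB Cw by simp
    finally show ?thesis using Cw by auto
  qed
  have "u \<noteq> 0\<^sub>v n"
  proof
    assume "u = 0\<^sub>v n"
    then have "w = B *\<^sub>v (C *\<^sub>v w)"
    proof -
      assume u0: "u = 0\<^sub>v n"
      show ?thesis
      proof (rule eq_vecI)
        fix i assume i: "i < dim_vec (B *\<^sub>v (C *\<^sub>v w))"
        then have "i < n" using B by auto
        then have "u $ i = 0" using u0 by simp
        then show "w $ i = (B *\<^sub>v (C *\<^sub>v w)) $ i" using i by (simp add: u_def)
      qed (use wc B in auto)
    qed
    then show False using w(2)[OF Cw] by simp
  qed
  then obtain j where j: "j < n" "u $ j \<noteq> 0" using uc by (metis carrier_vecD eq_vecI index_zero_vec)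
  \<comment> \<open>Row \<open>j\<close> of \<open>1 - B C\<close>, divided by \<open>u $ j\<close>:
    it annihilates the columns of \<open>B\<close> because \<open>C B = 1\<close>, and it sends
    \<open>u\<close> to \<open>1\<close> because \<open>C u = 0\<close>.\<close>
  define r where "r = (\<lambda>l. ((if l = j then 1 else 0) - (\<Sum>m<k. B $$ (j,m) * C $$ (m,l))) / u $ j)"
  define B' where "B' = mat n (Suc k) (\<lambda>(i,m). if m < k then B $$ (i,m) else u $ i)"
  define C' where "C' = mat (Suc k) n (\<lambda>(m,i). if m < k then C $$ (m,i) else r i)"
  have B'c: "B' \<in> carrier_mat n (Suc k)" and C'c: "C' \<in> carrier_mat (Suc k) n"
    by (auto simp: B'_def C'_def)
  have CB_e: "(\<Sum>l<n. C $$ (a,l) * B $$ (l,b)) = (if a = b then 1 else 0)" if "a < k" "b < k" for a b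
    using mult_mat_entry[OF C B that] CB that by simp
  have Cu_e: "(\<Sum>l<n. C $$ (a,l) * u $ l) = 0" if "a < k" for a
    using mult_mat_vec_entry[OF C uc that] Cu that by simp
  have r_sum: "(\<Sum>l<n. r l * x l) = (x j - (\<Sum>m<k. B $$ (j,m) * (\<Sum>l<n. C $$ (m,l) * x l))) / u $ j"
    for x :: "nat \<Rightarrow> complex"
  proof -
    have "(\<Sum>l<n. r l * x l) = (\<Sum>l<n. ((if l = j then x l else 0)
       - (\<Sum>m<k. B $$ (j,m) * (C $$ (m,l) * x l))) / u $ j)"
      unfolding r_def by (intro sum.cong) (auto simp: sum_distrib_right left_diff_distrib mult.assoc)
    also have "\<dots> = ((\<Sum>l<n. if l = j then x l else 0)
       - (\<Sum>l<n. \<Sum>m<k. B $$ (j,m) * (C $$ (m,l) * x l))) / u $ j"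
      by (simp add: sum_divide_distrib[symmetric] sum_subtractf)
    also have "(\<Sum>l<n. if l = j then x l else 0) = x j" using j by simp
    also have "(\<Sum>l<n. \<Sum>m<k. B $$ (j,m) * (C $$ (m,l) * x l)) = (\<Sum>m<k. B $$ (j,m) * (\<Sum>l<n. C $$ (m,l) * x l))"
      by (subst sum.swap) (simp add: sum_distrib_left)
    finally show ?thesis .
  qed
  have "C' * B' = 1\<^sub>m (Suc k)"
  proof (rule eq_matI)
    fix a b assume "a < dim_row (1\<^sub>m (Suc k))" "b < dim_col (1\<^sub>m (Suc k))"
    then have ab: "a < Suc k" "b < Suc k" by auto
    have e: "(C' * B') $$ (a,b) = (\<Sum>l<n. C' $$ (a,l) * B' $$ (l,b))"
      by (rule mult_mat_entry[OF C'c B'c ab])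
    consider "a < k" "b < k" | "a < k" "b = k" | "a = k" "b < k" | "a = k" "b = k" using ab by linarith
    then show "(C' * B') $$ (a,b) = 1\<^sub>m (Suc k) $$ (a,b)"
    proof cases
      case 1
      then show ?thesis using e CB_e[of a b] by (simp add: C'_def B'_def)
    next
      case 2
      then show ?thesis using e Cu_e[of a] by (simp add: C'_def B'_def)
    next
      case 3
      have "(\<Sum>l<n. r l * B $$ (l,b)) = (B $$ (j,b) - (\<Sum>m<k. B $$ (j,m) * (if m = b then 1 else 0))) / u $ j"
        unfolding r_sum using CB_e 3 by simp
      also have "(\<Sum>m<k. B $$ (j,m) * (if m = b then 1 else 0)) = B $$ (j,b)" using 3 by (simp add: if_distrib [of "(*) _"] cong: if_cong)
      finally show ?thesis using e 3 by (simp add: C'_def B'_def)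
    next
      case 4
      have "(\<Sum>l<n. r l * u $ l) = 1"
        unfolding r_sum using Cu_e j by simp
      then show ?thesis using e 4 by (simp add: C'_def B'_def)
    qed
  qed (use B'c C'c in auto)
  moreover have "B' *\<^sub>v v \<in> W" if v: "v \<in> carrier_vec (Suc k)" for v
  proof -
    define v' where "v' = vec k (\<lambda>i. v $ i)"
    have v'c: "v' \<in> carrier_vec k" by (simp add: v'_def)
    have "B' *\<^sub>v v = B *\<^sub>v v' + v $ k \<cdot>\<^sub>v u"
    proof (rule eq_vecI)
      fix i assume "i < dim_vec (B *\<^sub>v v' + v $ k \<cdot>\<^sub>v u)"
      then have i: "i < n" using uc by auto
      have "(B' *\<^sub>v v) $ i = (\<Sum>m<k. B $$ (i,m) * v $ m) + u $ i * v $ k"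
        using mult_mat_vec_entry[OF B'c v i] i by (simp add: B'_def)
      moreover have "(B *\<^sub>v v') $ i = (\<Sum>m<k. B $$ (i,m) * v $ m)"
        using mult_mat_vec_entry[OF B v'c i] by (simp add: v'_def)
      ultimately show "(B' *\<^sub>v v) $ i = (B *\<^sub>v v' + v $ k \<cdot>\<^sub>v u) $ i" using i uc B by simp
    qed (use B'c uc in auto)
    then show ?thesis using BW v'c uW W by (auto simp: is_subspace_def)
  qed
  ultimately show ?thesis using B'c C'c by blast
qed

text \<open>Take a frame with the greatest number \<open>k\<close> of columns;
  \<open>left_inverse_dim_le\<close> bounds \<open>k\<close> by \<open>n\<close>. By
  \<open>subspace_frame_extend\<close> the columns then span \<open>W\<close>. If
  \<open>k = n\<close>, then \<open>B\<close> is invertible and \<open>W\<close> is the whole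
  space.\<close>

lemma subspace_frame:
  assumes W: "is_subspace n W" "W \<noteq> {0\<^sub>v n}"
  obtains k B C where "0 < k" "B \<in> carrier_mat n k" "C \<in> carrier_mat k n" "C * B = 1\<^sub>m k"
    "W = (*\<^sub>v) B ` carrier_vec k" "W = carrier_vec n \<or> k < n"
proof -
  define P where "P = (\<lambda>k. \<exists>B\<in>carrier_mat n k. \<exists>C\<in>carrier_mat k n. C * B = 1\<^sub>m k \<and>
    (\<forall>v\<in>carrier_vec k. B *\<^sub>v v \<in> W))"
  have P0: "P 0"
  proof -
    have "(0\<^sub>m n 0 :: complex mat) *\<^sub>v v \<in> W" if "v \<in> carrier_vec 0" for v
    proof -
      have "(0\<^sub>m n 0 :: complex mat) *\<^sub>v v = 0\<^sub>v n"
      proof (rule eq_vecI)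
        fix i assume "i < dim_vec (0\<^sub>v n :: complex vec)"
        then have i: "i < n" by simp
        show "((0\<^sub>m n 0 :: complex mat) *\<^sub>v v) $ i = 0\<^sub>v n $ i"
          using mult_mat_vec_entry[of "0\<^sub>m n 0" n 0 v i] that i by simp
      qed simp
      then show ?thesis using W by (simp add: is_subspace_def)
    qed
    then show ?thesis unfolding P_def
      by (intro bexI[of _ "0\<^sub>m n 0"] bexI[of _ "0\<^sub>m 0 n"]) auto
  qed
  have Pn: "k \<le> n" if "P k" for k using that left_inverse_dim_le unfolding P_def by blast
  define k where "k = Greatest P"
  have Pk: "P k" unfolding k_def by (rule GreatestI_nat[where P=P, OF P0]) (use Pn in auto)
  have not: "\<not> P (Suc k)" unfolding k_def
    by (metis Greatest_le_nat Pn Suc_n_not_le_n)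
  obtain B C where B: "B \<in> carrier_mat n k" and C: "C \<in> carrier_mat k n" and CB: "C * B = 1\<^sub>m k"
    and BW: "\<forall>v\<in>carrier_vec k. B *\<^sub>v v \<in> W"
    using Pk unfolding P_def by blast
  have img: "W = (*\<^sub>v) B ` carrier_vec k"
  proof (rule ccontr)
    assume "W \<noteq> (*\<^sub>v) B ` carrier_vec k"
    then obtain w where "w \<in> W" "\<And>v. v \<in> carrier_vec k \<Longrightarrow> w \<noteq> B *\<^sub>v v" using BW by blast
    from subspace_frame_extend[OF W(1) B C CB BW this] show False using not unfolding P_def by blast
  qed
  have "k \<noteq> 0"
  proof
    assume k: "k = 0"
    have "W \<subseteq> {0\<^sub>v n}" unfolding img using B k by (auto intro!: eq_vecI simp: scalar_prod_def)
    then show False using W by (auto simp: is_subspace_def)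
  qed
  moreover have "W = carrier_vec n \<or> k < n"
  proof (rule ccontr)
    assume *: "\<not> (W = carrier_vec n \<or> k < n)"
    then have kn: "k = n" using Pn[OF Pk] by linarith
    then have BC: "B * C = 1\<^sub>m n" using mat_mult_left_right_inverse[of C n B] B C CB by simp
    have "carrier_vec n \<subseteq> W"
    proof
      fix v :: "complex vec" assume v: "v \<in> carrier_vec n"
      have "B *\<^sub>v (C *\<^sub>v v) = v" using assoc_mult_mat_vec[OF B C v] BC v by simp
      then show "v \<in> W" using BW C v by (metis mult_mat_vec_carrier)
    qed
    then show False using * W by (auto simp: is_subspace_def)
  qed
  ultimately show thesis using that[of k B C] B C CB img by blast
qed

section \<open>Irreducible representations\<close>

definition msum :: "nat \<Rightarrow> ('a \<Rightarrow> complex mat) \<Rightarrow> 'a set \<Rightarrow> complex mat" where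
  "msum n F S = mat n n (\<lambda>ij. \<Sum>x\<in>S. F x $$ ij)"

lemma msum_carrier [simp]: "msum n F S \<in> carrier_mat n n"
  by (simp add: msum_def)

lemma msum_cong: "(\<And>x. x \<in> S \<Longrightarrow> F x = F' x) \<Longrightarrow> msum n F S = msum n F' S"
  by (simp add: msum_def cong: sum.cong)

lemma msum_reindex_bij:
  assumes "bij_betw f S T"
  shows "msum n (\<lambda>x. F (f x)) S = msum n F T"
proof -
  have "(\<Sum>x\<in>S. F (f x) $$ ij) = (\<Sum>x\<in>T. F x $$ ij)" for ij
    using sum.reindex_bij_betw[OF assms, of "\<lambda>x. F x $$ ij"] .
  then show ?thesis by (simp add: msum_def)
qed

lemma msum_mult_left:
  assumes A: "A \<in> carrier_mat n n" and F: "\<And>x. x \<in> S \<Longrightarrow> F x \<in> carrier_mat n n"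
  shows "A * msum n F S = msum n (\<lambda>x. A * F x) S"
proof (rule eq_matI)
  fix i j assume "i < dim_row (msum n (\<lambda>x. A * F x) S)" "j < dim_col (msum n (\<lambda>x. A * F x) S)"
  then have i: "i < n" and j: "j < n" by (auto simp: msum_def)
  have "(A * msum n F S) $$ (i,j) = (\<Sum>k<n. A $$ (i,k) * (\<Sum>x\<in>S. F x $$ (k,j)))"
    using mult_mat_entry[OF A msum_carrier i j] j by (simp add: msum_def)
  also have "\<dots> = (\<Sum>x\<in>S. \<Sum>k<n. A $$ (i,k) * F x $$ (k,j))"
    by (simp add: sum_distrib_left) (rule sum.swap)
  also have "\<dots> = (\<Sum>x\<in>S. (A * F x) $$ (i,j))"
    using mult_mat_entry[OF A F i j] by (intro sum.cong) auto
  finally show "(A * msum n F S) $$ (i,j) = msum n (\<lambda>x. A * F x) S $$ (i,j)"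
    using i j by (simp add: msum_def)
qed (use A in \<open>auto simp: msum_def\<close>)

lemma msum_mult_right:
  assumes A: "A \<in> carrier_mat n n" and F: "\<And>x. x \<in> S \<Longrightarrow> F x \<in> carrier_mat n n"
  shows "msum n F S * A = msum n (\<lambda>x. F x * A) S"
proof (rule eq_matI)
  fix i j assume "i < dim_row (msum n (\<lambda>x. F x * A) S)" "j < dim_col (msum n (\<lambda>x. F x * A) S)"
  then have i: "i < n" and j: "j < n" by (auto simp: msum_def)
  have "(msum n F S * A) $$ (i,j) = (\<Sum>k<n. (\<Sum>x\<in>S. F x $$ (i,k)) * A $$ (k,j))"
    using mult_mat_entry[OF msum_carrier A i j] i by (simp add: msum_def)
  also have "\<dots> = (\<Sum>x\<in>S. \<Sum>k<n. F x $$ (i,k) * A $$ (k,j))"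
    by (simp add: sum_distrib_right) (rule sum.swap)
  also have "\<dots> = (\<Sum>x\<in>S. (F x * A) $$ (i,j))"
    using mult_mat_entry[OF F A i j] by (intro sum.cong) auto
  finally show "(msum n F S * A) $$ (i,j) = msum n (\<lambda>x. F x * A) S $$ (i,j)"
    using i j by (simp add: msum_def)
qed (use A in \<open>auto simp: msum_def\<close>)

lemma mat_trace_carrier: "A \<in> carrier_mat n n \<Longrightarrow> mat_trace A = (\<Sum>i<n. A $$ (i,i))"
  by (auto simp: mat_trace_def lessThan_atLeast0)

lemma mat_trace_msum:
  assumes F: "\<And>x. x \<in> S \<Longrightarrow> F x \<in> carrier_mat n n"
  shows "mat_trace (msum n F S) = (\<Sum>x\<in>S. mat_trace (F x))"
proof -
  have "mat_trace (msum n F S) = (\<Sum>i<n. \<Sum>x\<in>S. F x $$ (i,i))"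
    by (simp add: mat_trace_carrier[OF msum_carrier]) (simp add: msum_def)
  also have "\<dots> = (\<Sum>x\<in>S. mat_trace (F x))"
    using mat_trace_carrier[OF F] by (subst sum.swap) simp
  finally show ?thesis .
qed

lemma mat_trace_comm:
  assumes A: "A \<in> carrier_mat n n" and B: "B \<in> carrier_mat n n"
  shows "mat_trace (A * B) = mat_trace (B * A)"
proof -
  have "mat_trace (A * B) = (\<Sum>i<n. \<Sum>k<n. A $$ (i,k) * B $$ (k,i))"
    using mat_trace_carrier[OF mult_carrier_mat[OF A B]] mult_mat_entry[OF A B] by simp
  also have "\<dots> = (\<Sum>k<n. \<Sum>i<n. B $$ (k,i) * A $$ (i,k))"
    by (subst sum.swap) (simp add: mult.commute)
  also have "\<dots> = mat_trace (B * A)"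
    using mat_trace_carrier[OF mult_carrier_mat[OF B A]] mult_mat_entry[OF B A] by simp
  finally show ?thesis .
qed

lemma mat_trace_smult: "mat_trace (c \<cdot>\<^sub>m A) = c * mat_trace A" if "A \<in> carrier_mat n n"
  using that by (auto simp: mat_trace_def sum_distrib_left)

lemma mat_trace_one: "mat_trace (1\<^sub>m n) = of_nat n"
  by (simp add: mat_trace_def)

lemma mat_trace_minus:
  "A \<in> carrier_mat n n \<Longrightarrow> B \<in> carrier_mat n n \<Longrightarrow> mat_trace (A - B) = mat_trace A - mat_trace B"
  by (auto simp: mat_trace_def sum_subtractf)

text \<open>The conjugate transpose.\<close>

definition hadj :: "complex mat \<Rightarrow> complex mat" where
  "hadj A = mat (dim_col A) (dim_row A) (\<lambda>(i,j). cnj (A $$ (j,i)))"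

lemma hadj_carrier [simp]: "A \<in> carrier_mat n m \<Longrightarrow> hadj A \<in> carrier_mat m n"
  by (auto simp: hadj_def)

lemma hadj_entry: "A \<in> carrier_mat n m \<Longrightarrow> i < m \<Longrightarrow> j < n \<Longrightarrow> hadj A $$ (i,j) = cnj (A $$ (j,i))"
  by (auto simp: hadj_def)

lemma hadj_hadj: "hadj (hadj A) = A"
  by (rule eq_matI) (auto simp: hadj_def)

lemma hadj_one: "hadj (1\<^sub>m n) = 1\<^sub>m n"
  by (rule eq_matI) (auto simp: hadj_def)

lemma hadj_smult: "hadj (c \<cdot>\<^sub>m A) = cnj c \<cdot>\<^sub>m hadj A"
  by (rule eq_matI) (auto simp: hadj_def)

lemma hadj_minus:
  "A \<in> carrier_mat n m \<Longrightarrow> B \<in> carrier_mat n m \<Longrightarrow> hadj (A - B) = hadj A - hadj B"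
  by (rule eq_matI) (auto simp: hadj_def)

lemma hadj_mult:
  assumes A: "A \<in> carrier_mat n n" and B: "B \<in> carrier_mat n n"
  shows "hadj (A * B) = hadj B * hadj A"
proof (rule eq_matI)
  fix i j assume "i < dim_row (hadj B * hadj A)" "j < dim_col (hadj B * hadj A)"
  then have i: "i < n" and j: "j < n" using A B by (auto simp: hadj_def)
  have "hadj (A * B) $$ (i,j) = (\<Sum>k<n. cnj (A $$ (j,k)) * cnj (B $$ (k,i)))"
    using hadj_entry[OF mult_carrier_mat[OF A B] i j] mult_mat_entry[OF A B j i] by simp
  also have "\<dots> = (\<Sum>k<n. hadj B $$ (i,k) * hadj A $$ (k,j))"
    using hadj_entry[OF A _ j] hadj_entry[OF B i] by (simp add: mult.commute)
  also have "\<dots> = (hadj B * hadj A) $$ (i,j)"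
    using mult_mat_entry[OF hadj_carrier[OF B] hadj_carrier[OF A] i j] by simp
  finally show "hadj (A * B) $$ (i,j) = (hadj B * hadj A) $$ (i,j)" .
qed (use A B in \<open>auto simp: hadj_def\<close>)

lemma hadj_msum:
  assumes "\<And>x. x \<in> S \<Longrightarrow> F x \<in> carrier_mat n n"
  shows "hadj (msum n F S) = msum n (\<lambda>x. hadj (F x)) S"
proof (rule eq_matI)
  fix i j assume "i < dim_row (msum n (\<lambda>x. hadj (F x)) S)" "j < dim_col (msum n (\<lambda>x. hadj (F x)) S)"
  then have i: "i < n" and j: "j < n" by (auto simp: msum_def)
  then have "hadj (msum n F S) $$ (i,j) = (\<Sum>x\<in>S. cnj (F x $$ (j,i)))"
    by (simp add: hadj_def msum_def)
  also have "\<dots> = (\<Sum>x\<in>S. hadj (F x) $$ (i,j))"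
    using hadj_entry[OF assms i j] by simp
  finally show "hadj (msum n F S) $$ (i,j) = msum n (\<lambda>x. hadj (F x)) S $$ (i,j)"
    using i j by (simp add: msum_def)
qed (auto simp: msum_def hadj_def)

lemma mat_trace_hadj: "A \<in> carrier_mat n n \<Longrightarrow> mat_trace (hadj A) = cnj (mat_trace A)"
  by (auto simp: mat_trace_def hadj_def)

text \<open>The square of the Frobenius norm.\<close>

definition fnorm :: "complex mat \<Rightarrow> real" where
  "fnorm A = (\<Sum>i<dim_row A. \<Sum>j<dim_col A. (cmod (A $$ (i,j)))\<^sup>2)"

lemma fnorm_nonneg: "0 \<le> fnorm A"
  by (auto simp: fnorm_def intro!: sum_nonneg)

lemma fnorm_eq_0:
  assumes "A \<in> carrier_mat n n" "fnorm A = 0"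
  shows "A = 0\<^sub>m n n"
proof (rule eq_matI)
  fix i j assume "i < dim_row (0\<^sub>m n n)" "j < dim_col (0\<^sub>m n n)"
  then have i: "i < n" and j: "j < n" by auto
  have "(\<Sum>i<n. \<Sum>j<n. (cmod (A $$ (i,j)))\<^sup>2) = 0" using assms by (auto simp: fnorm_def)
  then have "(\<Sum>j<n. (cmod (A $$ (i,j)))\<^sup>2) = 0"
    using i by (subst (asm) sum_nonneg_eq_0_iff) (auto intro!: sum_nonneg)
  then have "(cmod (A $$ (i,j)))\<^sup>2 = 0"
    using j by (subst (asm) sum_nonneg_eq_0_iff) auto
  then show "A $$ (i,j) = 0\<^sub>m n n $$ (i,j)" using i j by simp
qed (use assms in auto)

lemma mat_trace_mult_hadj:
  assumes A: "A \<in> carrier_mat n n"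
  shows "mat_trace (A * hadj A) = of_real (fnorm A)"
proof -
  have "mat_trace (A * hadj A) = (\<Sum>i<n. \<Sum>k<n. A $$ (i,k) * cnj (A $$ (i,k)))"
    using mat_trace_carrier[OF mult_carrier_mat[OF A hadj_carrier[OF A]]]
      mult_mat_entry[OF A hadj_carrier[OF A]] hadj_entry[OF A] by simp
  also have "\<dots> = of_real (fnorm A)"
    using A by (auto simp: fnorm_def complex_mult_cnj cmod_power2)
  finally show ?thesis .
qed

section \<open>Schur's lemma and invariant Hermitian forms\<close>

locale finite_rep = group G for G (structure) +
  fixes \<rho> :: "'a \<Rightarrow> complex mat" and n :: nat
  assumes finite_carrier: "finite (carrier G)" and rep: "is_rep G \<rho> n"
begin

lemma mult_carrier_n [simp]:
  "A \<in> carrier_mat n n \<Longrightarrow> B \<in> carrier_mat n n \<Longrightarrow> A * B \<in> carrier_mat n n"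
  by simp

lemmas mat_assoc = assoc_mult_mat[of _ n n _ n _ n]

lemma mult_one_n [simp]:
  fixes A :: "complex mat"
  shows
  "A \<in> carrier_mat n n \<Longrightarrow> A * 1\<^sub>m n = A"
  "A \<in> carrier_mat n n \<Longrightarrow> 1\<^sub>m n * A = A"
  by auto

lemma rep_carrier [simp]: "g \<in> carrier G \<Longrightarrow> \<rho> g \<in> carrier_mat n n"
  using rep by (simp add: is_rep_def)

lemma rep_one [simp]: "\<rho> \<one> = 1\<^sub>m n"
  using rep by (simp add: is_rep_def)

lemma rep_mult: "g \<in> carrier G \<Longrightarrow> h \<in> carrier G \<Longrightarrow> \<rho> (g \<otimes> h) = \<rho> g * \<rho> h"
  using rep by (simp add: is_rep_def)

lemma rep_inv [simp]:
  "g \<in> carrier G \<Longrightarrow> \<rho> g * \<rho> (inv g) = 1\<^sub>m n"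
  "g \<in> carrier G \<Longrightarrow> \<rho> (inv g) * \<rho> g = 1\<^sub>m n"
  by (simp_all add: rep_mult[symmetric])

lemma bij_mult_left: "g \<in> carrier G \<Longrightarrow> bij_betw (\<lambda>h. g \<otimes> h) (carrier G) (carrier G)"
  by (rule bij_betwI[where g = "\<lambda>h. inv g \<otimes> h"]) (auto simp: m_assoc[symmetric])

lemma bij_mult_right: "g \<in> carrier G \<Longrightarrow> bij_betw (\<lambda>h. h \<otimes> g) (carrier G) (carrier G)"
  by (rule bij_betwI[where g = "\<lambda>h. h \<otimes> inv g"]) (auto simp: m_assoc)

definition rker :: "'a set" where
  "rker = {g \<in> carrier G. \<rho> g = 1\<^sub>m n}"

text \<open>The center \<open>Z(\<chi>)\<close> of the character; \<open>rcenter_eq_ctr\<close>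
  relates it to the center of the quotient by the kernel.\<close>

definition rcenter :: "'a set" where
  "rcenter = {g \<in> carrier G. \<exists>c. \<rho> g = c \<cdot>\<^sub>m 1\<^sub>m n}"

lemma rker_subgroup: "subgroup rker G"
proof (rule subgroup.intro)
  show "inv x \<in> rker" if "x \<in> rker" for x
    using that rep_inv[of x] rep_carrier[of "inv x"] by (auto simp: rker_def)
qed (auto simp: rker_def rep_mult)

lemma trace_conj:
  assumes "g \<in> carrier G" "h \<in> carrier G"
  shows "mat_trace (\<rho> (inv h) * (\<rho> g * \<rho> h)) = mat_trace (\<rho> g)"
proof -
  have "mat_trace (\<rho> (inv h) * (\<rho> g * \<rho> h)) = mat_trace ((\<rho> g * \<rho> h) * \<rho> (inv h))"
    using assms by (intro mat_trace_comm[where n=n]) auto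
  also have "(\<rho> g * \<rho> h) * \<rho> (inv h) = \<rho> g"
    using assms by (simp add: assoc_mult_mat[of _ n n _ n _ n])
  finally show ?thesis .
qed

end

locale finite_irr_rep = finite_rep +
  assumes irr: "irr_rep G \<rho> n"
begin

lemma n_pos: "0 < n"
  using irr by (simp add: irr_rep_def)

text \<open>Over the complex numbers \<open>A\<close> has an eigenvalue, as \<open>n > 0\<close>.
  Its eigenspace is nonzero and invariant under every \<open>\<rho> g\<close>, so by irreducibility
  it is everything.\<close>

lemma schur:
  assumes A: "A \<in> carrier_mat n n" and comm: "\<And>g. g \<in> carrier G \<Longrightarrow> A * \<rho> g = \<rho> g * A"
  obtains c where "A = c \<cdot>\<^sub>m 1\<^sub>m n"
proof -
  obtain c where "c \<in> spectrum A" using spectrum_non_empty[OF A n_pos] by auto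
  then obtain v where v: "v \<in> carrier_vec n" "v \<noteq> 0\<^sub>v n" "A *\<^sub>v v = c \<cdot>\<^sub>v v"
    using A by (auto simp: spectrum_def eigenvalue_def eigenvector_def)
  define W where "W = {v \<in> carrier_vec n. A *\<^sub>v v = c \<cdot>\<^sub>v v}"
  have "is_subspace n W"
    using A by (auto simp: is_subspace_def W_def mult_add_distrib_mat_vec[OF A] mult_mat_vec[OF A]
        smult_add_distrib_vec smult_smult_assoc mult.commute intro!: eq_vecI)
  moreover have "\<rho> g *\<^sub>v w \<in> W" if g: "g \<in> carrier G" and w: "w \<in> W" for g w
  proof -
    have wc: "w \<in> carrier_vec n" "A *\<^sub>v w = c \<cdot>\<^sub>v w" using w by (auto simp: W_def)
    have "A *\<^sub>v (\<rho> g *\<^sub>v w) = (A * \<rho> g) *\<^sub>v w"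
      using assoc_mult_mat_vec[OF A rep_carrier[OF g] wc(1)] by simp
    also have "\<dots> = \<rho> g *\<^sub>v (A *\<^sub>v w)"
      unfolding comm[OF g] by (rule assoc_mult_mat_vec[OF rep_carrier[OF g] A wc(1)])
    also have "\<dots> = c \<cdot>\<^sub>v (\<rho> g *\<^sub>v w)"
      using wc mult_mat_vec[OF rep_carrier[OF g] wc(1)] by simp
    finally show ?thesis using mult_mat_vec_carrier[OF rep_carrier[OF g] wc(1)] by (simp add: W_def)
  qed
  ultimately have "W = carrier_vec n"
    using irr v unfolding irr_rep_def invariant_subspace_def W_def by blast
  then have W: "A *\<^sub>v v = c \<cdot>\<^sub>v v" if "v \<in> carrier_vec n" for v using that by (auto simp: W_def)
  have "A = c \<cdot>\<^sub>m 1\<^sub>m n"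
  proof (rule eq_matI)
    fix i j assume "i < dim_row (c \<cdot>\<^sub>m 1\<^sub>m n)" "j < dim_col (c \<cdot>\<^sub>m 1\<^sub>m n)"
    then have i: "i < n" and j: "j < n" by auto
    have "(A *\<^sub>v unit_vec n j) $ i = A $$ (i,j)" using A i j by simp
    then show "A $$ (i,j) = (c \<cdot>\<^sub>m 1\<^sub>m n) $$ (i,j)" using W[of "unit_vec n j"] i j by simp
  qed (use A in auto)
  then show thesis by (rule that)
qed

lemma rcenterI:
  assumes "z \<in> carrier G" "\<And>g. g \<in> carrier G \<Longrightarrow> \<rho> (z \<otimes> g) = \<rho> (g \<otimes> z)"
  shows "z \<in> rcenter"
  using schur[of "\<rho> z"] assms by (auto simp: rcenter_def rep_mult)

text \<open>The two positive definite averages below replace a choice of unitary structure: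
  \<open>\<rho> g Hr \<rho> g\<^sup>* = Hr\<close> and \<open>\<rho> g\<^sup>* Hl \<rho> g = Hl\<close>, so \<open>Hr Hl\<close> commutes with \<open>\<rho>\<close> and is a scalar
  by Schur's lemma. This makes \<open>\<rho> (g\<^sup>-\<^sup>1)\<close> similar to \<open>\<rho> g\<^sup>*\<close> without any matrix inversion.\<close>

definition Hl :: "complex mat" where "Hl = msum n (\<lambda>h. hadj (\<rho> h) * \<rho> h) (carrier G)"
definition Hr :: "complex mat" where "Hr = msum n (\<lambda>h. \<rho> h * hadj (\<rho> h)) (carrier G)"

lemma Hl_carrier [simp]: "Hl \<in> carrier_mat n n" by (simp add: Hl_def)
lemma Hr_carrier [simp]: "Hr \<in> carrier_mat n n" by (simp add: Hr_def)

lemma Hl_invariant: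
  assumes g: "g \<in> carrier G"
  shows "hadj (\<rho> g) * (Hl * \<rho> g) = Hl"
proof -
  have "hadj (\<rho> g) * (Hl * \<rho> g) = msum n (\<lambda>h. hadj (\<rho> g) * (hadj (\<rho> h) * \<rho> h * \<rho> g)) (carrier G)"
    unfolding Hl_def using g by (simp add: msum_mult_right msum_mult_left)
  also have "\<dots> = msum n (\<lambda>h. hadj (\<rho> (h \<otimes> g)) * \<rho> (h \<otimes> g)) (carrier G)"
    using g by (intro msum_cong) (simp add: rep_mult hadj_mult[of _ n] mat_assoc)
  also have "\<dots> = Hl" unfolding Hl_def by (rule msum_reindex_bij[OF bij_mult_right[OF g]])
  finally show ?thesis .
qed

lemma Hr_invariant:
  assumes g: "g \<in> carrier G"
  shows "\<rho> g * (Hr * hadj (\<rho> g)) = Hr"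
proof -
  have "\<rho> g * (Hr * hadj (\<rho> g)) = msum n (\<lambda>h. \<rho> g * (\<rho> h * hadj (\<rho> h) * hadj (\<rho> g))) (carrier G)"
    unfolding Hr_def using g by (simp add: msum_mult_right msum_mult_left)
  also have "\<dots> = msum n (\<lambda>h. \<rho> (g \<otimes> h) * hadj (\<rho> (g \<otimes> h))) (carrier G)"
    using g by (intro msum_cong) (simp add: rep_mult hadj_mult[of _ n] mat_assoc)
  also have "\<dots> = Hr" unfolding Hr_def by (rule msum_reindex_bij[OF bij_mult_left[OF g]])
  finally show ?thesis .
qed

lemma hadj_Hl: "hadj Hl = Hl" and hadj_Hr: "hadj Hr = Hr"
  unfolding Hl_def Hr_def
  by (auto simp: hadj_msum hadj_mult[of _ n] hadj_hadj intro!: msum_cong)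

text \<open>Expand both averages and move factors cyclically under the trace: each summand becomes
  the trace of \<open>X * hadj X\<close> with \<open>X = \<rho> g * Y * \<rho> h\<close>. The form
  is therefore nonnegative.\<close>

lemma trace_Hr_Hl:
  assumes Y: "Y \<in> carrier_mat n n"
  shows "mat_trace (Hr * (hadj Y * (Hl * Y))) =
    of_real (\<Sum>h\<in>carrier G. \<Sum>g\<in>carrier G. fnorm (\<rho> g * Y * \<rho> h))"
proof -
  have M: "hadj Y * (Hl * Y) = msum n (\<lambda>g. hadj Y * (hadj (\<rho> g) * \<rho> g * Y)) (carrier G)"
    unfolding Hl_def using Y by (simp add: msum_mult_right msum_mult_left)
  have Mc: "hadj Y * (Hl * Y) \<in> carrier_mat n n" using Y by simp
  have "mat_trace (Hr * (hadj Y * (Hl * Y)))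
      = (\<Sum>h\<in>carrier G. mat_trace (\<rho> h * hadj (\<rho> h) * (hadj Y * (Hl * Y))))"
    unfolding Hr_def using Mc by (simp add: msum_mult_right mat_trace_msum)
  also have "\<dots> = (\<Sum>h\<in>carrier G. \<Sum>g\<in>carrier G.
      mat_trace (\<rho> h * hadj (\<rho> h) * (hadj Y * (hadj (\<rho> g) * \<rho> g * Y))))"
    unfolding M using Y by (simp add: msum_mult_left mat_trace_msum)
  also have "\<dots> = (\<Sum>h\<in>carrier G. \<Sum>g\<in>carrier G. of_real (fnorm (\<rho> g * Y * \<rho> h)))"
  proof (intro sum.cong refl)
    fix h g assume h: "h \<in> carrier G" and g: "g \<in> carrier G"
    let ?Q = "\<rho> h * hadj (\<rho> h) * hadj Y * hadj (\<rho> g)"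
    have "mat_trace (\<rho> h * hadj (\<rho> h) * (hadj Y * (hadj (\<rho> g) * \<rho> g * Y)))
      = mat_trace (?Q * (\<rho> g * Y))" using Y g h by (simp add: mat_assoc)
    also have "\<dots> = mat_trace ((\<rho> g * Y) * ?Q)"
      using Y g h by (intro mat_trace_comm[where n=n]) auto
    also have "(\<rho> g * Y) * ?Q = (\<rho> g * Y * \<rho> h) * hadj (\<rho> g * Y * \<rho> h)"
      using Y g h by (simp add: mat_assoc hadj_mult[of _ n])
    also have "mat_trace \<dots> = of_real (fnorm (\<rho> g * Y * \<rho> h))"
      using Y g h by (intro mat_trace_mult_hadj[where n=n]) auto
    finally show "mat_trace (\<rho> h * hadj (\<rho> h) * (hadj Y * (hadj (\<rho> g) * \<rho> g * Y)))
      = of_real (fnorm (\<rho> g * Y * \<rho> h))" .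
  qed
  finally show ?thesis by simp
qed

text \<open>All summands are nonnegative, hence zero, and the one with \<open>g = h = \<one>\<close>
  is \<open>fnorm Y\<close>. This is definiteness of the form.\<close>

lemma sum_fnorm_eq_0:
  assumes Y: "Y \<in> carrier_mat n n"
    and 0: "(\<Sum>h\<in>carrier G. \<Sum>g\<in>carrier G. fnorm (\<rho> g * Y * \<rho> h)) = 0"
  shows "Y = 0\<^sub>m n n"
proof -
  have "\<forall>h\<in>carrier G. (\<Sum>g\<in>carrier G. fnorm (\<rho> g * Y * \<rho> h)) = 0"
    using 0 sum_nonneg_eq_0_iff[OF finite_carrier, of "\<lambda>h. \<Sum>g\<in>carrier G. fnorm (\<rho> g * Y * \<rho> h)"]
    by (simp add: sum_nonneg fnorm_nonneg)
  then have "(\<Sum>g\<in>carrier G. fnorm (\<rho> g * Y * \<rho> \<one>)) = 0" using one_closed by blast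
  then have "\<forall>g\<in>carrier G. fnorm (\<rho> g * Y * \<rho> \<one>) = 0"
    using sum_nonneg_eq_0_iff[OF finite_carrier, of "\<lambda>g. fnorm (\<rho> g * Y * \<rho> \<one>)"]
    by (simp add: fnorm_nonneg)
  then have "fnorm (\<rho> \<one> * Y * \<rho> \<one>) = 0" using one_closed by blast
  then show ?thesis using fnorm_eq_0[OF Y] Y by simp
qed

text \<open>Invariance of both averages lets \<open>Hr * Hl\<close> commute with
  \<open>\<rho>\<close>. Its trace is the positive form at \<open>Y = 1\<close>, so the scalar is
  real and nonzero. Realness is what lets taking adjoints give the same scalar for
  \<open>Hl * Hr\<close>.\<close>

lemma Hr_Hl_scalar:
  obtains c :: real where "c \<noteq> 0" "Hr * Hl = of_real c \<cdot>\<^sub>m 1\<^sub>m n"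
proof -
  have "Hr * Hl * \<rho> g = \<rho> g * (Hr * Hl)" if g: "g \<in> carrier G" for g
  proof -
    have "Hr * Hl * \<rho> g = \<rho> g * (Hr * hadj (\<rho> g)) * Hl * \<rho> g" using Hr_invariant[OF g] by simp
    also have "\<dots> = \<rho> g * Hr * (hadj (\<rho> g) * (Hl * \<rho> g))" using g by (simp add: mat_assoc)
    also have "\<dots> = \<rho> g * (Hr * Hl)" unfolding Hl_invariant[OF g] using g by (simp add: mat_assoc)
    finally show ?thesis .
  qed
  then obtain d where d: "Hr * Hl = d \<cdot>\<^sub>m 1\<^sub>m n" using schur[of "Hr * Hl"] by auto
  define s where "s = (\<Sum>h\<in>carrier G. \<Sum>g\<in>carrier G. fnorm (\<rho> g * 1\<^sub>m n * \<rho> h))"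
  have "mat_trace (Hr * Hl) = of_real s"
    using trace_Hr_Hl[of "1\<^sub>m n"] by (simp add: s_def hadj_one)
  then have dn: "d * of_nat n = of_real s" unfolding d by (simp add: mat_trace_smult[of _ n] mat_trace_one)
  have "s \<noteq> 0"
  proof
    assume "s = 0"
    then have "1\<^sub>m n = (0\<^sub>m n n :: complex mat)"
      using sum_fnorm_eq_0[of "1\<^sub>m n"] by (simp add: s_def)
    then have "1\<^sub>m n $$ (0,0) = (0\<^sub>m n n :: complex mat) $$ (0,0)" by simp
    then show False using n_pos by simp
  qed
  moreover have "d = of_real (s / n)" using dn n_pos by (simp add: field_simps)
  ultimately show thesis using that[of "s / n"] d n_pos by simp
qed

text \<open>Invariance of \<open>Hl\<close> gives
  \<open>Hl * \<rho> (inv g) = hadj (\<rho> g) * Hl\<close>. Multiplying by \<open>Hr\<close> on the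
  left and taking traces leaves the common factor \<open>c\<close>, which cancels.\<close>

lemma trace_rep_inv:
  assumes g: "g \<in> carrier G"
  shows "mat_trace (\<rho> (inv g)) = cnj (mat_trace (\<rho> g))"
proof -
  obtain c :: real where c: "c \<noteq> 0" "Hr * Hl = of_real c \<cdot>\<^sub>m 1\<^sub>m n" by (rule Hr_Hl_scalar)
  have "hadj (Hr * Hl) = Hl * Hr" by (simp add: hadj_mult[of _ n] hadj_Hl hadj_Hr)
  then have lr: "Hl * Hr = of_real c \<cdot>\<^sub>m 1\<^sub>m n" unfolding c by (simp add: hadj_smult hadj_one)
  have "Hl * \<rho> (inv g) = hadj (\<rho> g) * (Hl * \<rho> g) * \<rho> (inv g)" using Hl_invariant[OF g] by simp
  also have "\<dots> = hadj (\<rho> g) * Hl" using g by (simp add: mat_assoc)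
  finally have e: "Hl * \<rho> (inv g) = hadj (\<rho> g) * Hl" .
  have "of_real c * mat_trace (\<rho> (inv g)) = mat_trace (Hr * Hl * \<rho> (inv g))"
    unfolding c using g by (simp add: mult_smult_assoc_mat[of _ n n _ n] mat_trace_smult[of _ n])
  also have "Hr * Hl * \<rho> (inv g) = (Hr * hadj (\<rho> g)) * Hl" using g e by (simp add: mat_assoc)
  also have "mat_trace \<dots> = mat_trace (Hl * (Hr * hadj (\<rho> g)))"
    using g by (intro mat_trace_comm[where n=n]) auto
  also have "Hl * (Hr * hadj (\<rho> g)) = (Hl * Hr) * hadj (\<rho> g)" using g by (simp add: mat_assoc)
  also have "mat_trace \<dots> = of_real c * cnj (mat_trace (\<rho> g))"
    unfolding lr using g
    by (simp add: mult_smult_assoc_mat[of _ n n _ n] mat_trace_smult[of _ n] mat_trace_hadj[of _ n])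
  finally show ?thesis using c by simp
qed

text \<open>For \<open>Y = \<rho> g - 1\<close> the positive form \<open>tr (Hr Y\<^sup>* Hl Y)\<close> is a multiple of \<open>n - Re (tr (\<rho> g))\<close>.\<close>

lemma trace_eq_dim_imp_one:
  assumes g: "g \<in> carrier G" and tr: "mat_trace (\<rho> g) = of_nat n"
  shows "\<rho> g = 1\<^sub>m n"
proof -
  obtain c :: real where c: "c \<noteq> 0" "Hr * Hl = of_real c \<cdot>\<^sub>m 1\<^sub>m n" by (rule Hr_Hl_scalar)
  define A where "A = \<rho> g"
  define A' where "A' = \<rho> (inv g)"
  define Y where "Y = A - 1\<^sub>m n"
  have cA: "A \<in> carrier_mat n n" "A' \<in> carrier_mat n n" "Y \<in> carrier_mat n n"
    using g by (auto simp: A_def A'_def Y_def)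
  have HA: "Hr * (hadj A * (Hl * A)) = Hr * Hl" using Hl_invariant[OF g] by (simp add: A_def)
  have "hadj A * Hl = hadj A * (Hl * A) * A'"
    using g by (simp add: A_def A'_def mat_assoc)
  then have e: "hadj A * Hl = Hl * A'" using Hl_invariant[OF g] by (simp add: A_def)
  have X1: "Hl * Y = Hl * A - Hl"
    unfolding Y_def using mult_minus_distrib_mat[OF Hl_carrier cA(1) one_carrier_mat] by simp
  have X2: "hadj Y = hadj A - 1\<^sub>m n"
    unfolding Y_def using cA by (simp add: hadj_minus[of _ n n] hadj_one)
  have "hadj Y * (Hl * Y) = hadj A * (Hl * Y) - Hl * Y"
    unfolding X2 using cA minus_mult_distrib_mat[of "hadj A" n n "1\<^sub>m n" "Hl * Y" n] by simp
  also have "hadj A * (Hl * Y) = hadj A * (Hl * A) - Hl * A'"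
    unfolding X1 e[symmetric] using cA
    by (intro mult_minus_distrib_mat[of _ n n _ n]) auto
  finally have XX: "hadj Y * (Hl * Y) = (hadj A * (Hl * A) - Hl * A') - (Hl * A - Hl)"
    unfolding X1 .
  have t1: "mat_trace (Hr * (Hl * B)) = of_real c * mat_trace B" if "B \<in> carrier_mat n n" for B
  proof -
    have "Hr * (Hl * B) = of_real c \<cdot>\<^sub>m B"
      using that mat_assoc[of Hr Hl B] c by (simp add: mult_smult_assoc_mat[of _ n n _ n])
    then show ?thesis using that by (simp add: mat_trace_smult[of _ n])
  qed
  have d1: "Hr * (hadj Y * (Hl * Y)) = (Hr * (hadj A * (Hl * A)) - Hr * (Hl * A')) - (Hr * (Hl * A) - Hr * Hl)"
  proof -
    have 1: "hadj A * (Hl * A) \<in> carrier_mat n n" "Hl * A' \<in> carrier_mat n n" "Hl * A \<in> carrier_mat n n"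
      using cA by auto
    then have 2: "hadj A * (Hl * A) - Hl * A' \<in> carrier_mat n n" "Hl * A - Hl \<in> carrier_mat n n"
      by (simp_all add: minus_carrier_mat)
    show ?thesis
      unfolding XX mult_minus_distrib_mat[OF Hr_carrier 2]
        mult_minus_distrib_mat[OF Hr_carrier 1(1,2)] mult_minus_distrib_mat[OF Hr_carrier 1(3) Hl_carrier] ..
  qed
  have t2: "mat_trace (Hr * Hl) = of_real c * of_nat n"
    using t1[of "1\<^sub>m n"] by (simp add: mat_trace_one)
  \<comment> \<open>The four traces are \<open>c\<close> times \<open>n\<close>, the conjugate of
    the trace of \<open>\<rho> g\<close>, that trace itself, and \<open>n\<close>. As the trace is
    \<open>n\<close>, they cancel.\<close>
  have "mat_trace (Hr * (hadj Y * (Hl * Y))) =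
      (mat_trace (Hr * (hadj A * (Hl * A))) - mat_trace (Hr * (Hl * A')))
      - (mat_trace (Hr * (Hl * A)) - mat_trace (Hr * Hl))"
  proof -
    have 1: "Hr * (hadj A * (Hl * A)) \<in> carrier_mat n n" "Hr * (Hl * A') \<in> carrier_mat n n"
      "Hr * (Hl * A) \<in> carrier_mat n n" "Hr * Hl \<in> carrier_mat n n"
      using cA by auto
    then have 2: "Hr * (hadj A * (Hl * A)) - Hr * (Hl * A') \<in> carrier_mat n n"
      "Hr * (Hl * A) - Hr * Hl \<in> carrier_mat n n"
      by (simp_all add: minus_carrier_mat)
    show ?thesis
      unfolding d1 mat_trace_minus[OF 2] mat_trace_minus[OF 1(1,2)] mat_trace_minus[OF 1(3,4)] ..
  qed
  also have "\<dots> = 0"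
    using HA t1[OF cA(1)] t1[OF cA(2)] t2 tr trace_rep_inv[OF g] by (simp add: A_def A'_def)
  finally have "(\<Sum>h\<in>carrier G. \<Sum>g\<in>carrier G. fnorm (\<rho> g * Y * \<rho> h)) = 0"
    unfolding trace_Hr_Hl[OF cA(3)] by (simp only: of_real_eq_0_iff)
  then have X0: "Y = 0\<^sub>m n n" by (rule sum_fnorm_eq_0[OF cA(3)])
  have "A = 1\<^sub>m n"
  proof (rule eq_matI)
    fix i j assume "i < dim_row (1\<^sub>m n)" "j < dim_col (1\<^sub>m n)"
    then have ij: "i < n" "j < n" by auto
    then have "Y $$ (i,j) = 0" using X0 by simp
    then show "A $$ (i,j) = 1\<^sub>m n $$ (i,j)" using ij cA by (simp add: Y_def)
  qed (use cA in auto)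
  then show ?thesis by (simp add: A_def)
qed

section \<open>Orthogonality and the center of a character\<close>

text \<open>The first orthogonality relation for a single character. Averaging a matrix over
  conjugation by \<open>\<rho>\<close> yields a scalar matrix by Schur's lemma, with scalar
  determined by the trace; matrix units turn this into relations between matrix entries.\<close>

lemma sum_trace_trace_inv:
  "(\<Sum>g\<in>carrier G. mat_trace (\<rho> g) * mat_trace (\<rho> (inv g))) = of_nat (card (carrier G))"
proof -
  define T where "T A = msum n (\<lambda>g. \<rho> g * (A * \<rho> (inv g))) (carrier G)" for A
  have T: "of_nat n * T A $$ (i,l) = (if i = l then of_nat (card (carrier G)) * mat_trace A else 0)"
    if A: "A \<in> carrier_mat n n" and il: "i < n" "l < n" for A i l
  proof -
    have "T A * \<rho> h = \<rho> h * T A" if h: "h \<in> carrier G" for h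
    proof -
      have "\<rho> h * T A = msum n (\<lambda>g. \<rho> h * (\<rho> g * (A * \<rho> (inv g)))) (carrier G)"
        unfolding T_def using A h by (simp add: msum_mult_left)
      also have "\<dots> = msum n (\<lambda>g. \<rho> (h \<otimes> g) * (A * \<rho> (inv (h \<otimes> g))) * \<rho> h) (carrier G)"
      proof (rule msum_cong)
        fix g assume g: "g \<in> carrier G"
        have "\<rho> (inv (h \<otimes> g)) * \<rho> h = \<rho> (inv g)"
          using g h by (simp add: inv_mult_group rep_mult mat_assoc)
        then show "\<rho> h * (\<rho> g * (A * \<rho> (inv g))) = \<rho> (h \<otimes> g) * (A * \<rho> (inv (h \<otimes> g))) * \<rho> h"
          using g h A by (simp add: mat_assoc rep_mult[of h g])
      qed
      also have "\<dots> = msum n (\<lambda>g. \<rho> g * (A * \<rho> (inv g)) * \<rho> h) (carrier G)"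
        by (rule msum_reindex_bij[OF bij_mult_left[OF h]])
      also have "\<dots> = T A * \<rho> h" unfolding T_def using A h by (simp add: msum_mult_right)
      finally show ?thesis by simp
    qed
    then obtain c where c: "T A = c \<cdot>\<^sub>m 1\<^sub>m n" using schur[of "T A"] by (auto simp: T_def)
    have "mat_trace (T A) = (\<Sum>g\<in>carrier G. mat_trace (\<rho> g * (A * \<rho> (inv g))))"
      unfolding T_def using A by (simp add: mat_trace_msum)
    also have "\<dots> = (\<Sum>g\<in>carrier G. mat_trace A)"
    proof (intro sum.cong refl)
      fix g assume g: "g \<in> carrier G"
      have "mat_trace (\<rho> g * (A * \<rho> (inv g))) = mat_trace ((A * \<rho> (inv g)) * \<rho> g)"
        using A g by (intro mat_trace_comm[where n=n]) auto
      then show "mat_trace (\<rho> g * (A * \<rho> (inv g))) = mat_trace A" using A g by (simp add: mat_assoc)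
    qed
    finally have "of_nat n * c = of_nat (card (carrier G)) * mat_trace A"
      unfolding c by (simp add: mat_trace_smult[of _ n] mat_trace_one mult.commute)
    then show ?thesis using il by (simp add: c)
  qed
  \<comment> \<open>Matrix units: the \<open>(i,l)\<close> entry of \<open>T (E j k)\<close> is the
    sum over \<open>g\<close> of \<open>\<rho> g $$ (i,j) * \<rho> (inv g) $$ (k,l)\<close>. The
    product of traces needs the entries with \<open>j = i\<close> and \<open>l = k\<close>.\<close>
  define E where "E j k = mat n n (\<lambda>(a,b). if a = j \<and> b = k then 1 else (0::complex))" for j k
  have Ec: "E j k \<in> carrier_mat n n" for j k by (simp add: E_def)
  have TE: "T (E j k) $$ (i,l) = (\<Sum>g\<in>carrier G. \<rho> g $$ (i,j) * \<rho> (inv g) $$ (k,l))"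
    if "i < n" "j < n" "k < n" "l < n" for i j k l
  proof -
    have "(\<rho> g * (E j k * \<rho> (inv g))) $$ (i,l) = \<rho> g $$ (i,j) * \<rho> (inv g) $$ (k,l)"
      if g: "g \<in> carrier G" for g
    proof -
      have e1: "(E j k * \<rho> (inv g)) $$ (a,l) = (if a = j then \<rho> (inv g) $$ (k,l) else 0)" if "a < n" for a
      proof -
        have "(E j k * \<rho> (inv g)) $$ (a,l) = (\<Sum>b<n. E j k $$ (a,b) * \<rho> (inv g) $$ (b,l))"
          using g \<open>l < n\<close> that by (intro mult_mat_entry[OF Ec]) auto
        also have "\<dots> = (\<Sum>b<n. if b = k then (if a = j then \<rho> (inv g) $$ (k,l) else 0) else 0)"
          using that by (intro sum.cong) (auto simp: E_def)
        finally show ?thesis using \<open>k < n\<close> by simp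
      qed
      have "(\<rho> g * (E j k * \<rho> (inv g))) $$ (i,l)
          = (\<Sum>a<n. \<rho> g $$ (i,a) * (E j k * \<rho> (inv g)) $$ (a,l))"
        using g Ec \<open>i < n\<close> \<open>l < n\<close> by (intro mult_mat_entry[where a=n and c=n]) auto
      also have "\<dots> = (\<Sum>a<n. if a = j then \<rho> g $$ (i,j) * \<rho> (inv g) $$ (k,l) else 0)"
        using e1 by (intro sum.cong) auto
      finally show ?thesis using \<open>j < n\<close> by simp
    qed
    then show ?thesis using that by (simp add: T_def msum_def)
  qed
  have trE: "mat_trace (E j k) = (if j = k then 1 else 0)" if "j < n" for j k
    using that by (simp add: mat_trace_carrier[OF Ec]) (auto simp: E_def)
  have "(\<Sum>g\<in>carrier G. mat_trace (\<rho> g) * mat_trace (\<rho> (inv g)))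
      = (\<Sum>g\<in>carrier G. \<Sum>i<n. \<Sum>k<n. \<rho> g $$ (i,i) * \<rho> (inv g) $$ (k,k))"
    by (intro sum.cong) (auto simp: mat_trace_carrier[where n=n] sum_product)
  also have "\<dots> = (\<Sum>i<n. \<Sum>g\<in>carrier G. \<Sum>k<n. \<rho> g $$ (i,i) * \<rho> (inv g) $$ (k,k))"
    by (rule sum.swap)
  also have "\<dots> = (\<Sum>i<n. \<Sum>k<n. \<Sum>g\<in>carrier G. \<rho> g $$ (i,i) * \<rho> (inv g) $$ (k,k))"
    by (intro sum.cong refl, rule sum.swap)
  also have "\<dots> = (\<Sum>i<n. \<Sum>k<n. T (E i k) $$ (i,k))"
    using TE by (intro sum.cong) auto
  finally have "of_nat n * (\<Sum>g\<in>carrier G. mat_trace (\<rho> g) * mat_trace (\<rho> (inv g)))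
     = (\<Sum>i<n. \<Sum>k<n. of_nat n * T (E i k) $$ (i,k))" by (simp add: sum_distrib_left)
  also have "\<dots> = (\<Sum>i<n. \<Sum>k<n. if i = k then of_nat (card (carrier G)) else 0)"
    using T[OF Ec] trE by (intro sum.cong) auto
  also have "\<dots> = of_nat n * of_nat (card (carrier G))" by simp
  finally show ?thesis using n_pos by simp
qed

lemma sum_norm_trace:
  "(\<Sum>g\<in>carrier G. (cmod (mat_trace (\<rho> g)))\<^sup>2) = card (carrier G)"
proof -
  have "complex_of_real (\<Sum>g\<in>carrier G. (cmod (mat_trace (\<rho> g)))\<^sup>2) = of_nat (card (carrier G))"
    unfolding sum_trace_trace_inv[symmetric]
    by (auto simp: trace_rep_inv complex_mult_cnj cmod_power2 intro!: sum.cong)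
  then show ?thesis by (metis of_real_eq_iff of_real_of_nat_eq)
qed

text \<open>If \<open>\<rho> z\<close> is the scalar \<open>c\<close>, the trace of
  \<open>\<rho> z * \<rho> (inv z) = 1\<close> together with \<open>trace_rep_inv\<close> gives
  \<open>c * cnj c = 1\<close>.\<close>

lemma norm_trace_rcenter:
  assumes "z \<in> rcenter"
  shows "(cmod (mat_trace (\<rho> z)))\<^sup>2 = (real n)\<^sup>2"
proof -
  obtain c where z: "z \<in> carrier G" and c: "\<rho> z = c \<cdot>\<^sub>m 1\<^sub>m n" using assms by (auto simp: rcenter_def)
  have "\<rho> z * \<rho> (inv z) = c \<cdot>\<^sub>m \<rho> (inv z)"
    unfolding c using z by (simp add: mult_smult_assoc_mat[of _ n n _ n])
  then have "c * mat_trace (\<rho> (inv z)) = of_nat n"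
    using z by (metis inv_closed mat_trace_one mat_trace_smult rep_carrier rep_inv(1))
  then have "c * (cnj c * of_nat n) = of_nat n"
    using trace_rep_inv[OF z] by (simp add: c mat_trace_smult[of _ n] mat_trace_one)
  then have "(mat_trace (\<rho> z)) * cnj (mat_trace (\<rho> z)) = of_nat n * of_nat n"
    by (simp add: c mat_trace_smult[of _ n] mat_trace_one mult.assoc)
  then have "complex_of_real ((cmod (mat_trace (\<rho> z)))\<^sup>2) = complex_of_real ((real n)\<^sup>2)"
    by (simp only: complex_mult_cnj cmod_power2) (simp add: power2_eq_square)
  then show ?thesis by (simp only: of_real_eq_iff)
qed

text \<open>Keep only the central terms in \<open>sum_norm_trace\<close>; each of them equals
  \<open>n\<^sup>2\<close>.\<close>

lemma dim_sq_rcenter_le: "n\<^sup>2 * card rcenter \<le> card (carrier G)"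
proof -
  have sub: "rcenter \<subseteq> carrier G" by (auto simp: rcenter_def)
  have "real (n\<^sup>2 * card rcenter) = (\<Sum>z\<in>rcenter. (cmod (mat_trace (\<rho> z)))\<^sup>2)"
    using norm_trace_rcenter by simp
  also have "\<dots> \<le> (\<Sum>g\<in>carrier G. (cmod (mat_trace (\<rho> g)))\<^sup>2)"
    by (rule sum_mono2[OF finite_carrier sub]) simp
  finally show ?thesis unfolding sum_norm_trace by (simp only: of_nat_le_iff)
qed

text \<open>Here the character vanishes off \<open>rcenter\<close>: for such \<open>g\<close> some
  commutator with \<open>h\<close> acts as a scalar \<open>c \<noteq> 1\<close>, and conjugating by
  \<open>h\<close> shows that the trace of \<open>\<rho> g\<close> equals \<open>c\<close> times
  itself.\<close>

lemma dim_sq_rcenter_eq: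
  assumes com: "\<And>g h. g \<in> carrier G \<Longrightarrow> h \<in> carrier G \<Longrightarrow> g \<otimes> h \<otimes> inv g \<otimes> inv h \<in> rcenter"
  shows "n\<^sup>2 * card rcenter = card (carrier G)"
proof -
  have sub: "rcenter \<subseteq> carrier G" by (auto simp: rcenter_def)
  have 0: "mat_trace (\<rho> g) = 0" if g: "g \<in> carrier G" "g \<notin> rcenter" for g
  proof -
    obtain h where h: "h \<in> carrier G" "\<rho> (g \<otimes> h) \<noteq> \<rho> (h \<otimes> g)" using rcenterI[OF g(1)] g(2) by auto
    define k where "k = g \<otimes> h \<otimes> inv g \<otimes> inv h"
    obtain c where c: "\<rho> k = c \<cdot>\<^sub>m 1\<^sub>m n" and k: "k \<in> carrier G"
      using com[OF g(1) h(1)] by (auto simp: rcenter_def k_def)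
    have "k \<otimes> (h \<otimes> g) = g \<otimes> h" using g h by (simp add: k_def m_assoc) (simp add: m_assoc[symmetric])
    then have "\<rho> (g \<otimes> h) = \<rho> k * \<rho> (h \<otimes> g)" using k g h by (metis m_closed rep_mult)
    then have e: "\<rho> (g \<otimes> h) = c \<cdot>\<^sub>m \<rho> (h \<otimes> g)"
      using g h by (simp add: c mult_smult_assoc_mat[of _ n n _ n])
    have "c \<noteq> 1"
    proof
      assume "c = 1"
      then have "\<rho> (g \<otimes> h) = \<rho> (h \<otimes> g)" unfolding e using g h by (intro eq_matI) auto
      then show False using h by simp
    qed
    have "mat_trace (\<rho> g) = mat_trace (\<rho> (inv h) * (\<rho> g * \<rho> h))" using g h by (simp add: trace_conj)
    also have "\<rho> (inv h) * (\<rho> g * \<rho> h) = c \<cdot>\<^sub>m (\<rho> (inv h) * \<rho> (h \<otimes> g))"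
      using e g h by (simp add: rep_mult[symmetric] mult_smult_distrib[of _ n n _ n])
    also have "\<rho> (inv h) * \<rho> (h \<otimes> g) = \<rho> g"
      using g h by (simp add: rep_mult mat_assoc[symmetric])
    finally have "mat_trace (\<rho> g) = c * mat_trace (\<rho> g)" using g by (simp add: mat_trace_smult[of _ n])
    then show ?thesis using \<open>c \<noteq> 1\<close> by simp
  qed
  have "real (n\<^sup>2 * card rcenter) = (\<Sum>z\<in>rcenter. (cmod (mat_trace (\<rho> z)))\<^sup>2)"
    using norm_trace_rcenter by simp
  also have "\<dots> = (\<Sum>g\<in>carrier G. (cmod (mat_trace (\<rho> g)))\<^sup>2)"
    using 0 by (intro sum.mono_neutral_left[OF finite_carrier sub]) auto
  finally show ?thesis unfolding sum_norm_trace by (simp only: of_nat_eq_iff)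
qed

text \<open>The nontrivial inclusion is \<open>trace_eq_dim_imp_one\<close>. Codegrees can now be
  computed from the kernel of the representation.\<close>

lemma char_ker_character: "char_ker G (character G \<rho>) = rker"
proof -
  have "mat_trace (\<rho> g) = of_nat n \<longleftrightarrow> \<rho> g = 1\<^sub>m n" if "g \<in> carrier G" for g
    using trace_eq_dim_imp_one[OF that] mat_trace_one by metis
  then show ?thesis by (simp add: char_ker_def character_def rker_def mat_trace_one cong: conj_cong)
qed

lemma codeg_in_cod: "real (card (carrier G)) / real (card rker) / real n \<in> cod G"
proof -
  have "codeg G (character G \<rho>) \<in> cod G" using irr by (auto simp: cod_def Irr_def)
  then show ?thesis unfolding codeg_def char_ker_character
    by (simp add: character_def mat_trace_one)
qed

lemma dim_in_cd: "of_nat n \<in> cd G"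
proof -
  have "character G \<rho> \<one> \<in> cd G" using irr by (auto simp: cd_def Irr_def)
  then show ?thesis by (simp add: character_def mat_trace_one)
qed

end

section \<open>Separating normal subgroups\<close>

lemma mat_eq_by_vec:
  fixes A :: "complex mat"
  assumes A: "A \<in> carrier_mat a b" and B: "B \<in> carrier_mat a b"
    and eq: "\<And>v. v \<in> carrier_vec b \<Longrightarrow> A *\<^sub>v v = B *\<^sub>v v"
  shows "A = B"
proof (rule eq_matI)
  fix i j assume "i < dim_row B" "j < dim_col B"
  then have i: "i < a" and j: "j < b" using B by auto
  have "(A *\<^sub>v unit_vec b j) $ i = A $$ (i,j)" "(B *\<^sub>v unit_vec b j) $ i = B $$ (i,j)"
    using A B i j by simp_all
  then show "A $$ (i,j) = B $$ (i,j)" using eq[of "unit_vec b j"] by simp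
qed (use A B in auto)

text \<open>In the coordinates of a frame \<open>B\<close> with left inverse \<open>C\<close>, the
  action on \<open>W\<close> is \<open>\<sigma> g = C * (\<rho> g * B)\<close>. Multiplicativity is
  checked after applying the injective map \<open>B\<close>. The last conclusion makes the dimension
  drop for proper \<open>W\<close>.\<close>

lemma invariant_subspace_rep:
  fixes G :: "('g,'b) monoid_scheme"
  assumes grp: "group G" and rep: "is_rep G \<rho> n" and W: "invariant_subspace G \<rho> n W" "W \<noteq> {0\<^sub>v n}"
  obtains k \<sigma> B where "0 < k" "is_rep G \<sigma> k" "B \<in> carrier_mat n k" "W = (*\<^sub>v) B ` carrier_vec k"
    "inj_on ((*\<^sub>v) B) (carrier_vec k)"
    "\<forall>g\<in>carrier G. \<forall>v\<in>carrier_vec k. \<rho> g *\<^sub>v (B *\<^sub>v v) = B *\<^sub>v (\<sigma> g *\<^sub>v v)"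
    "W = carrier_vec n \<or> k < n"
proof -
  interpret group G by (rule grp)
  from W have sub: "is_subspace n W" and inv: "\<And>g w. g \<in> carrier G \<Longrightarrow> w \<in> W \<Longrightarrow> \<rho> g *\<^sub>v w \<in> W"
    by (auto simp: invariant_subspace_def)
  from sub W(2) obtain k B C where k: "0 < k" and B: "B \<in> carrier_mat n k" and C: "C \<in> carrier_mat k n"
    and CB: "C * B = 1\<^sub>m k" and img: "W = (*\<^sub>v) B ` carrier_vec k" and kn: "W = carrier_vec n \<or> k < n"
    by (rule subspace_frame)
  have \<rho>c: "\<rho> g \<in> carrier_mat n n" if "g \<in> carrier G" for g using rep that by (simp add: is_rep_def)
  have CBv: "C *\<^sub>v (B *\<^sub>v v) = v" if "v \<in> carrier_vec k" for v
    using assoc_mult_mat_vec[OF C B that] CB that by simp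
  have Bc: "B *\<^sub>v v \<in> carrier_vec n" if "v \<in> carrier_vec k" for v using B that by (rule mult_mat_vec_carrier)
  have inj: "v = w" if "v \<in> carrier_vec k" "w \<in> carrier_vec k" "B *\<^sub>v v = B *\<^sub>v w" for v w
    using CBv that by metis
  define \<sigma> where "\<sigma> g = C * (\<rho> g * B)" for g
  have \<sigma>c: "\<sigma> g \<in> carrier_mat k k" if "g \<in> carrier G" for g
    using \<rho>c[OF that] B C by (simp add: \<sigma>_def)
  have \<sigma>v: "\<sigma> g *\<^sub>v v = C *\<^sub>v (\<rho> g *\<^sub>v (B *\<^sub>v v))" if g: "g \<in> carrier G" and v: "v \<in> carrier_vec k" for g v
    unfolding \<sigma>_def using assoc_mult_mat_vec[OF C mult_carrier_mat[OF \<rho>c[OF g] B] v]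
      assoc_mult_mat_vec[OF \<rho>c[OF g] B v] by simp
  have int: "\<rho> g *\<^sub>v (B *\<^sub>v v) = B *\<^sub>v (\<sigma> g *\<^sub>v v)" if g: "g \<in> carrier G" and v: "v \<in> carrier_vec k" for g v
  proof -
    have "B *\<^sub>v v \<in> W" using img v by auto
    then have "\<rho> g *\<^sub>v (B *\<^sub>v v) \<in> W" by (rule inv[OF g])
    then obtain u where u: "u \<in> carrier_vec k" "\<rho> g *\<^sub>v (B *\<^sub>v v) = B *\<^sub>v u" using img by auto
    then show ?thesis using \<sigma>v[OF g v] CBv by simp
  qed
  have "is_rep G \<sigma> k"
    unfolding is_rep_def
  proof (intro conjI ballI)
    show "\<sigma> \<one>\<^bsub>G\<^esub> = 1\<^sub>m k" using rep B CB by (simp add: \<sigma>_def is_rep_def)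
  next
    fix g h assume g: "g \<in> carrier G" and h: "h \<in> carrier G"
    show "\<sigma> (g \<otimes>\<^bsub>G\<^esub> h) = \<sigma> g * \<sigma> h"
    proof (rule mat_eq_by_vec[of _ k k])
      fix v :: "complex vec" assume v: "v \<in> carrier_vec k"
      have hv: "\<sigma> h *\<^sub>v v \<in> carrier_vec k" using \<sigma>c[OF h] v by (rule mult_mat_vec_carrier)
      have "B *\<^sub>v (\<sigma> (g \<otimes>\<^bsub>G\<^esub> h) *\<^sub>v v) = \<rho> (g \<otimes>\<^bsub>G\<^esub> h) *\<^sub>v (B *\<^sub>v v)"
        using int[OF m_closed[OF g h] v] by simp
      also have "\<dots> = \<rho> g *\<^sub>v (\<rho> h *\<^sub>v (B *\<^sub>v v))"
        using rep g h assoc_mult_mat_vec[OF \<rho>c[OF g] \<rho>c[OF h] Bc[OF v]] by (simp add: is_rep_def)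
      also have "\<dots> = B *\<^sub>v (\<sigma> g *\<^sub>v (\<sigma> h *\<^sub>v v))"
        using int[OF h v] int[OF g hv] by simp
      also have "\<dots> = B *\<^sub>v ((\<sigma> g * \<sigma> h) *\<^sub>v v)"
        using assoc_mult_mat_vec[OF \<sigma>c[OF g] \<sigma>c[OF h] v] by simp
      finally show "\<sigma> (g \<otimes>\<^bsub>G\<^esub> h) *\<^sub>v v = (\<sigma> g * \<sigma> h) *\<^sub>v v"
        by (rule inj[rotated 2])
          (use \<sigma>c[OF m_closed[OF g h]] \<sigma>c[OF g] \<sigma>c[OF h] v in \<open>auto intro!: mult_mat_vec_carrier[of _ k k]\<close>)
    qed (use \<sigma>c g h in \<open>auto intro!: mult_carrier_mat[of _ k k]\<close>)
  qed (use \<sigma>c in auto)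
  moreover have "inj_on ((*\<^sub>v) B) (carrier_vec k)" by (rule inj_onI) (rule inj)
  ultimately show thesis using that[OF k _ B img _ _ kn] int by blast
qed

text \<open>Having no nonzero \<open>M\<close>-fixed vector is inherited by subrepresentations, so a representation
  of least positive dimension with this property is irreducible, and no complete reducibility
  is needed.\<close>

definition fixed_free_rep ::
  "('g,'b) monoid_scheme \<Rightarrow> 'g set \<Rightarrow> 'g set \<Rightarrow> ('g \<Rightarrow> complex mat) \<Rightarrow> nat \<Rightarrow> bool" where
  "fixed_free_rep G N M \<rho> n \<longleftrightarrow> 0 < n \<and> is_rep G \<rho> n \<and> (\<forall>x\<in>N. \<rho> x = 1\<^sub>m n) \<and>
     (\<forall>v\<in>carrier_vec n. (\<forall>m\<in>M. \<rho> m *\<^sub>v v = v) \<longrightarrow> v = 0\<^sub>v n)"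

text \<open>The conditions on \<open>N\<close> and \<open>M\<close> are asked only on
  \<open>W\<close>, so the lemma serves both to cut a suitable piece out of the regular
  representation and to pass to a subrepresentation of a fixed-free one.\<close>

lemma fixed_free_subrep:
  fixes G :: "('g,'b) monoid_scheme"
  assumes grp: "group G" and NM: "N \<subseteq> carrier G" "M \<subseteq> carrier G" and rep: "is_rep G \<rho> n"
    and W: "invariant_subspace G \<rho> n W" "W \<noteq> {0\<^sub>v n}"
    and WN: "\<And>x v. x \<in> N \<Longrightarrow> v \<in> W \<Longrightarrow> \<rho> x *\<^sub>v v = v"
    and WM: "\<And>v. v \<in> W \<Longrightarrow> (\<forall>m\<in>M. \<rho> m *\<^sub>v v = v) \<Longrightarrow> v = 0\<^sub>v n"
  obtains k \<sigma> where "fixed_free_rep G N M \<sigma> k" "W = carrier_vec n \<or> k < n"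
proof -
  obtain k \<sigma> B where k: "0 < k" and \<sigma>: "is_rep G \<sigma> k" and B: "B \<in> carrier_mat n k"
    and img: "W = (*\<^sub>v) B ` carrier_vec k"
    and inj: "inj_on ((*\<^sub>v) B) (carrier_vec k)"
    and int: "\<forall>g\<in>carrier G. \<forall>v\<in>carrier_vec k. \<rho> g *\<^sub>v (B *\<^sub>v v) = B *\<^sub>v (\<sigma> g *\<^sub>v v)"
    and kn: "W = carrier_vec n \<or> k < n"
    by (rule invariant_subspace_rep[OF grp rep W])
  have \<sigma>c: "\<sigma> g \<in> carrier_mat k k" if "g \<in> carrier G" for g using \<sigma> that by (simp add: is_rep_def)
  have BW: "B *\<^sub>v v \<in> W" if "v \<in> carrier_vec k" for v using img that by auto
  have "\<sigma> x = 1\<^sub>m k" if x: "x \<in> N" for x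
  proof (rule mat_eq_by_vec[of _ k k])
    fix v :: "complex vec" assume v: "v \<in> carrier_vec k"
    have xG: "x \<in> carrier G" using x NM by auto
    have "B *\<^sub>v (\<sigma> x *\<^sub>v v) = B *\<^sub>v v" using int xG v WN[OF x BW[OF v]] by auto
    then have "\<sigma> x *\<^sub>v v = v" using inj_onD[OF inj] mult_mat_vec_carrier[OF \<sigma>c[OF xG] v] v by blast
    then show "\<sigma> x *\<^sub>v v = 1\<^sub>m k *\<^sub>v v" using v by simp
  qed (use \<sigma>c x NM in auto)
  moreover have "v = 0\<^sub>v k" if v: "v \<in> carrier_vec k" and fx: "\<forall>m\<in>M. \<sigma> m *\<^sub>v v = v" for v
  proof -
    have "\<forall>m\<in>M. \<rho> m *\<^sub>v (B *\<^sub>v v) = B *\<^sub>v v" 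
    proof
      fix m assume m: "m \<in> M"
      then show "\<rho> m *\<^sub>v (B *\<^sub>v v) = B *\<^sub>v v" using int fx NM v by (metis subsetD)
    qed
    then have "B *\<^sub>v v = 0\<^sub>v n" by (rule WM[OF BW[OF v]])
    moreover have "B *\<^sub>v 0\<^sub>v k = 0\<^sub>v n" using B by (intro eq_vecI) auto
    ultimately show ?thesis using inj_onD[OF inj] v by (metis zero_carrier_vec)
  qed
  ultimately have "fixed_free_rep G N M \<sigma> k" using k \<sigma> unfolding fixed_free_rep_def by blast
  from that[OF this kn] show thesis by assumption
qed

text \<open>Inside the regular representation take the functions that are constant on cosets of
  \<open>N\<close> and sum to zero on cosets of \<open>M\<close>. An \<open>M\<close>-fixed one is
  constant on each coset of \<open>M\<close>, so its value times \<open>card M\<close> is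
  zero.\<close>

lemma fixed_free_rep_exists:
  fixes G :: "('g,'b) monoid_scheme"
  assumes grp: "group G" and fin: "finite (carrier G)" and N: "N \<lhd> G" and M: "M \<lhd> G" and NM: "N \<subset> M"
  obtains \<rho> n where "fixed_free_rep G N M \<rho> n"
proof -
  interpret group G by (rule grp)
  interpret N: normal N G by (rule N)
  interpret M: normal M G by (rule M)
  have finM: "finite M" using fin M.subset finite_subset by blast
  define d where "d = card (carrier G)"
  obtain e where e: "bij_betw e {..<d} (carrier G)"
    unfolding d_def using ex_bij_betw_nat_finite[OF fin] by (auto simp: lessThan_atLeast0)
  define idx where "idx = the_inv_into {..<d} e"
  have ec: "e i \<in> carrier G" if "i < d" for i using e that by (auto simp: bij_betw_def)
  have idx: "idx x < d" "e (idx x) = x" if "x \<in> carrier G" for x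
    using e that the_inv_into_into[of e "{..<d}" x "{..<d}"] f_the_inv_into_f[of e "{..<d}" x]
    by (auto simp: idx_def bij_betw_def)
  have idxe: "idx (e i) = i" if "i < d" for i
    using e that by (simp add: idx_def bij_betw_def the_inv_into_f_f)
  \<comment> \<open>Reads a vector as a function on the group, through the enumeration
    \<open>e\<close> of its elements.\<close>
  define F where "F v x = v $ idx x" for v :: "complex vec" and x
  have F_eqI: "v = w" if "v \<in> carrier_vec d" "w \<in> carrier_vec d" "\<And>x. x \<in> carrier G \<Longrightarrow> F v x = F w x" for v w
  proof (rule eq_vecI)
    fix i assume "i < dim_vec w"
    then have "i < d" using that by simp
    then show "v $ i = w $ i" using that(3)[OF ec] by (simp add: F_def idxe)
  qed (use that in simp)
  \<comment> \<open>The permutation matrices of left multiplication; on functions they act by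
    \<open>f(x)\<close> becoming \<open>f(inv g x)\<close>, which is \<open>P_F\<close>.\<close>
  define P :: "'g \<Rightarrow> complex mat" where
    "P g = mat d d (\<lambda>(i,j). if e i = g \<otimes>\<^bsub>G\<^esub> e j then 1 else 0)" for g
  have Pc: "P g \<in> carrier_mat d d" for g by (simp add: P_def)
  have P_F: "F (P g *\<^sub>v v) x = F v (inv\<^bsub>G\<^esub> g \<otimes>\<^bsub>G\<^esub> x)"
    if g: "g \<in> carrier G" and x: "x \<in> carrier G" and v: "v \<in> carrier_vec d" for g x v
  proof -
    have gx: "inv\<^bsub>G\<^esub> g \<otimes>\<^bsub>G\<^esub> x \<in> carrier G" using g x by simp
    have key: "x = g \<otimes>\<^bsub>G\<^esub> e j \<longleftrightarrow> j = idx (inv\<^bsub>G\<^esub> g \<otimes>\<^bsub>G\<^esub> x)" if "j < d" for j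
    proof
      assume "x = g \<otimes>\<^bsub>G\<^esub> e j"
      then have "inv\<^bsub>G\<^esub> g \<otimes>\<^bsub>G\<^esub> x = e j" using g ec[OF that] by (simp add: m_assoc[symmetric])
      then show "j = idx (inv\<^bsub>G\<^esub> g \<otimes>\<^bsub>G\<^esub> x)" using idxe[OF that] by simp
    next
      assume "j = idx (inv\<^bsub>G\<^esub> g \<otimes>\<^bsub>G\<^esub> x)"
      then show "x = g \<otimes>\<^bsub>G\<^esub> e j" using g x idx[OF gx] by (simp add: m_assoc[symmetric])
    qed
    have "F (P g *\<^sub>v v) x = (\<Sum>j<d. P g $$ (idx x, j) * v $ j)"
      unfolding F_def by (rule mult_mat_vec_entry[OF Pc v idx(1)[OF x]])
    also have "\<dots> = (\<Sum>j<d. if j = idx (inv\<^bsub>G\<^esub> g \<otimes>\<^bsub>G\<^esub> x) then v $ j else 0)"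
      using idx[OF x] key by (intro sum.cong) (auto simp: P_def)
    also have "\<dots> = F v (inv\<^bsub>G\<^esub> g \<otimes>\<^bsub>G\<^esub> x)" using idx(1)[OF gx] by (simp add: F_def)
    finally show ?thesis .
  qed
  have Pvc: "P g *\<^sub>v v \<in> carrier_vec d" for g v using Pc[of g] by (simp add: carrier_vecI)
  have rep: "is_rep G P d"
    unfolding is_rep_def
  proof (intro conjI ballI Pc)
    show "P \<one>\<^bsub>G\<^esub> = 1\<^sub>m d"
    proof (rule mat_eq_by_vec[OF Pc one_carrier_mat])
      fix v :: "complex vec" assume v: "v \<in> carrier_vec d"
      have "P \<one>\<^bsub>G\<^esub> *\<^sub>v v = v" by (rule F_eqI[OF Pvc v]) (use v P_F in simp)
      then show "P \<one>\<^bsub>G\<^esub> *\<^sub>v v = 1\<^sub>m d *\<^sub>v v" using v by simp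
    qed
  next
    fix g h assume g: "g \<in> carrier G" and h: "h \<in> carrier G"
    show "P (g \<otimes>\<^bsub>G\<^esub> h) = P g * P h"
    proof (rule mat_eq_by_vec[OF Pc mult_carrier_mat[OF Pc Pc]])
      fix v :: "complex vec" assume v: "v \<in> carrier_vec d"
      have "P (g \<otimes>\<^bsub>G\<^esub> h) *\<^sub>v v = P g *\<^sub>v (P h *\<^sub>v v)"
      proof (rule F_eqI[OF Pvc Pvc])
        fix x assume x: "x \<in> carrier G"
        show "F (P (g \<otimes>\<^bsub>G\<^esub> h) *\<^sub>v v) x = F (P g *\<^sub>v (P h *\<^sub>v v)) x"
          using P_F[OF m_closed[OF g h] x v] P_F[OF g x Pvc] P_F[OF h m_closed[OF inv_closed[OF g] x] v]
            g h x by (simp add: inv_mult_group m_assoc)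
      qed
      then show "P (g \<otimes>\<^bsub>G\<^esub> h) *\<^sub>v v = (P g * P h) *\<^sub>v v"
        using assoc_mult_mat_vec[OF Pc Pc v] by simp
    qed
  qed
  define W where "W = {v \<in> carrier_vec d. (\<forall>x\<in>N. \<forall>y\<in>carrier G. F v (x \<otimes>\<^bsub>G\<^esub> y) = F v y) \<and>
    (\<forall>y\<in>carrier G. (\<Sum>m\<in>M. F v (m \<otimes>\<^bsub>G\<^esub> y)) = 0)}"
  have F_add: "F (v + w) x = F v x + F w x" if "v \<in> carrier_vec d" "w \<in> carrier_vec d" "x \<in> carrier G" for v w x
    using idx(1)[OF that(3)] that(1,2) by (simp add: F_def)
  have F_smult: "F (c \<cdot>\<^sub>v v) x = c * F v x" if "v \<in> carrier_vec d" "x \<in> carrier G" for v c x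
    using idx(1)[OF that(2)] that(1) by (simp add: F_def)
  have F_0: "F (0\<^sub>v d) x = 0" if "x \<in> carrier G" for x
    using idx(1)[OF that] by (simp add: F_def)
  have MG: "m \<in> carrier G" if "m \<in> M" for m using M.subset that by auto
  have NG: "m \<in> carrier G" if "m \<in> N" for m using N.subset that by auto
  have sub: "is_subspace d W"
    unfolding is_subspace_def
  proof (intro conjI ballI allI)
    show "W \<subseteq> carrier_vec d" by (auto simp: W_def)
    show "0\<^sub>v d \<in> W" by (simp add: W_def F_0 MG NG)
    show "v + w \<in> W" if "v \<in> W" "w \<in> W" for v w
      using that by (simp add: W_def F_add MG NG sum.distrib)
    show "c \<cdot>\<^sub>v v \<in> W" if "v \<in> W" for v c
      using that by (simp add: W_def F_smult MG NG sum_distrib_left[symmetric])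
  qed
  have inv: "invariant_subspace G P d W"
    unfolding invariant_subspace_def
  proof (intro conjI ballI sub)
    fix g v assume g: "g \<in> carrier G" and v: "v \<in> W"
    have vc: "v \<in> carrier_vec d" using v by (simp add: W_def)
    let ?c = "\<lambda>x. inv\<^bsub>G\<^esub> g \<otimes>\<^bsub>G\<^esub> x \<otimes>\<^bsub>G\<^esub> g"
    \<comment> \<open>Translation turns left multiplication by \<open>x\<close> into left
      multiplication by a conjugate of \<open>x\<close>; both conditions defining \<open>W\<close>
      survive because \<open>N\<close> and \<open>M\<close> are normal.\<close>
    have shift: "inv\<^bsub>G\<^esub> g \<otimes>\<^bsub>G\<^esub> (x \<otimes>\<^bsub>G\<^esub> y) = ?c x \<otimes>\<^bsub>G\<^esub> (inv\<^bsub>G\<^esub> g \<otimes>\<^bsub>G\<^esub> y)"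
      if "x \<in> carrier G" "y \<in> carrier G" for x y
      using that g by (simp add: m_assoc) (simp add: m_assoc[symmetric])
    have "F (P g *\<^sub>v v) (x \<otimes>\<^bsub>G\<^esub> y) = F (P g *\<^sub>v v) y" if x: "x \<in> N" and y: "y \<in> carrier G" for x y
    proof -
      have "?c x \<in> N" using N.inv_op_closed1[OF g x] .
      then show ?thesis using v g x y NG P_F[OF g _ vc] shift by (simp add: W_def)
    qed
    moreover have "(\<Sum>m\<in>M. F (P g *\<^sub>v v) (m \<otimes>\<^bsub>G\<^esub> y)) = 0" if y: "y \<in> carrier G" for y
    proof -
      have b: "bij_betw ?c M M"
      proof (rule bij_betwI[where g = "\<lambda>x. g \<otimes>\<^bsub>G\<^esub> x \<otimes>\<^bsub>G\<^esub> inv\<^bsub>G\<^esub> g"])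
        show "?c \<in> M \<rightarrow> M" using M.inv_op_closed1[OF g] by auto
        show "(\<lambda>x. g \<otimes>\<^bsub>G\<^esub> x \<otimes>\<^bsub>G\<^esub> inv\<^bsub>G\<^esub> g) \<in> M \<rightarrow> M" using M.inv_op_closed2[OF g] by auto
        show "g \<otimes>\<^bsub>G\<^esub> (inv\<^bsub>G\<^esub> g \<otimes>\<^bsub>G\<^esub> x \<otimes>\<^bsub>G\<^esub> g) \<otimes>\<^bsub>G\<^esub> inv\<^bsub>G\<^esub> g = x" if "x \<in> M" for x
          using MG[OF that] g by (simp add: m_assoc) (simp add: m_assoc[symmetric])
        show "inv\<^bsub>G\<^esub> g \<otimes>\<^bsub>G\<^esub> (g \<otimes>\<^bsub>G\<^esub> x \<otimes>\<^bsub>G\<^esub> inv\<^bsub>G\<^esub> g) \<otimes>\<^bsub>G\<^esub> g = x" if "x \<in> M" for x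
          using MG[OF that] g by (simp add: m_assoc) (simp add: m_assoc[symmetric])
      qed
      have "(\<Sum>m\<in>M. F (P g *\<^sub>v v) (m \<otimes>\<^bsub>G\<^esub> y)) = (\<Sum>m\<in>M. F v (?c m \<otimes>\<^bsub>G\<^esub> (inv\<^bsub>G\<^esub> g \<otimes>\<^bsub>G\<^esub> y)))"
        using y MG P_F[OF g _ vc] shift by (intro sum.cong) auto
      also have "\<dots> = (\<Sum>m\<in>M. F v (m \<otimes>\<^bsub>G\<^esub> (inv\<^bsub>G\<^esub> g \<otimes>\<^bsub>G\<^esub> y)))"
        by (rule sum.reindex_bij_betw[OF b])
      also have "\<dots> = 0" using v y g by (simp add: W_def)
      finally show ?thesis .
    qed
    ultimately show "P g *\<^sub>v v \<in> W" using Pvc by (simp add: W_def)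
  qed
  have "W \<noteq> {0\<^sub>v d}"
  proof
    assume W0: "W = {0\<^sub>v d}"
    \<comment> \<open>The ratio is chosen so that \<open>f\<close>, the indicator of
      \<open>N\<close> minus \<open>q\<close> times that of \<open>M\<close>, sums to zero on
      \<open>M\<close>. Since \<open>N\<close> is proper in \<open>M\<close>,
      \<open>q \<noteq> 1\<close> and \<open>f\<close> does not vanish at the identity.\<close>
    define q :: complex where "q = of_nat (card N) / of_nat (card M)"
    define f :: "'g \<Rightarrow> complex" where "f x = (if x \<in> N then 1 else 0) - (if x \<in> M then q else 0)" for x
    define v where "v = vec d (\<lambda>i. f (e i))"
    have vc: "v \<in> carrier_vec d" by (simp add: v_def)
    have Ff: "F v x = f x" if "x \<in> carrier G" for x using idx[OF that] by (simp add: F_def v_def)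
    have Npos: "card N < card M" by (rule psubset_card_mono[OF finM NM])
    have mulM: "m \<otimes>\<^bsub>G\<^esub> y \<in> M \<longleftrightarrow> y \<in> M" if "m \<in> M" "y \<in> carrier G" for m y
      by (metis M.m_closed M.m_inv_closed MG inv_solve_left m_closed that)
    have mulN: "m \<otimes>\<^bsub>G\<^esub> y \<in> N \<longleftrightarrow> y \<in> N" if "m \<in> N" "y \<in> carrier G" for m y
      by (metis N.m_closed N.m_inv_closed NG inv_solve_left m_closed that)
    have "f (x \<otimes>\<^bsub>G\<^esub> y) = f y" if "x \<in> N" "y \<in> carrier G" for x y
      using that mulN mulM NM by (auto simp: f_def)
    moreover have "(\<Sum>m\<in>M. f (m \<otimes>\<^bsub>G\<^esub> y)) = 0" if y: "y \<in> carrier G" for y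
    proof (cases "y \<in> M")
      case True
      have b: "bij_betw (\<lambda>m. m \<otimes>\<^bsub>G\<^esub> y) M M"
        by (rule bij_betwI[where g = "\<lambda>m. m \<otimes>\<^bsub>G\<^esub> inv\<^bsub>G\<^esub> y"])
          (use True MG y in \<open>auto simp: m_assoc\<close>)
      have "(\<Sum>m\<in>M. f (m \<otimes>\<^bsub>G\<^esub> y)) = (\<Sum>m\<in>M. f m)" by (rule sum.reindex_bij_betw[OF b])
      also have "\<dots> = (\<Sum>m\<in>M. if m \<in> N then 1 else 0) - of_nat (card M) * q"
        by (simp add: f_def sum_subtractf)
      also have "(\<Sum>m\<in>M. if m \<in> N then 1 else (0::complex)) = of_nat (card N)"
      proof -
        have "M \<inter> N = N" using NM by auto
        then show ?thesis using finM by (simp add: sum.inter_restrict[symmetric])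
      qed
      finally show ?thesis using Npos by (simp add: q_def)
    next
      case False
      then have "m \<otimes>\<^bsub>G\<^esub> y \<notin> M" if "m \<in> M" for m using mulM[OF that y] by simp
      then show ?thesis using NM by (intro sum.neutral) (auto simp: f_def)
    qed
    ultimately have "v \<in> W" using vc MG NG by (simp add: W_def Ff)
    then have "v = 0\<^sub>v d" using W0 by simp
    then have "f \<one>\<^bsub>G\<^esub> = 0" using Ff[OF one_closed] F_0[OF one_closed] by simp
    then have "q = 1" by (simp add: f_def)
    then show False using Npos by (simp add: q_def field_simps)
  qed
  then obtain k \<sigma> where "fixed_free_rep G N M \<sigma> k"
  proof (rule fixed_free_subrep[OF grp N.subset M.subset rep inv])
    fix x v assume x: "x \<in> N" and v: "v \<in> W"
    have vc: "v \<in> carrier_vec d" using v by (simp add: W_def)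
    show "P x *\<^sub>v v = v"
    proof (rule F_eqI[OF Pvc vc])
      fix y assume "y \<in> carrier G"
      then show "F (P x *\<^sub>v v) y = F v y" using P_F[OF NG[OF x] _ vc] v x by (simp add: W_def)
    qed
  next
    fix v assume v: "v \<in> W" and fx: "\<forall>m\<in>M. P m *\<^sub>v v = v"
    have vc: "v \<in> carrier_vec d" using v by (simp add: W_def)
    show "v = 0\<^sub>v d"
    proof (rule F_eqI[OF vc zero_carrier_vec])
      fix x assume x: "x \<in> carrier G"
      have "F v (m \<otimes>\<^bsub>G\<^esub> x) = F v x" if m: "m \<in> M" for m
        using P_F[OF inv_closed[OF MG[OF m]] x vc] fx m MG[OF m] by simp
      then have "(\<Sum>m\<in>M. F v (m \<otimes>\<^bsub>G\<^esub> x)) = of_nat (card M) * F v x" by simp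
      moreover have "(\<Sum>m\<in>M. F v (m \<otimes>\<^bsub>G\<^esub> x)) = 0" using v x by (simp add: W_def)
      moreover have "card M \<noteq> 0" using finM M.one_closed by (metis card_eq_0_iff empty_iff)
      ultimately show "F v x = F (0\<^sub>v d) x" using F_0[OF x] by simp
    qed
  qed blast
  then show thesis by (rule that)
qed

text \<open>A fixed-free representation of least dimension is irreducible, since a proper nonzero
  invariant subspace would carry a smaller one. It is nontrivial on \<open>M\<close>, as otherwise
  \<open>unit_vec n 0\<close> would be a nonzero fixed vector.\<close>

theorem irr_rep_separating_subset:
  fixes G :: "('g,'b) monoid_scheme"
  assumes grp: "group G" and fin: "finite (carrier G)" and N: "N \<lhd> G" and M: "M \<lhd> G" and NM: "N \<subset> M"
  obtains \<rho> n where "irr_rep G \<rho> n" "\<And>x. x \<in> N \<Longrightarrow> \<rho> x = 1\<^sub>m n" "\<exists>m\<in>M. \<rho> m \<noteq> 1\<^sub>m n"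
proof -
  interpret N: normal N G by (rule N)
  interpret M: normal M G by (rule M)
  define n where "n = (LEAST n. \<exists>\<rho>. fixed_free_rep G N M \<rho> n)"
  have "\<exists>n \<rho>. fixed_free_rep G N M \<rho> n" using fixed_free_rep_exists[OF assms] by metis
  then have "\<exists>\<rho>. fixed_free_rep G N M \<rho> n" unfolding n_def by (rule LeastI_ex)
  then obtain \<rho> where ff: "fixed_free_rep G N M \<rho> n" by blast
  have least: "\<not> fixed_free_rep G N M \<sigma> k" if "k < n" for k \<sigma>
    using not_less_Least[of k "\<lambda>n. \<exists>\<rho>. fixed_free_rep G N M \<rho> n"] that unfolding n_def by blast
  from ff have n: "0 < n" and rep: "is_rep G \<rho> n" and N1: "\<And>x. x \<in> N \<Longrightarrow> \<rho> x = 1\<^sub>m n"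
    and fr: "\<And>v. v \<in> carrier_vec n \<Longrightarrow> \<forall>m\<in>M. \<rho> m *\<^sub>v v = v \<Longrightarrow> v = 0\<^sub>v n"
    unfolding fixed_free_rep_def by auto
  have "W = {0\<^sub>v n} \<or> W = carrier_vec n" if W: "invariant_subspace G \<rho> n W" for W
  proof (rule ccontr)
    assume a: "\<not> (W = {0\<^sub>v n} \<or> W = carrier_vec n)"
    have Wc: "W \<subseteq> carrier_vec n" using W by (simp add: invariant_subspace_def is_subspace_def)
    obtain k \<sigma> where "fixed_free_rep G N M \<sigma> k" "W = carrier_vec n \<or> k < n"
    proof (rule fixed_free_subrep[OF grp N.subset M.subset rep W])
      show "W \<noteq> {0\<^sub>v n}" using a by blast
      show "\<rho> x *\<^sub>v v = v" if "x \<in> N" "v \<in> W" for x v using N1[OF that(1)] Wc that(2) by auto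
      show "v = 0\<^sub>v n" if "v \<in> W" "\<forall>m\<in>M. \<rho> m *\<^sub>v v = v" for v using fr[of v] that Wc by blast
    qed blast
    then show False using least a by blast
  qed
  then have "irr_rep G \<rho> n" using n rep unfolding irr_rep_def by blast
  moreover have "\<exists>m\<in>M. \<rho> m \<noteq> 1\<^sub>m n"
  proof (rule ccontr)
    assume "\<not> (\<exists>m\<in>M. \<rho> m \<noteq> 1\<^sub>m n)"
    then have "\<forall>m\<in>M. \<rho> m *\<^sub>v unit_vec n 0 = unit_vec n 0" by simp
    then have "(unit_vec n 0 :: complex vec) = 0\<^sub>v n" using fr by simp
    then have "(unit_vec n 0 :: complex vec) $ 0 = 0\<^sub>v n $ 0" by simp
    then show False using n by simp
  qed
  ultimately show thesis using that N1 by blast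
qed

section \<open>Commutators and central quotients\<close>

lemma card_le_fibre:
  assumes "finite A" "\<And>y. y \<in> f ` A \<Longrightarrow> card {x \<in> A. f x = y} \<le> m"
  shows "card A \<le> card (f ` A) * m"
proof -
  have "card A = (\<Sum>y\<in>f ` A. card {x \<in> A. f x = y})"
    using sum.image_gen[OF assms(1), of "\<lambda>_. 1::nat" f] by simp
  also have "\<dots> \<le> (\<Sum>y\<in>f ` A. m)" by (rule sum_mono[OF assms(2)])
  finally show ?thesis by simp
qed

lemma card_ge_fibre:
  assumes "finite A" "\<And>y. y \<in> f ` A \<Longrightarrow> m \<le> card {x \<in> A. f x = y}"
  shows "card (f ` A) * m \<le> card A"
proof -
  have "(\<Sum>y\<in>f ` A. m) \<le> (\<Sum>y\<in>f ` A. card {x \<in> A. f x = y})" by (rule sum_mono[OF assms(2)])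
  also have "\<dots> = card A"
    using sum.image_gen[OF assms(1), of "\<lambda>_. 1::nat" f] by simp
  finally show ?thesis by simp
qed

text \<open>Multiplication by \<open>w\<close> permutes \<open>S\<close>, so the nonzero product
  over \<open>S\<close> equals itself times \<open>w ^ card S\<close>.\<close>

lemma power_card_eq_1:
  fixes S :: "complex set"
  assumes "finite S" "0 \<notin> S" "w \<noteq> 0" "\<And>s. s \<in> S \<Longrightarrow> w * s \<in> S"
  shows "w ^ card S = 1"
proof -
  have inj: "inj_on ((*) w) S" using assms(3) by (auto intro!: inj_onI)
  have "(*) w ` S = S" using assms by (intro card_subset_eq) (auto simp: card_image[OF inj])
  then have "prod id S = prod id ((*) w ` S)" by simp
  also have "\<dots> = w ^ card S * prod id S" by (simp add: prod.reindex[OF inj] prod.distrib)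
  finally show ?thesis using assms(1,2) by simp
qed

context group
begin

lemma cancel_left [simp]:
  "x \<in> carrier G \<Longrightarrow> y \<in> carrier G \<Longrightarrow> x \<otimes> (inv x \<otimes> y) = y"
  "x \<in> carrier G \<Longrightarrow> y \<in> carrier G \<Longrightarrow> inv x \<otimes> (x \<otimes> y) = y"
  by (simp_all add: m_assoc[symmetric])

definition commutator :: "'a \<Rightarrow> 'a \<Rightarrow> 'a" where
  "commutator x y = x \<otimes> y \<otimes> inv x \<otimes> inv y"

lemma commutator_closed [simp]:
  "x \<in> carrier G \<Longrightarrow> y \<in> carrier G \<Longrightarrow> commutator x y \<in> carrier G"
  by (simp add: commutator_def)

text \<open>For normal \<open>K\<close>, \<open>ctr K\<close> is the preimage of the center of \<open>G/K\<close>, and \<open>cent K x\<close> that of the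
  centralizer of \<open>xK\<close>.\<close>

definition ctr :: "'a set \<Rightarrow> 'a set" where
  "ctr K = {x \<in> carrier G. \<forall>y\<in>carrier G. commutator x y \<in> K}"

definition cent :: "'a set \<Rightarrow> 'a \<Rightarrow> 'a set" where
  "cent K x = {y \<in> carrier G. commutator x y \<in> K}"

lemma normal_conj: "N \<lhd> G \<Longrightarrow> x \<in> N \<Longrightarrow> g \<in> carrier G \<Longrightarrow> g \<otimes> x \<otimes> inv g \<in> N"
  by (simp add: normal.inv_op_closed2)

lemma normal_conj': "N \<lhd> G \<Longrightarrow> x \<in> N \<Longrightarrow> g \<in> carrier G \<Longrightarrow> inv g \<otimes> x \<otimes> g \<in> N"
  by (simp add: normal.inv_op_closed1)

lemma normal_subset: "N \<lhd> G \<Longrightarrow> N \<subseteq> carrier G"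
  by (simp add: normal_def subgroup.subset)

lemma normal_subgroup: "N \<lhd> G \<Longrightarrow> subgroup N G"
  by (simp add: normal_def)

lemma cent_subgroup:
  assumes K: "K \<lhd> G" and x: "x \<in> carrier G"
  shows "subgroup (cent K x) G"
proof -
  interpret K: normal K G by (rule K)
  show ?thesis
  proof (rule subgroup.intro)
    show "cent K x \<subseteq> carrier G" by (auto simp: cent_def)
    show "\<one> \<in> cent K x" using x by (simp add: cent_def commutator_def)
    show "y \<otimes> z \<in> cent K x" if "y \<in> cent K x" "z \<in> cent K x" for y z
    proof -
      have yz: "y \<in> carrier G" "z \<in> carrier G" "commutator x y \<in> K" "commutator x z \<in> K"
        using that by (auto simp: cent_def)
      have "commutator x (y \<otimes> z) = commutator x y \<otimes> (y \<otimes> commutator x z \<otimes> inv y)"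
        using x yz by (simp add: commutator_def m_assoc inv_mult_group)
      then show ?thesis using yz normal_conj[OF K] by (simp add: cent_def)
    qed
    show "inv y \<in> cent K x" if "y \<in> cent K x" for y
    proof -
      have y: "y \<in> carrier G" "commutator x y \<in> K" using that by (auto simp: cent_def)
      have "commutator x (inv y) = inv y \<otimes> inv (commutator x y) \<otimes> y"
        using x y by (simp add: commutator_def m_assoc inv_mult_group)
      then show ?thesis using y normal_conj'[OF K] by (simp add: cent_def)
    qed
  qed
qed

lemma ctr_normal:
  assumes K: "K \<lhd> G"
  shows "ctr K \<lhd> G"
proof -
  interpret K: normal K G by (rule K)
  have "subgroup (ctr K) G"
  proof (rule subgroup.intro)
    show "ctr K \<subseteq> carrier G" by (auto simp: ctr_def)
    show "\<one> \<in> ctr K" by (simp add: ctr_def commutator_def)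
    show "x \<otimes> z \<in> ctr K" if "x \<in> ctr K" "z \<in> ctr K" for x z
    proof -
      have xz: "x \<in> carrier G" "z \<in> carrier G" using that by (auto simp: ctr_def)
      have "commutator (x \<otimes> z) y = (x \<otimes> commutator z y \<otimes> inv x) \<otimes> commutator x y"
        if "y \<in> carrier G" for y
        using xz that by (simp add: commutator_def m_assoc inv_mult_group)
      then show ?thesis using xz that normal_conj[OF K] by (auto simp: ctr_def)
    qed
    show "inv x \<in> ctr K" if "x \<in> ctr K" for x
    proof -
      have x: "x \<in> carrier G" using that by (auto simp: ctr_def)
      have "commutator (inv x) y = inv x \<otimes> inv (commutator x y) \<otimes> x" if "y \<in> carrier G" for y
        using x that by (simp add: commutator_def m_assoc inv_mult_group)
      then show ?thesis using x that normal_conj'[OF K] by (auto simp: ctr_def)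
    qed
  qed
  moreover have "g \<otimes> x \<otimes> inv g \<in> ctr K" if g: "g \<in> carrier G" and "x \<in> ctr K" for g x
  proof -
    have x: "x \<in> carrier G" "\<And>y. y \<in> carrier G \<Longrightarrow> commutator x y \<in> K" using that by (auto simp: ctr_def)
    have "commutator (g \<otimes> x \<otimes> inv g) y = g \<otimes> commutator x (inv g \<otimes> y \<otimes> g) \<otimes> inv g"
      if "y \<in> carrier G" for y
      using x g that by (simp add: commutator_def m_assoc inv_mult_group)
    then show ?thesis using x g normal_conj[OF K] by (auto simp: ctr_def)
  qed
  ultimately show ?thesis by (simp add: normal_inv_iff)
qed

lemma normal_subset_ctr:
  assumes K: "K \<lhd> G"
  shows "K \<subseteq> ctr K"
proof
  interpret K: normal K G by (rule K)
  fix x assume x: "x \<in> K"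
  have "commutator x y \<in> K" if y: "y \<in> carrier G" for y
  proof -
    have "commutator x y = x \<otimes> (y \<otimes> inv x \<otimes> inv y)" using x y by (simp add: commutator_def m_assoc)
    then show ?thesis using x y normal_conj[OF K] by simp
  qed
  then show "x \<in> ctr K" using x by (simp add: ctr_def)
qed

lemma ctr_mono: "K \<subseteq> L \<Longrightarrow> ctr K \<subseteq> ctr L"
  by (auto simp: ctr_def)

lemma ctrD: "x \<in> ctr K \<Longrightarrow> y \<in> carrier G \<Longrightarrow> commutator x y \<in> K"
  by (simp add: ctr_def)

lemma ctrD':
  assumes K: "K \<lhd> G" and x: "x \<in> ctr K" "y \<in> carrier G"
  shows "commutator y x \<in> K"
proof -
  interpret K: normal K G by (rule K)
  have "x \<in> carrier G" using x by (simp add: ctr_def)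
  then have "commutator y x = inv (commutator x y)" using x by (simp add: commutator_def m_assoc inv_mult_group)
  then show ?thesis using ctrD[OF x] by simp
qed

lemma ctr_subset_cent: "K \<lhd> G \<Longrightarrow> x \<in> carrier G \<Longrightarrow> ctr K \<subseteq> cent K x"
  using ctrD' by (auto simp: cent_def ctr_def)

lemma lcs_Suc: "lcs G (Suc i) = generate G {commutator x y | x y. x \<in> lcs G i \<and> y \<in> carrier G}"
  by (simp add: commutator_def)

lemma lcs_normal: "lcs G i \<lhd> G"
proof (induction i)
  case 0
  then show ?case by (simp add: normal_self)
next
  case (Suc i)
  have sub: "lcs G i \<subseteq> carrier G" by (rule normal_subset[OF Suc])
  show ?case
    unfolding lcs_Suc
  proof (rule normal_generateI)
    show "{commutator x y |x y. x \<in> lcs G i \<and> y \<in> carrier G} \<subseteq> carrier G" using sub by auto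
    fix h g assume "h \<in> {commutator x y |x y. x \<in> lcs G i \<and> y \<in> carrier G}" and g: "g \<in> carrier G"
    then obtain x y where x: "x \<in> lcs G i" "x \<in> carrier G" and y: "y \<in> carrier G" and h: "h = commutator x y"
      using sub by auto
    have "g \<otimes> h \<otimes> inv g = commutator (g \<otimes> x \<otimes> inv g) (g \<otimes> y \<otimes> inv g)"
      using x y g by (simp add: h commutator_def m_assoc inv_mult_group)
    then show "g \<otimes> h \<otimes> inv g \<in> {commutator x y |x y. x \<in> lcs G i \<and> y \<in> carrier G}"
      using normal_conj[OF Suc x(1) g] y g by auto
  qed
qed

lemma lcs_subset: "lcs G i \<subseteq> carrier G"
  by (rule normal_subset[OF lcs_normal])

text \<open>Both sides say that \<open>K\<close> contains the commutators of \<open>lcs G i\<close>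
  with the group. This turns inclusions for the lower central series into centrality modulo
  \<open>K\<close>, and is used in both directions throughout.\<close>

lemma lcs_Suc_subset_iff:
  assumes K: "subgroup K G"
  shows "lcs G (Suc i) \<subseteq> K \<longleftrightarrow> lcs G i \<subseteq> ctr K"
proof
  assume *: "lcs G (Suc i) \<subseteq> K"
  show "lcs G i \<subseteq> ctr K"
  proof
    fix x assume x: "x \<in> lcs G i"
    have "commutator x y \<in> K" if "y \<in> carrier G" for y
      using * x that unfolding lcs_Suc by (auto intro: generate.incl)
    then show "x \<in> ctr K" using x lcs_subset by (auto simp: ctr_def)
  qed
next
  assume *: "lcs G i \<subseteq> ctr K"
  show "lcs G (Suc i) \<subseteq> K"
    unfolding lcs_Suc by (rule generate_subgroup_incl[OF _ K]) (use * ctrD in blast)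
qed

lemma lcs_Suc_subset: "lcs G (Suc i) \<subseteq> lcs G i"
  using lcs_Suc_subset_iff[OF normal_subgroup[OF lcs_normal]] normal_subset_ctr[OF lcs_normal] by blast

lemma lcs_antimono: "i \<le> j \<Longrightarrow> lcs G j \<subseteq> lcs G i"
  by (induction j rule: dec_induct) (use lcs_Suc_subset in blast)+

lemma derived_eq_lcs: "derived G (carrier G) = lcs G 1"
proof -
  have "(\<Union>h1\<in>carrier G. \<Union>h2\<in>carrier G. {h1 \<otimes> h2 \<otimes> inv h1 \<otimes> inv h2}) =
    {x \<otimes> y \<otimes> inv x \<otimes> inv y | x y. x \<in> carrier G \<and> y \<in> carrier G}" by auto
  then show ?thesis by (simp add: derived_def)
qed

lemma normal_join:
  assumes A: "A \<lhd> G" and B: "B \<lhd> G"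
  shows "generate G (A \<union> B) \<lhd> G"
  using normal_subset[OF A] normal_subset[OF B] normal_conj[OF A] normal_conj[OF B]
  by (intro normal_generateI) auto

text \<open>Separate \<open>N\<close> from the join of \<open>N\<close> and \<open>M\<close>: a
  kernel containing both \<open>N\<close> and \<open>M\<close> would contain the join.\<close>

lemma irr_rep_separating:
  assumes fin: "finite (carrier G)" and N: "N \<lhd> G" and M: "M \<lhd> G" and NM: "\<not> M \<subseteq> N"
  obtains \<rho> n where "finite_irr_rep G \<rho> n" "N \<subseteq> finite_rep.rker G \<rho> n" "\<not> M \<subseteq> finite_rep.rker G \<rho> n"
proof -
  have g: "generate G (N \<union> M) \<lhd> G" by (rule normal_join[OF N M])
  have incl: "N \<subseteq> generate G (N \<union> M)" "M \<subseteq> generate G (N \<union> M)" by (auto intro: generate.incl)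
  then have "N \<subset> generate G (N \<union> M)" using NM by blast
  then obtain \<rho> n where \<rho>: "irr_rep G \<rho> n" "\<And>x. x \<in> N \<Longrightarrow> \<rho> x = 1\<^sub>m n"
    "\<exists>m\<in>generate G (N \<union> M). \<rho> m \<noteq> 1\<^sub>m n"
    by (rule irr_rep_separating_subset[OF is_group fin N g]) blast
  interpret finite_irr_rep G \<rho> n
    by unfold_locales (use \<rho> fin in \<open>auto simp: irr_rep_def\<close>)
  have Nk: "N \<subseteq> rker" using \<rho>(2) normal_subset[OF N] by (auto simp: rker_def)
  have "\<not> M \<subseteq> rker"
  proof
    assume "M \<subseteq> rker"
    then have "generate G (N \<union> M) \<subseteq> rker" using Nk by (intro generate_subgroup_incl[OF _ rker_subgroup]) auto
    then show False using \<rho>(3) by (auto simp: rker_def)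
  qed
  then show thesis using that Nk finite_irr_rep_axioms by blast
qed

text \<open>The condition on \<open>f\<close> says that its fibres on \<open>H\<close> are the left
  cosets of \<open>H \<inter> K\<close>, so left translation by \<open>x\<close> is the required
  bijection.\<close>

lemma card_fibre_subgroup:
  assumes H: "subgroup H G"
    and f: "\<And>x y. x \<in> H \<Longrightarrow> y \<in> H \<Longrightarrow> f x = f y \<longleftrightarrow> inv x \<otimes> y \<in> K"
    and x: "x \<in> H"
  shows "card {y \<in> H. f y = f x} = card (H \<inter> K)"
proof -
  interpret H: subgroup H G by (rule H)
  have "bij_betw (\<lambda>y. x \<otimes> y) (H \<inter> K) {y \<in> H. f y = f x}"
  proof (rule bij_betwI[where g = "\<lambda>y. inv x \<otimes> y"])
    show "(\<lambda>y. x \<otimes> y) \<in> H \<inter> K \<rightarrow> {y \<in> H. f y = f x}"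
    proof
      fix y assume y: "y \<in> H \<inter> K"
      then have xy: "x \<otimes> y \<in> H" using x by simp
      have "inv x \<otimes> (x \<otimes> y) = y" using x y by simp
      then have "f x = f (x \<otimes> y)" using f[OF x xy] y by simp
      then show "x \<otimes> y \<in> {y \<in> H. f y = f x}" using xy by simp
    qed
    show "(\<lambda>y. inv x \<otimes> y) \<in> {y \<in> H. f y = f x} \<rightarrow> H \<inter> K"
    proof
      fix y assume y: "y \<in> {y \<in> H. f y = f x}"
      then have "inv x \<otimes> y \<in> K" using f[OF x, of y] by simp
      then show "inv x \<otimes> y \<in> H \<inter> K" using x y by simp
    qed
  qed (use x in auto)
  then show ?thesis using bij_betw_same_card by metis
qed

lemma card_eq_image_subgroup:
  assumes fin: "finite (carrier G)" and H: "subgroup H G"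
    and f: "\<And>x y. x \<in> H \<Longrightarrow> y \<in> H \<Longrightarrow> f x = f y \<longleftrightarrow> inv x \<otimes> y \<in> K"
  shows "card H = card (f ` H) * card (H \<inter> K)"
proof (rule antisym)
  have finH: "finite H" using subgroup.subset[OF H] fin finite_subset by blast
  have c: "card {x \<in> H. f x = y} = card (H \<inter> K)" if "y \<in> f ` H" for y
    using that card_fibre_subgroup[OF H f] by auto
  show "card H \<le> card (f ` H) * card (H \<inter> K)" by (rule card_le_fibre[OF finH]) (simp add: c)
  show "card (f ` H) * card (H \<inter> K) \<le> card H" by (rule card_ge_fibre[OF finH]) (simp add: c)
qed

end

section \<open>The central character of an irreducible representation\<close>

context finite_irr_rep
begin

lemma rker_normal: "rker \<lhd> G"
proof -
  have "g \<otimes> x \<otimes> inv g \<in> rker" if "g \<in> carrier G" "x \<in> rker" for g x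
    using that by (auto simp: rker_def rep_mult)
  then show ?thesis using rker_subgroup by (simp add: normal_inv_iff)
qed

lemma rep_eq_iff:
  assumes "x \<in> carrier G" "y \<in> carrier G"
  shows "\<rho> x = \<rho> y \<longleftrightarrow> inv x \<otimes> y \<in> rker"
proof
  assume "\<rho> x = \<rho> y"
  then have "\<rho> (inv x \<otimes> y) = \<rho> (inv x) * \<rho> x" using assms by (simp add: rep_mult)
  then show "inv x \<otimes> y \<in> rker" using assms by (simp add: rker_def)
next
  assume "inv x \<otimes> y \<in> rker"
  then have "\<rho> x * \<rho> (inv x \<otimes> y) = \<rho> x" using assms by (simp add: rker_def)
  moreover have "\<rho> x * \<rho> (inv x \<otimes> y) = \<rho> y" using assms by (simp add: rep_mult[symmetric])
  ultimately show "\<rho> x = \<rho> y" by simp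
qed

lemma commutator_swap:
  "x \<in> carrier G \<Longrightarrow> y \<in> carrier G \<Longrightarrow> x \<otimes> y = commutator x y \<otimes> (y \<otimes> x)"
  by (simp add: commutator_def m_assoc)

text \<open>Modulo the kernel, \<open>Z(\<chi>)\<close> is the center of the quotient: scalar
  matrices commute with everything, and the converse is Schur's lemma in the form
  \<open>rcenterI\<close>.\<close>

lemma rcenter_eq_ctr: "rcenter = ctr rker"
proof
  show "rcenter \<subseteq> ctr rker"
  proof
    fix z assume "z \<in> rcenter"
    then obtain c where z: "z \<in> carrier G" and c: "\<rho> z = c \<cdot>\<^sub>m 1\<^sub>m n" by (auto simp: rcenter_def)
    have "commutator z y \<in> rker" if y: "y \<in> carrier G" for y
    proof -
      have "\<rho> (z \<otimes> y) = \<rho> (y \<otimes> z)"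
        using y z by (simp add: rep_mult c mult_smult_assoc_mat[of _ n n _ n] mult_smult_distrib[of _ n n _ n])
      then have "\<rho> (commutator z y) = \<rho> (y \<otimes> z) * \<rho> (inv (y \<otimes> z))"
        using y z by (metis commutator_def inv_closed inv_mult_group m_assoc m_closed rep_mult)
      then show ?thesis using y z by (simp add: rker_def)
    qed
    then show "z \<in> ctr rker" using z by (simp add: ctr_def)
  qed
  show "ctr rker \<subseteq> rcenter"
  proof
    fix z assume z: "z \<in> ctr rker"
    then have zc: "z \<in> carrier G" by (simp add: ctr_def)
    have "\<rho> (z \<otimes> g) = \<rho> (g \<otimes> z)" if g: "g \<in> carrier G" for g
    proof -
      have "\<rho> (z \<otimes> g) = \<rho> (commutator z g) * \<rho> (g \<otimes> z)"
        using zc g commutator_swap[OF zc g] by (metis commutator_closed m_closed rep_mult)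
      then show ?thesis using ctrD[OF z g] zc g by (simp add: rker_def)
    qed
    then show "z \<in> rcenter" by (rule rcenterI[OF zc])
  qed
qed

lemma rcenter_normal: "rcenter \<lhd> G"
  unfolding rcenter_eq_ctr by (rule ctr_normal[OF rker_normal])

lemma rker_subset_rcenter: "rker \<subseteq> rcenter"
  unfolding rcenter_eq_ctr by (rule normal_subset_ctr[OF rker_normal])

text \<open>The central character: on \<open>rcenter\<close> the corner entry is the scalar by which
  \<open>z\<close> acts. Only its values on \<open>rcenter\<close> are meaningful.\<close>

definition scal :: "'a \<Rightarrow> complex" where
  "scal z = \<rho> z $$ (0,0)"

lemma rep_scal: "z \<in> rcenter \<Longrightarrow> \<rho> z = scal z \<cdot>\<^sub>m 1\<^sub>m n"
  using n_pos by (auto simp: rcenter_def scal_def)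

lemma rcenter_carrier: "z \<in> rcenter \<Longrightarrow> z \<in> carrier G"
  by (simp add: rcenter_def)

lemma scal_mult:
  assumes "y \<in> rcenter" "z \<in> rcenter"
  shows "scal (y \<otimes> z) = scal y * scal z"
proof -
  have "\<rho> (y \<otimes> z) = \<rho> y * \<rho> z" using assms by (simp add: rcenter_carrier rep_mult)
  also have "\<dots> = (scal y * scal z) \<cdot>\<^sub>m 1\<^sub>m n"
    unfolding rep_scal[OF assms(1)] rep_scal[OF assms(2)]
    by (intro eq_matI) (auto simp: mult_smult_assoc_mat[of _ n n _ n])
  finally show ?thesis using n_pos by (simp add: scal_def[of "y \<otimes> z"])
qed

lemma scal_eq_iff:
  assumes "y \<in> rcenter" "z \<in> rcenter"
  shows "scal y = scal z \<longleftrightarrow> inv y \<otimes> z \<in> rker"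
proof -
  have "scal y = scal z \<longleftrightarrow> \<rho> y = \<rho> z"
    using rep_scal[OF assms(1)] rep_scal[OF assms(2)] scal_def by metis
  then show ?thesis using rep_eq_iff assms rcenter_carrier by simp
qed

lemma scal_one: "scal \<one> = 1"
  using n_pos by (simp add: scal_def)

lemma scal_neq_0:
  assumes "z \<in> rcenter"
  shows "scal z \<noteq> 0"
proof -
  have "inv z \<in> rcenter" using assms normal_subgroup[OF rcenter_normal] by (simp add: subgroup.m_inv_closed)
  then have "scal z * scal (inv z) = 1"
    using scal_mult[OF assms, of "inv z"] assms by (simp add: rcenter_carrier scal_one)
  then show ?thesis by auto
qed

lemma scal_pow: "z \<in> rcenter \<Longrightarrow> z [^] (m::nat) \<in> rcenter \<and> scal (z [^] m) = scal z ^ m"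
proof (induction m)
  case 0
  then show ?case using normal_subgroup[OF rcenter_normal] by (simp add: scal_one subgroup.one_closed)
next
  case (Suc m)
  then show ?case using normal_subgroup[OF rcenter_normal] scal_mult[of "z [^] m" z]
    by (simp add: subgroup.m_closed mult.commute)
qed

lemma card_scal_image:
  assumes H: "subgroup H G" "H \<subseteq> rcenter"
  shows "card H = card (scal ` H) * card (H \<inter> rker)"
  by (rule card_eq_image_subgroup[OF finite_carrier H(1)]) (use scal_eq_iff H(2) in blast)

text \<open>Each of the \<open>m\<close> copies of \<open>y\<close> that is moved past
  \<open>g\<close> contributes one factor \<open>scal (commutator y g)\<close>.\<close>

lemma rep_commutator:
  assumes y: "y \<in> carrier G" and g: "g \<in> carrier G" and c: "commutator y g \<in> rcenter"
  shows "\<rho> (y [^] (m::nat)) * \<rho> g = scal (commutator y g) ^ m \<cdot>\<^sub>m (\<rho> g * \<rho> (y [^] m))"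
proof (induction m)
  case 0
  have "1 \<cdot>\<^sub>m \<rho> g = \<rho> g" by (intro eq_matI) auto
  then show ?case using g by simp
next
  case (Suc m)
  let ?s = "scal (commutator y g)"
  have ym: "y [^] m \<in> carrier G" using y by simp
  have "\<rho> (y \<otimes> g) = \<rho> (commutator y g) * \<rho> (g \<otimes> y)"
    using y g commutator_swap[OF y g] by (metis commutator_closed m_closed rep_mult)
  then have 1: "\<rho> y * \<rho> g = ?s \<cdot>\<^sub>m (\<rho> g * \<rho> y)"
    using y g rep_scal[OF c] by (simp add: rep_mult mult_smult_assoc_mat[of _ n n _ n])
  have "\<rho> (y [^] Suc m) * \<rho> g = \<rho> (y [^] m) * (\<rho> y * \<rho> g)"
    using y ym g by (simp add: rep_mult mat_assoc)
  also have "\<dots> = ?s \<cdot>\<^sub>m (\<rho> (y [^] m) * \<rho> g * \<rho> y)"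
    unfolding 1 using y ym g by (simp add: mat_assoc mult_smult_distrib[of _ n n _ n])
  also have "\<dots> = ?s \<cdot>\<^sub>m (?s ^ m \<cdot>\<^sub>m (\<rho> g * \<rho> (y [^] m) * \<rho> y))"
    unfolding Suc using y ym g by (simp add: mult_smult_assoc_mat[of _ n n _ n])
  also have "\<dots> = ?s ^ Suc m \<cdot>\<^sub>m (\<rho> g * \<rho> (y [^] Suc m))"
    using y ym g by (simp add: mat_assoc rep_mult) (intro eq_matI, auto)
  finally show ?case .
qed

text \<open>The factor in \<open>rep_commutator\<close> is then \<open>1\<close>, so
  \<open>\<rho> (y [^] m)\<close> commutes with every \<open>\<rho> g\<close>.\<close>

lemma pow_in_rcenterI:
  assumes y: "y \<in> carrier G" and c: "\<And>g. g \<in> carrier G \<Longrightarrow> commutator y g \<in> rcenter"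
    and s: "\<And>g. g \<in> carrier G \<Longrightarrow> scal (commutator y g) ^ m = 1"
  shows "y [^] (m::nat) \<in> rcenter"
proof (rule rcenterI)
  fix g assume g: "g \<in> carrier G"
  have "1 \<cdot>\<^sub>m (\<rho> g * \<rho> (y [^] m)) = \<rho> g * \<rho> (y [^] m)" by (intro eq_matI) auto
  then show "\<rho> (y [^] m \<otimes> g) = \<rho> (g \<otimes> y [^] m)"
    using rep_commutator[OF y g c[OF g], of m] s[OF g] y g by (simp add: rep_mult)
qed (use y in simp)

text \<open>Converse of \<open>pow_in_rcenterI\<close> for a single \<open>g\<close>: as
  \<open>y [^] m\<close> acts as a scalar, the factor in \<open>rep_commutator\<close> fixes an
  invertible matrix, which is cancelled.\<close>

lemma scal_commutator_pow:
  assumes y: "y \<in> carrier G" and g: "g \<in> carrier G" and c: "commutator y g \<in> rcenter"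
    and ym: "y [^] (m::nat) \<in> rcenter"
  shows "scal (commutator y g) ^ m = 1"
proof -
  define A where "A = \<rho> (g \<otimes> y [^] m)"
  have gy: "g \<otimes> y [^] m \<in> carrier G" using y g by simp
  have Ac: "A \<in> carrier_mat n n" using gy by (simp add: A_def)
  have "\<rho> (y [^] m) * \<rho> g = \<rho> g * \<rho> (y [^] m)"
    using rep_scal[OF ym] g by (simp add: mult_smult_assoc_mat[of _ n n _ n] mult_smult_distrib[of _ n n _ n])
  then have "A = scal (commutator y g) ^ m \<cdot>\<^sub>m A"
    using rep_commutator[OF y g c, of m] y g by (simp add: A_def rep_mult)
  then have "A * \<rho> (inv (g \<otimes> y [^] m)) = scal (commutator y g) ^ m \<cdot>\<^sub>m (A * \<rho> (inv (g \<otimes> y [^] m)))"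
    using Ac gy by (metis inv_closed mult_smult_assoc_mat rep_carrier)
  then have "1\<^sub>m n = scal (commutator y g) ^ m \<cdot>\<^sub>m (1\<^sub>m n :: complex mat)" using gy by (simp add: A_def)
  then have "1\<^sub>m n $$ (0,0) = (scal (commutator y g) ^ m \<cdot>\<^sub>m (1\<^sub>m n :: complex mat)) $$ (0,0)" by simp
  then show ?thesis using n_pos by simp
qed

text \<open>Matrices of size one commute, so every element is central modulo the kernel. Later this
  forces characters nontrivial on the derived subgroup to be nonlinear.\<close>

lemma lcs1_subset_rker:
  assumes "n = 1"
  shows "lcs G 1 \<subseteq> rker"
proof -
  have "x \<in> rcenter" if x: "x \<in> carrier G" for x
  proof (rule rcenterI[OF x])
    fix g assume g: "g \<in> carrier G"
    show "\<rho> (x \<otimes> g) = \<rho> (g \<otimes> x)"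
    proof (rule eq_matI)
      fix i j assume "i < dim_row (\<rho> (g \<otimes> x))" "j < dim_col (\<rho> (g \<otimes> x))"
      then have i: "i < n" and j: "j < n"
        using carrier_matD[OF rep_carrier[OF m_closed[OF g x]]] by simp_all
      show "\<rho> (x \<otimes> g) $$ (i,j) = \<rho> (g \<otimes> x) $$ (i,j)"
        using mult_mat_entry[OF rep_carrier[OF x] rep_carrier[OF g] i j]
          mult_mat_entry[OF rep_carrier[OF g] rep_carrier[OF x] i j] x g assms i j
        by (simp add: rep_mult mult.commute)
    qed (use carrier_matD[OF rep_carrier[OF m_closed[OF g x]]] carrier_matD[OF rep_carrier[OF m_closed[OF x g]]]
        in simp_all)
  qed
  then have "lcs G 0 \<subseteq> ctr rker" unfolding rcenter_eq_ctr by auto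
  then show ?thesis using lcs_Suc_subset_iff[OF normal_subgroup[OF rker_normal], of 0] by simp
qed

end

section \<open>Finite p-groups\<close>

declare lcs.simps(2) [simp del]

locale finite_p_group = group G for G (structure) +
  fixes p :: nat
  assumes prime_p: "Factorial_Ring.prime p" and fin: "finite (carrier G)"
    and card_pow: "\<exists>k. card (carrier G) = p ^ k"
begin

lemma p_gt_1: "1 < p"
  using prime_p prime_gt_1_nat by blast

lemma card_subgroup_dvd: "subgroup H G \<Longrightarrow> card H dvd card (carrier G)"
  using lagrange[of H] unfolding Coset.order_def by (intro dvdI[of _ _ "card (rcosets H)"]) (simp add: mult.commute)

lemma card_subgroup:
  assumes "subgroup H G"
  obtains j where "card H = p ^ j"
proof -
  obtain k where "card (carrier G) = p ^ k" using card_pow by blast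
  then have "card H dvd p ^ k" using card_subgroup_dvd[OF assms] by simp
  then show thesis using that divides_primepow_nat[OF prime_p] by blast
qed

lemma finite_subgroup: "subgroup H G \<Longrightarrow> finite H"
  using subgroup.subset fin finite_subset by blast

lemma card_subgroup_pos: "subgroup H G \<Longrightarrow> 0 < card H"
  using finite_subgroup subgroup.one_closed by (fastforce simp: card_gt_0_iff)

text \<open>Both orders are powers of \<open>p\<close>, so a strict inclusion costs at least one
  factor \<open>p\<close>.\<close>

lemma card_psubset:
  assumes H: "subgroup H G" and L: "subgroup L G" and HL: "H \<subset> L"
  shows "p * card H \<le> card L"
proof -
  obtain i where i: "card H = p ^ i" using H by (rule card_subgroup)
  obtain j where j: "card L = p ^ j" using L by (rule card_subgroup)
  note ij = i j
  have "card H < card L" by (rule psubset_card_mono[OF finite_subgroup[OF L] HL])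
  then have "i < j" unfolding ij by (rule power_less_imp_less_exp[OF p_gt_1])
  then have "p ^ Suc i \<le> p ^ j" using p_gt_1 by (intro power_increasing) auto
  then show ?thesis using ij by simp
qed

text \<open>The index of \<open>H\<close> in \<open>L\<close> is a power of \<open>p\<close> not
  exceeding \<open>p\<close>, hence divides \<open>p\<close>; so the coset of \<open>u\<close> has
  trivial \<open>p\<close>-th power in \<open>L\<close> modulo \<open>H\<close>.\<close>

lemma pow_p_in_subgroup:
  assumes H: "H \<lhd> G" and L: "subgroup L G" and HL: "H \<subseteq> L" and card: "card L \<le> p * card H" and u: "u \<in> L"
  shows "u [^] p \<in> H"
proof -
  interpret L: group "G\<lparr>carrier := L\<rparr>" by (rule subgroup.subgroup_is_group[OF L is_group])
  interpret Q: normal H "G\<lparr>carrier := L\<rparr>" by (rule normal_restrict_supergroup[OF L H HL])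
  interpret F: group "G\<lparr>carrier := L\<rparr> Mod H" by (rule Q.factorgroup_is_group)
  have sH: "subgroup H G" by (rule normal_subgroup[OF H])
  define q where "q = card (rcosets\<^bsub>G\<lparr>carrier := L\<rparr>\<^esub> H)"
  have lag: "q * card H = card L"
    using L.lagrange[OF Q.subgroup_axioms] by (simp add: Coset.order_def q_def)
  obtain j where j: "card L = p ^ j" using L by (rule card_subgroup)
  have "q dvd p ^ j" unfolding j[symmetric] lag[symmetric] by simp
  then obtain l where l: "q = p ^ l" using divides_primepow_nat[OF prime_p] by blast
  have "q \<le> p" using lag card card_subgroup_pos[OF sH] by (metis mult_le_cancel2)
  then have "p ^ l \<le> p ^ 1" using l by simp
  then have "l \<le> 1" by (rule power_le_imp_le_exp[OF p_gt_1])
  then have qp: "q dvd p" using l by (cases l) auto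
  have uL: "u \<in> carrier (G\<lparr>carrier := L\<rparr>)" using u by simp
  have c: "H #>\<^bsub>G\<lparr>carrier := L\<rparr>\<^esub> u \<in> carrier (G\<lparr>carrier := L\<rparr> Mod H)"
    using uL by (auto simp: carrier_FactGroup)
  have "Coset.order (G\<lparr>carrier := L\<rparr> Mod H) = q" by (simp add: Coset.order_def q_def FactGroup_def)
  then have "(H #>\<^bsub>G\<lparr>carrier := L\<rparr>\<^esub> u) [^]\<^bsub>G\<lparr>carrier := L\<rparr> Mod H\<^esub> q = H"
    using F.pow_order_eq_1[OF c] by simp
  then have "(H #>\<^bsub>G\<lparr>carrier := L\<rparr>\<^esub> u) [^]\<^bsub>G\<lparr>carrier := L\<rparr> Mod H\<^esub> p = H"
    using qp F.nat_pow_pow[OF c] by (metis F.nat_pow_one dvdE one_FactGroup)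
  then have "H #>\<^bsub>G\<lparr>carrier := L\<rparr>\<^esub> (u [^]\<^bsub>G\<lparr>carrier := L\<rparr>\<^esub> p) = H"
    using Q.FactGroup_pow[OF uL] by simp
  then have "u [^]\<^bsub>G\<lparr>carrier := L\<rparr>\<^esub> p \<in> H"
    
    using L.coset_join1[OF _ L.nat_pow_closed[OF uL] Q.subgroup_axioms] by simp
  then show ?thesis using nat_pow_consistent[of u p L] by simp
qed

text \<open>The class equation: conjugacy classes have \<open>p\<close>-power size, and with a
  trivial center only \<open>{\<one>}\<close> is a singleton, which makes the group order congruent
  to 1 modulo \<open>p\<close>.\<close>

lemma nontrivial_center:
  assumes "card (carrier G) \<noteq> 1"
  obtains z where "z \<in> carrier G" "z \<noteq> \<one>" "\<And>g. g \<in> carrier G \<Longrightarrow> z \<otimes> g = g \<otimes> z"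
proof (rule ccontr)
  note center_elt = that
  assume a: "\<not> thesis"
  define \<phi> where "\<phi> = (\<lambda>g. (\<lambda>h \<in> carrier G. g \<otimes> h \<otimes> (inv g)))"
  interpret A: group_action G "carrier G" \<phi> unfolding \<phi>_def by (rule action_by_conjugation)
  define Os where "Os = orbits G (carrier G) \<phi>"
  have finO: "finite Os" unfolding Os_def orbits_def using fin by simp
  have one: "orbit G \<phi> \<one> = {\<one>}" by (auto simp: orbit_def \<phi>_def intro!: exI[of _ \<one>])
  then have oneO: "{\<one>} \<in> Os" unfolding Os_def orbits_def by (auto intro!: exI[of _ \<one>])
  obtain k where k: "card (carrier G) = p ^ k" using card_pow by blast
  have dvd: "p dvd card O'" if O': "O' \<in> Os - {{\<one>}}" for O'
  proof -
    obtain x where x: "x \<in> carrier G" "O' = orbit G \<phi> x" using O' by (auto simp: Os_def orbits_def)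
    have "card O' dvd p ^ k"
      unfolding k[symmetric] Coset.order_def[symmetric] A.orbit_stabilizer_theorem[OF x(1), symmetric] x(2) by simp
    then obtain l where l: "card O' = p ^ l" using divides_primepow_nat[OF prime_p] by blast
    have "l \<noteq> 0"
    proof
      assume "l = 0"
      then have "card O' = 1" using l by simp
      moreover have xO: "x \<in> O'" using x A.orbit_refl by simp
      ultimately have Ox: "O' = {x}" by (auto simp: card_1_singleton_iff)
      have "x \<otimes> g = g \<otimes> x" if g: "g \<in> carrier G" for g
      proof -
        have "\<phi> g x \<in> O'" using g x by (auto simp: orbit_def)
        then have "g \<otimes> x \<otimes> inv g = x" using Ox x by (simp add: \<phi>_def)
        then have "(g \<otimes> x \<otimes> inv g) \<otimes> g = x \<otimes> g" by simp
        then show ?thesis using g x by (simp add: m_assoc)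
      qed
      then have "x = \<one>" using a center_elt[OF x(1)] by blast
      then show False using O' Ox by simp
    qed
    then show ?thesis using l by (cases l) auto
  qed
  have "card (carrier G) = (\<Sum>O'\<in>Os. card O')"
    using A.disjoint_sum[OF fin, of "\<lambda>_. 1::nat"] by (simp add: Os_def)
  also have "\<dots> = card {\<one>} + (\<Sum>O'\<in>Os - {{\<one>}}. card O')"
    by (rule sum.remove[OF finO oneO])
  finally have "p ^ k = 1 + (\<Sum>O'\<in>Os - {{\<one>}}. card O')" using k by simp
  moreover have "p dvd (\<Sum>O'\<in>Os - {{\<one>}}. card O')" by (rule dvd_sum) (rule dvd)
  moreover have "p dvd p ^ k" using assms k by (cases k) auto
  ultimately have "p dvd 1" by (metis dvd_add_left_iff)
  then show False using p_gt_1 by simp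
qed

text \<open>Lift a nontrivial central element of the quotient \<open>G Mod N\<close>, again a
  \<open>p\<close>-group.\<close>

lemma psubset_ctr:
  assumes N: "N \<lhd> G" and ne: "N \<noteq> carrier G"
  shows "N \<subset> ctr N"
proof -
  interpret N: normal N G by (rule N)
  interpret Q: group "G Mod N" by (rule N.factorgroup_is_group)
  have lag: "card (carrier (G Mod N)) * card N = card (carrier G)"
    using lagrange[OF N.subgroup_axioms] by (simp add: Coset.order_def FactGroup_def)
  interpret Q: finite_p_group "G Mod N" p
  proof unfold_locales
    show "finite (carrier (G Mod N))" using fin by (simp add: carrier_FactGroup)
    obtain k where "card (carrier G) = p ^ k" using card_pow by blast
    then have "card (carrier (G Mod N)) dvd p ^ k" using lag by (metis dvd_triv_left)
    then show "\<exists>k. card (carrier (G Mod N)) = p ^ k" using divides_primepow_nat[OF prime_p] by blast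
  qed (rule prime_p)
  have "card (carrier (G Mod N)) \<noteq> 1"
  proof
    assume "card (carrier (G Mod N)) = 1"
    then have "card N = card (carrier G)" using lag by simp
    then have "N = carrier G" using card_subset_eq[OF fin N.subset] by simp
    then show False using ne by simp
  qed
  then obtain Z where Z: "Z \<in> carrier (G Mod N)" "Z \<noteq> \<one>\<^bsub>G Mod N\<^esub>"
    "\<And>A. A \<in> carrier (G Mod N) \<Longrightarrow> Z \<otimes>\<^bsub>G Mod N\<^esub> A = A \<otimes>\<^bsub>G Mod N\<^esub> Z"
    by (rule Q.nontrivial_center) blast
  obtain z where z: "z \<in> carrier G" "Z = N #> z" using Z(1) by (auto simp: carrier_FactGroup)
  have "z \<notin> N" using Z(2) z coset_join2[OF z(1) N.subgroup_axioms] by auto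
  moreover have "commutator z g \<in> N" if g: "g \<in> carrier G" for g
  proof -
    have "N #> g \<in> carrier (G Mod N)" using g by (auto simp: carrier_FactGroup)
    then have "N #> (z \<otimes> g) = N #> (g \<otimes> z)" 
      using Z(3)[of "N #> g"] z N.rcos_sum[OF z(1) g] N.rcos_sum[OF g z(1)] by simp
    then have "z \<otimes> g \<in> N #> (g \<otimes> z)" using rcos_self[OF _ N.subgroup_axioms, of "z \<otimes> g"] z g by simp
    then obtain h where h: "h \<in> N" "z \<otimes> g = h \<otimes> (g \<otimes> z)" by (auto simp: r_coset_def)
    have "commutator z g = (z \<otimes> g) \<otimes> (inv z \<otimes> inv g)" using z g by (simp add: commutator_def m_assoc)
    also have "\<dots> = h" unfolding h(2) using h(1) z g by (simp add: m_assoc)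
    finally show ?thesis using h(1) by simp
  qed
  ultimately show ?thesis using z normal_subset_ctr[OF N] by (auto simp: ctr_def)
qed

text \<open>Choose \<open>N\<close> maximal among the normal subgroups not containing
  \<open>lcs G i\<close>. As \<open>ctr N\<close> is larger, it contains \<open>lcs G i\<close>, so
  \<open>lcs G (Suc i) \<subseteq> N\<close>; stability then contradicts the choice of
  \<open>N\<close>.\<close>

lemma lcs_stable_trivial:
  assumes "lcs G (Suc i) = lcs G i"
  shows "lcs G i = {\<one>}"
proof (rule ccontr)
  assume ne: "lcs G i \<noteq> {\<one>}"
  define S where "S = {N. N \<lhd> G \<and> \<not> lcs G i \<subseteq> N}"
  have finS: "finite S"
    by (rule finite_subset[of _ "Pow (carrier G)"]) (use fin normal_subset in \<open>auto simp: S_def\<close>)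
  have "\<one> \<in> lcs G i" using normal_subgroup[OF lcs_normal] subgroup.one_closed by blast
  then have "{\<one>} \<in> S" using ne one_is_normal by (auto simp: S_def)
  then obtain N where N: "N \<in> S" "\<And>N'. N' \<in> S \<Longrightarrow> N \<subseteq> N' \<Longrightarrow> N = N'"
    using finite_has_maximal[OF finS] by blast
  have nN: "N \<lhd> G" and nl: "\<not> lcs G i \<subseteq> N" using N by (auto simp: S_def)
  have "N \<subset> ctr N" using psubset_ctr[OF nN] nl lcs_subset by blast
  then have "ctr N \<notin> S" using N(2) by blast
  then have "lcs G i \<subseteq> ctr N" using ctr_normal[OF nN] by (simp add: S_def)
  then have "lcs G (Suc i) \<subseteq> N" using lcs_Suc_subset_iff[OF normal_subgroup[OF nN]] by simp
  then show False using nl assms by simp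
qed

text \<open>Since \<open>lcs G 0 = G\<close>, a character in layer \<open>i\<close> has a kernel whose quotient has class exactly
  \<open>i + 1\<close>.\<close>

definition layer :: "nat \<Rightarrow> ('a \<Rightarrow> complex mat) \<Rightarrow> nat \<Rightarrow> bool" where
  "layer i \<rho> n \<longleftrightarrow> finite_irr_rep G \<rho> n \<and> lcs G (Suc i) \<subseteq> finite_rep.rker G \<rho> n \<and>
     \<not> lcs G i \<subseteq> finite_rep.rker G \<rho> n"

text \<open>A nontrivial term of the series properly contains the next one, so some irreducible
  representation separates the two.\<close>

lemma layer_exists:
  assumes "lcs G i \<noteq> {\<one>}"
  obtains \<rho> n where "layer i \<rho> n"
proof -
  have "\<not> lcs G i \<subseteq> lcs G (Suc i)" using lcs_stable_trivial[of i] assms lcs_Suc_subset[of i] by blast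
  then obtain \<rho> n where "finite_irr_rep G \<rho> n" "lcs G (Suc i) \<subseteq> finite_rep.rker G \<rho> n"
    "\<not> lcs G i \<subseteq> finite_rep.rker G \<rho> n"
    by (rule irr_rep_separating[OF fin lcs_normal lcs_normal])
  then show thesis using that[of \<rho> n] unfolding layer_def by simp
qed

lemma layer_descend:
  assumes l: "layer (Suc i) \<rho> n"
  obtains \<rho>' n' where "layer i \<rho>' n'" "finite_rep.rker G \<rho> n \<subset> finite_rep.rker G \<rho>' n'"
proof -
  interpret finite_irr_rep G \<rho> n using l by (simp add: layer_def)
  have l1: "lcs G (Suc (Suc i)) \<subseteq> rker" and l2: "\<not> lcs G (Suc i) \<subseteq> rker" using l by (auto simp: layer_def)
  \<comment> \<open>Since \<open>N\<close> contains \<open>lcs G (Suc i)\<close> and the kernel does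
    not, any representation trivial on \<open>N\<close> has a strictly larger kernel. It can be
    nontrivial on \<open>lcs G i\<close> because \<open>N\<close> is central modulo the
    kernel.\<close>
  define N where "N = generate G (rker \<union> lcs G (Suc i))"
  have N: "N \<lhd> G" unfolding N_def by (rule normal_join[OF rker_normal lcs_normal])
  have incl: "rker \<subseteq> N" "lcs G (Suc i) \<subseteq> N" by (auto simp: N_def intro: generate.incl)
  have "lcs G (Suc i) \<subseteq> ctr rker" using l1 lcs_Suc_subset_iff[OF normal_subgroup[OF rker_normal]] by simp
  then have "N \<subseteq> ctr rker"
    unfolding N_def using normal_subset_ctr[OF rker_normal]
    by (intro generate_subgroup_incl normal_subgroup[OF ctr_normal[OF rker_normal]]) auto
  then have "\<not> lcs G i \<subseteq> N" using l2 lcs_Suc_subset_iff[OF normal_subgroup[OF rker_normal], of i] by blast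
  then obtain \<rho>' n' where "finite_irr_rep G \<rho>' n'" "N \<subseteq> finite_rep.rker G \<rho>' n'"
    "\<not> lcs G i \<subseteq> finite_rep.rker G \<rho>' n'"
    by (rule irr_rep_separating[OF fin N lcs_normal])
  moreover from this have "rker \<subset> finite_rep.rker G \<rho>' n'" using incl l2 by blast
  ultimately show thesis using that[of \<rho>' n'] incl unfolding layer_def by simp
qed

end

section \<open>Groups with four codegrees\<close>

text \<open>Supplied by the trivial representation. If there are only two degrees, all nonlinear
  irreducible characters thus share one degree.\<close>

lemma one_in_cd:
  fixes G :: "('g,'b) monoid_scheme"
  assumes "group G" "finite (carrier G)"
  shows "1 \<in> cd G"
proof -
  define \<rho> :: "'g \<Rightarrow> complex mat" where "\<rho> = (\<lambda>_. 1\<^sub>m 1)"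
  have rep: "is_rep G \<rho> 1" by (simp add: is_rep_def \<rho>_def)
  have "W = carrier_vec 1" if W: "invariant_subspace G \<rho> 1 W" and ne: "W \<noteq> {0\<^sub>v 1}" for W
  proof -
    have sub: "is_subspace 1 W" using W by (simp add: invariant_subspace_def)
    then obtain w where w: "w \<in> W" "w \<noteq> 0\<^sub>v 1" "w \<in> carrier_vec 1"
      using ne unfolding is_subspace_def by blast
    have "w $ 0 \<noteq> 0"
    proof
      assume "w $ 0 = 0"
      then have "w = 0\<^sub>v 1" using w(3) by (intro eq_vecI) auto
      then show False using w(2) by simp
    qed
    have "v \<in> W" if v: "v \<in> carrier_vec 1" for v
    proof -
      have "v = (v $ 0 / w $ 0) \<cdot>\<^sub>v w" using v w(3) \<open>w $ 0 \<noteq> 0\<close> by (intro eq_vecI) auto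
      then show ?thesis using sub w(1) unfolding is_subspace_def by metis
    qed
    then show ?thesis using sub unfolding is_subspace_def by blast
  qed
  then have irr: "irr_rep G \<rho> 1" using rep unfolding irr_rep_def by auto
  interpret group G by (rule assms)
  interpret finite_irr_rep G \<rho> 1 by unfold_locales (use assms rep irr in auto)
  show ?thesis using dim_in_cd by simp
qed

context finite_p_group
begin

lemma layer_subset_rcenter:
  assumes "layer i \<rho> n"
  shows "lcs G i \<subseteq> finite_rep.rcenter G \<rho> n"
proof -
  interpret finite_irr_rep G \<rho> n using assms by (simp add: layer_def)
  have "lcs G (Suc i) \<subseteq> rker" using assms by (simp add: layer_def)
  then show ?thesis
    using lcs_Suc_subset_iff[OF normal_subgroup[OF rker_normal]] by (simp add: rcenter_eq_ctr)
qed

text \<open>Here \<open>p ^ e\<close> is the index of the kernel, \<open>p ^ f\<close> the degree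
  and \<open>p ^ t\<close> the codegree. In a layer the kernel is properly contained in
  \<open>rcenter\<close>, so \<open>dim_sq_rcenter_le\<close> gains a factor \<open>p\<close> and
  \<open>2 * f + 1 \<le> e\<close>.\<close>

lemma layer_exponents:
  assumes l: "layer i \<rho> n" and i: "1 \<le> i" and cod: "cod G \<subseteq> {1, real p, real p ^ b, real p ^ a}"
  obtains e f t where "card (carrier G) = p ^ e * card (finite_rep.rker G \<rho> n)" "n = p ^ f" "1 \<le> f"
    "e = f + t" "t = a \<or> t = b" "2 * f < e"
proof -
  interpret finite_irr_rep G \<rho> n using l by (simp add: layer_def)
  have sk: "subgroup rker G" by (rule normal_subgroup[OF rker_normal])
  obtain k where k: "card (carrier G) = p ^ k" using card_pow by blast
  obtain j where j: "card rker = p ^ j" by (rule card_subgroup[OF sk])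
  have "p ^ j dvd p ^ k" using card_subgroup_dvd[OF sk] k j by simp
  then have jk: "j \<le> k" by (rule power_dvd_imp_le[OF _ p_gt_1])
  define e where "e = k - j"
  have e: "card (carrier G) = p ^ e * card rker" using k j jk by (simp add: e_def flip: power_add)
  have "real (card (carrier G)) / real (card rker) = real p ^ e"
    using e j p_gt_1 by simp
  then have "real p ^ e / real n \<in> cod G" using codeg_in_cod by (simp only:)
  then have "real p ^ e / real n \<in> {1, real p, real p ^ b, real p ^ a}" using cod by blast
  then obtain t where t: "t \<in> {0, 1, b, a}" "real p ^ e / real n = real p ^ t"
    by (metis insertE insertI1 insertI2 power_0 power_one_right singletonD)
  then have "real p ^ e = real p ^ t * real n" using n_pos by (simp add: field_simps)
  then have pe: "p ^ e = p ^ t * n" by (metis of_nat_eq_iff of_nat_mult of_nat_power)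
  then have "n dvd p ^ e" by simp
  then obtain f where f: "n = p ^ f" using divides_primepow_nat[OF prime_p] by blast
  have "p ^ e = p ^ (f + t)" using pe f by (simp add: power_add mult.commute)
  then have eft: "e = f + t" using p_gt_1 by simp
  have nl: "\<not> lcs G i \<subseteq> rker" using l by (simp add: layer_def)
  have "rker \<subset> rcenter" using layer_subset_rcenter[OF l] nl rker_subset_rcenter by blast
  then have "p * card rker \<le> card rcenter" by (rule card_psubset[OF sk normal_subgroup[OF rcenter_normal]])
  then have "n\<^sup>2 * (p * card rker) \<le> n\<^sup>2 * card rcenter" by simp
  also have "\<dots> \<le> p ^ e * card rker" using dim_sq_rcenter_le e by simp
  finally have "(n\<^sup>2 * p) * card rker \<le> p ^ e * card rker" by (simp add: mult.assoc)
  then have "n\<^sup>2 * p \<le> p ^ e" using card_subgroup_pos[OF sk] by simp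
  then have "p ^ Suc (2 * f) \<le> p ^ e" using f by (simp add: power_mult[symmetric] mult.commute)
  then have fe: "Suc (2 * f) \<le> e" by (rule power_le_imp_le_exp[OF p_gt_1])
  have "\<not> lcs G 1 \<subseteq> rker" using nl lcs_antimono[OF i] by blast
  then have "n \<noteq> 1" using lcs1_subset_rker by blast
  then have f1: "1 \<le> f" using f by (cases f) auto
  \<comment> \<open>The codegrees \<open>1\<close> and \<open>p\<close> are excluded since
    \<open>t = e - f > f \<ge> 1\<close>.\<close>
  have "t = a \<or> t = b" using t(1) eft fe f1 by auto
  then show thesis using that[OF e f f1 eft] fe by simp
qed

lemma exponent_less:
  assumes "subgroup K G" "subgroup L G" "K \<subset> L"
    and "card (carrier G) = p ^ e * card K" "card (carrier G) = p ^ e' * card L"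
  shows "e' < e"
proof (rule ccontr)
  assume "\<not> e' < e"
  then have "p ^ e \<le> p ^ e'" using p_gt_1 by (intro power_increasing) auto
  moreover have "card K < card L" by (rule psubset_card_mono[OF finite_subgroup[OF assms(2)] assms(3)])
  ultimately have "p ^ e * card K < p ^ e' * card L"
    using p_gt_1 by (intro mult_le_less_imp_less) auto
  then show False using assms(4,5) by simp
qed

text \<open>Let \<open>Y\<close> and \<open>Z\<close> be the preimages of the centers of \<open>G/ker \<rho>\<close> and \<open>G/ker \<sigma>\<close>. As
  \<open>ker \<rho>/ker \<sigma>\<close> is central of order \<open>p\<close>, all \<open>p\<close>-th powers of \<open>Y\<close> lie in \<open>Z\<close>; since \<open>Y/ker \<rho>\<close> embeds
  in the nonzero complex numbers, \<open>|Y : Z| \<le> p\<close>. But \<open>|G : Y| = p\<^sup>2\<close> and \<open>|G : Z| \<ge> p\<^sup>4\<close>.\<close>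

lemma layer_chain_degrees_absurd:
  assumes l1: "layer 1 \<rho> p" and l2: "layer 2 \<sigma> (p\<^sup>2)"
    and sub: "finite_rep.rker G \<sigma> (p\<^sup>2) \<subset> finite_rep.rker G \<rho> p"
    and card: "card (finite_rep.rker G \<rho> p) = p * card (finite_rep.rker G \<sigma> (p\<^sup>2))"
  shows False
proof -
  interpret R: finite_irr_rep G \<rho> p using l1 by (simp add: layer_def)
  interpret S: finite_irr_rep G \<sigma> "p\<^sup>2" using l2 by (simp add: layer_def)
  have sRc: "subgroup R.rcenter G" and sSc: "subgroup S.rcenter G"
    and sRk: "subgroup R.rker G" and sSk: "subgroup S.rker G"
    using R.rcenter_normal S.rcenter_normal R.rker_normal S.rker_normal normal_subgroup by auto
  have lR: "lcs G 2 \<subseteq> R.rker" using l1 by (simp add: layer_def numeral_2_eq_2)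
  have lS: "\<not> lcs G 2 \<subseteq> S.rker" using l2 by (simp add: layer_def)
  have SR: "S.rcenter \<subseteq> R.rcenter"
    unfolding S.rcenter_eq_ctr R.rcenter_eq_ctr using sub by (intro ctr_mono) auto
  \<comment> \<open>The intersection with \<open>S.rcenter\<close> contains \<open>lcs G 2\<close>,
    so it exceeds \<open>S.rker\<close>; as \<open>S.rker\<close> has index \<open>p\<close> in
    \<open>R.rker\<close>, it is all of \<open>R.rker\<close>.\<close>
  have RkS: "R.rker \<subseteq> S.rcenter"
  proof -
    have sI: "subgroup (R.rker \<inter> S.rcenter) G" by (rule subgroups_Inter_pair[OF sRk sSc])
    have "S.rker \<subset> R.rker \<inter> S.rcenter"
      using sub S.rker_subset_rcenter lR lS layer_subset_rcenter[OF l2] by blast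
    then have "card R.rker \<le> card (R.rker \<inter> S.rcenter)"
      using card_psubset[OF sSk sI] card by simp
    then have "R.rker \<inter> S.rcenter = R.rker"
      by (intro card_seteq[OF finite_subgroup[OF sRk]]) auto
    then show ?thesis by blast
  qed
  \<comment> \<open>On \<open>R.rker\<close> the map \<open>S.scal\<close> has kernel
    \<open>S.rker\<close>, so it takes exactly \<open>p\<close> values, and these are closed under
    multiplication.\<close>
  have pw: "S.scal k ^ p = 1" if k: "k \<in> R.rker" for k
  proof -
    have "R.rker \<inter> S.rker = S.rker" using sub by blast
    then have "card (S.scal ` R.rker) = p"
      using S.card_scal_image[OF sRk RkS] card card_subgroup_pos[OF sSk] by simp
    moreover have "S.scal k ^ card (S.scal ` R.rker) = 1"
    proof (rule power_card_eq_1)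
      show "finite (S.scal ` R.rker)" using finite_subgroup[OF sRk] by simp
      show "0 \<notin> S.scal ` R.rker" using S.scal_neq_0 RkS by (metis imageE subsetD)
      show "S.scal k \<noteq> 0" using S.scal_neq_0 RkS k by blast
      fix s assume "s \<in> S.scal ` R.rker"
      then obtain h where h: "h \<in> R.rker" "s = S.scal h" by blast
      then have "S.scal k * s = S.scal (k \<otimes> h)" using S.scal_mult[of k h] k RkS h by (simp add: subset_iff)
      then show "S.scal k * s \<in> S.scal ` R.rker" using subgroup.m_closed[OF sRk k h(1)] by blast
    qed
    ultimately show ?thesis by simp
  qed
  have powS: "y [^] p \<in> S.rcenter" if y: "y \<in> R.rcenter" for y
  proof (rule S.pow_in_rcenterI)
    show "y \<in> carrier G" using y by (rule R.rcenter_carrier)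
    fix g assume g: "g \<in> carrier G"
    have "commutator y g \<in> R.rker" using y g unfolding R.rcenter_eq_ctr by (rule ctrD)
    then show "commutator y g \<in> S.rcenter" "S.scal (commutator y g) ^ p = 1" using RkS pw by auto
  qed
  have finR: "finite (R.scal ` R.rcenter)" using finite_subgroup[OF sRc] by simp
  \<comment> \<open>Raising to the \<open>p\<close>-th power has fibres of at most \<open>p\<close>
    complex numbers, and by \<open>powS\<close> it maps the scalars of \<open>R.rcenter\<close> into
    those of \<open>S.rcenter\<close>.\<close>
  have "card (R.scal ` R.rcenter) \<le> card ((\<lambda>w. w ^ p) ` R.scal ` R.rcenter) * p"
  proof (rule card_le_fibre[OF finR])
    fix w assume w: "w \<in> (\<lambda>w. w ^ p) ` R.scal ` R.rcenter"
    have p0: "0 < p" using p_gt_1 by simp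
    have "w \<noteq> 0" using w R.scal_neq_0 by auto
    then have "card {z::complex. z ^ p = w} = p" by (rule card_nth_roots[OF _ p0])
    moreover have "card {x \<in> R.scal ` R.rcenter. x ^ p = w} \<le> card {z::complex. z ^ p = w}"
      by (rule card_mono) (use finite_nth_roots[OF p0] in auto)
    ultimately show "card {x \<in> R.scal ` R.rcenter. x ^ p = w} \<le> p" by simp
  qed
  also have "card ((\<lambda>w. w ^ p) ` R.scal ` R.rcenter) \<le> card (R.scal ` S.rcenter)"
  proof (rule card_mono)
    show "finite (R.scal ` S.rcenter)" using finite_subgroup[OF sSc] by simp
    show "(\<lambda>w. w ^ p) ` R.scal ` R.rcenter \<subseteq> R.scal ` S.rcenter"
    proof clarify
      fix y assume y: "y \<in> R.rcenter"
      have "R.scal y ^ p = R.scal (y [^] p)" using R.scal_pow[OF y] by simp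
      then show "R.scal y ^ p \<in> R.scal ` S.rcenter" using powS[OF y] by blast
    qed
  qed
  finally have le: "card (R.scal ` R.rcenter) \<le> card (R.scal ` S.rcenter) * p" by simp
  have c1: "card R.rcenter = card (R.scal ` R.rcenter) * card R.rker"
    using R.card_scal_image[OF sRc] R.rker_subset_rcenter by (simp add: Int_absorb1)
  have c2: "card S.rcenter = card (R.scal ` S.rcenter) * card R.rker"
    using R.card_scal_image[OF sSc SR] RkS by (simp add: Int_absorb1)
  have YZ: "card R.rcenter \<le> p * card S.rcenter"
    unfolding c1 c2 using mult_right_mono[OF le, of "card R.rker"] by (simp add: ac_simps)
  have "lcs G 1 \<subseteq> R.rcenter" by (rule layer_subset_rcenter[OF l1])
  then have "g \<otimes> h \<otimes> inv g \<otimes> inv h \<in> R.rcenter" if "g \<in> carrier G" "h \<in> carrier G" for g h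
    using that lcs_Suc_subset_iff[OF sRc, of 0] ctrD[of g R.rcenter h] by (auto simp: commutator_def)
  then have "p\<^sup>2 * card R.rcenter = card (carrier G)" by (rule R.dim_sq_rcenter_eq)
  moreover have "(p\<^sup>2)\<^sup>2 * card S.rcenter \<le> card (carrier G)" by (rule S.dim_sq_rcenter_le)
  \<comment> \<open>With \<open>Y\<close> and \<open>Z\<close> for the two centers,
    \<open>p^4 |Z| \<le> |G| = p^2 |Y| \<le> p^3 |Z|\<close>.\<close>
  ultimately have "p\<^sup>2 * (p\<^sup>2 * card S.rcenter) \<le> p\<^sup>2 * card R.rcenter" by (simp add: power2_eq_square ac_simps)
  then have "p\<^sup>2 * card S.rcenter \<le> card R.rcenter"
    by (rule mult_left_le_imp_le) (use p_gt_1 in simp)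
  also note YZ
  finally have "p * (p * card S.rcenter) \<le> 1 * (p * card S.rcenter)" by (simp add: power2_eq_square mult.assoc)
  then have "p \<le> 1" by (rule mult_right_le_imp_le) (use p_gt_1 card_subgroup_pos[OF sSc] in simp)
  then show False using p_gt_1 by simp
qed

text \<open>For \<open>x \<notin> G'\<close> the elements \<open>[x,h] r\<close> with \<open>r \<in> \<gamma>\<^sub>3\<close> form a normal subgroup \<open>D\<close> with
  \<open>|D : \<gamma>\<^sub>3| \<le> p\<close>. Modulo \<open>D\<close> both \<open>x\<close> and \<open>G'\<close> are central, so \<open>G/D\<close> has a central subgroup of
  index at most \<open>p\<close> and is abelian.\<close>

lemma card_lcs1_le:
  assumes idx: "card (carrier G) = p\<^sup>2 * card (lcs G 1)"
  shows "card (lcs G 1) \<le> p * card (lcs G 2)"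
proof -
  define T where "T = lcs G 1"
  define R where "R = lcs G 2"
  have nT: "T \<lhd> G" and nR: "R \<lhd> G" by (simp_all add: T_def R_def lcs_normal)
  have sT: "subgroup T G" and sR: "subgroup R G" using nT nR normal_subgroup by auto
  interpret R: normal R G by (rule nR)
  have RT: "R \<subseteq> T" using lcs_Suc_subset[of 1] by (simp add: R_def T_def numeral_2_eq_2)
  have Tctr: "T \<subseteq> ctr R"
    using lcs_Suc_subset_iff[OF sR, of 1] by (simp add: R_def T_def numeral_2_eq_2)
  have comT: "commutator x y \<in> T" if "x \<in> carrier G" "y \<in> carrier G" for x y
    using that lcs_Suc_subset_iff[OF sT, of 0] by (auto simp: T_def intro: ctrD)
  have idx': "card (carrier G) = p * (p * card T)" using idx by (simp add: T_def power2_eq_square)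
  \<comment> \<open>A subgroup strictly between \<open>T\<close> and \<open>G\<close> has index \<open>p\<close>.\<close>
  have full: "F = carrier G" if F: "subgroup F G" and E: "subgroup E G" and "T \<subset> E" "E \<subset> F" for E F
  proof -
    have "p * card T \<le> card E" "p * card E \<le> card F"
      using card_psubset[OF sT E] card_psubset[OF E F] that by auto
    then have "p * (p * card T) \<le> card F" by (metis le_trans mult_le_mono2)
    then show ?thesis using card_seteq[OF fin subgroup.subset[OF F]] idx' by simp
  qed
  have "T \<noteq> carrier G"
  proof
    assume "T = carrier G"
    then have "card T * 1 = card T * (p * p)" using idx' by (simp add: ac_simps)
    then show False using p_gt_1 card_subgroup_pos[OF sT] by simp
  qed
  then obtain x where x: "x \<in> carrier G" "x \<notin> T" using subgroup.subset[OF sT] by blast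
  \<comment> \<open>The centralizer of \<open>x\<close> modulo \<open>R\<close> contains
    \<open>T\<close> and \<open>x\<close>, so its index in the whole group is at most
    \<open>p\<close>. This index will bound the number of cosets of \<open>R\<close> in
    \<open>D\<close>.\<close>
  define C where "C = cent R x"
  have sC: "subgroup C G" unfolding C_def by (rule cent_subgroup[OF nR x(1)])
  have xC: "x \<in> C" using x by (simp add: C_def cent_def commutator_def m_assoc)
  have "T \<subset> C" using Tctr ctr_subset_cent[OF nR x(1)] xC x(2) unfolding C_def by blast
  then have "p * card T \<le> card C" by (rule card_psubset[OF sT sC])
  then have CG: "card (carrier G) \<le> p * card C" using idx' by simp
  define D where "D = {commutator x h \<otimes> r | h r. h \<in> carrier G \<and> r \<in> R}"
  have DI: "commutator x h \<otimes> r \<in> D" if "h \<in> carrier G" "r \<in> R" for h r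
    using that unfolding D_def by blast
  have RD: "R \<subseteq> D"
  proof
    fix r assume r: "r \<in> R"
    have "commutator x \<one> \<otimes> r = r" using x r by (simp add: commutator_def)
    then show "r \<in> D" using DI[OF one_closed r] by simp
  qed
  have DT: "D \<subseteq> T" using comT[OF x(1)] RT subgroup.m_closed[OF sT] by (auto simp: D_def)
  have nD: "D \<lhd> G"
  proof -
    have "subgroup D G"
    proof (rule subgroup.intro)
      show "D \<subseteq> carrier G" using DT subgroup.subset[OF sT] by blast
      show "\<one> \<in> D" using RD R.one_closed by blast
      show "d \<otimes> d' \<in> D" if d: "d \<in> D" "d' \<in> D" for d d'
      proof -
        obtain h r where h: "h \<in> carrier G" "r \<in> R" "d = commutator x h \<otimes> r" using d by (auto simp: D_def)
        obtain h' r' where h': "h' \<in> carrier G" "r' \<in> R" "d' = commutator x h' \<otimes> r'" using d by (auto simp: D_def)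
        define c where "c = commutator x h'"
        have c: "c \<in> carrier G" "c \<in> ctr R" using comT[OF x(1) h'(1)] Tctr x h' by (auto simp: c_def)
        \<comment> \<open>The error term in \<open>[x,h] [x,h'] = [x,h h'] k\<close>; it lies in
          \<open>R\<close> because \<open>c = [x,h']\<close> is central modulo
          \<open>R\<close>.\<close>
        define k where "k = inv c \<otimes> inv (commutator h c) \<otimes> c"
        have kR: "k \<in> R"
          unfolding k_def using ctrD'[OF nR c(2) h(1)] c normal_conj'[OF nR] by simp
        have eq1: "commutator x (h \<otimes> h') = commutator x h \<otimes> commutator h c \<otimes> c"
          using x h h' by (simp add: c_def commutator_def m_assoc inv_mult_group)
        have e2: "commutator x h \<otimes> c = commutator x (h \<otimes> h') \<otimes> k"
          unfolding eq1 k_def using x(1) h(1) c(1) by (simp add: m_assoc)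
        have rr: "r \<in> carrier G" "r' \<in> carrier G" using h h' R.subset by auto
        have "d \<otimes> d' = (commutator x h \<otimes> c) \<otimes> (inv c \<otimes> r \<otimes> c \<otimes> r')"
          using x(1) h(1) c(1) rr unfolding h(3) h'(3) c_def[symmetric] by (simp add: m_assoc)
        also have "\<dots> = commutator x (h \<otimes> h') \<otimes> (k \<otimes> (inv c \<otimes> r \<otimes> c \<otimes> r'))"
          unfolding e2 using x(1) h(1) h'(1) c(1) rr kR R.subset by (subst m_assoc) auto
        finally have "d \<otimes> d' = commutator x (h \<otimes> h') \<otimes> (k \<otimes> (inv c \<otimes> r \<otimes> c \<otimes> r'))" .
        moreover have "k \<otimes> (inv c \<otimes> r \<otimes> c \<otimes> r') \<in> R"
          using kR normal_conj'[OF nR h(2) c(1)] h'(2) by simp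
        ultimately show ?thesis using DI[OF m_closed[OF h(1) h'(1)]] by simp
      qed
      show "inv d \<in> D" if d: "d \<in> D" for d
      proof -
        obtain h r where h: "h \<in> carrier G" "r \<in> R" "d = commutator x h \<otimes> r" using d by (auto simp: D_def)
        define c where "c = commutator x h"
        have c: "c \<in> carrier G" "c \<in> ctr R" using comT[OF x(1) h(1)] Tctr x h by (auto simp: c_def)
        have rc: "r \<in> carrier G" using h R.subset by auto
        \<comment> \<open>The error between the inverse of \<open>[x,h]\<close> and
          \<open>[x,inv h]\<close>. It equals \<open>[inv h, c]\<close>, which lies in
          \<open>R\<close> by centrality of \<open>c\<close> modulo \<open>R\<close>.\<close>
        define u where "u = inv (commutator x (inv h)) \<otimes> inv c"
        have "u = commutator (inv h) c"
          using x(1) h(1) by (simp add: u_def c_def commutator_def m_assoc inv_mult_group)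
        then have uR: "u \<in> R" using ctrD'[OF nR c(2)] h(1) by simp
        have "inv d = inv r \<otimes> inv c" using c(1) rc unfolding h(3) c_def[symmetric] by (simp add: inv_mult_group)
        also have "\<dots> = inv c \<otimes> (c \<otimes> inv r \<otimes> inv c)" using c(1) rc by (simp add: m_assoc)
        also have "inv c = commutator x (inv h) \<otimes> u" using x(1) h(1) c(1) by (simp add: u_def)
        finally have "inv d = commutator x (inv h) \<otimes> (u \<otimes> (c \<otimes> inv r \<otimes> (commutator x (inv h) \<otimes> u)))"
          using x(1) h(1) c(1) rc uR R.subset by (subst (asm) m_assoc) auto
        moreover have "u \<otimes> (c \<otimes> inv r \<otimes> (commutator x (inv h) \<otimes> u)) \<in> R"
        proof -
          have "commutator x (inv h) \<otimes> u = inv c" using x(1) h(1) c(1) by (simp add: u_def)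
          then show ?thesis using uR normal_conj[OF nR R.m_inv_closed[OF h(2)] c(1)] by simp
        qed
        ultimately show ?thesis using DI[OF inv_closed[OF h(1)]] by simp
      qed
    qed
    moreover have "g \<otimes> d \<otimes> inv g \<in> D" if g: "g \<in> carrier G" and d: "d \<in> D" for g d
    proof -
      have dT: "d \<in> ctr R" "d \<in> carrier G" using d DT Tctr subgroup.subset[OF sT] by auto
      have "g \<otimes> d \<otimes> inv g = commutator g d \<otimes> d" using g dT by (simp add: commutator_def m_assoc)
      then show ?thesis
        using ctrD'[OF nR dT(1) g] RD \<open>subgroup D G\<close> d by (metis subgroup.m_closed subsetD)
    qed
    ultimately show ?thesis by (simp add: normal_inv_iff)
  qed
  have sD: "subgroup D G" by (rule normal_subgroup[OF nD])
  have cardD: "card D \<le> p * card R"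
  proof -
    \<comment> \<open>The coset of \<open>R\<close> containing \<open>[x,h]\<close>. It depends only
      on the left coset of \<open>h\<close> modulo \<open>C\<close>, so at most \<open>p\<close>
      cosets occur, and their union is \<open>D\<close>.\<close>
    define F where "F h = (\<lambda>r. commutator x h \<otimes> r) ` R" for h
    have "card (F ` carrier G) * card C \<le> card (carrier G)"
    proof (rule card_ge_fibre[OF fin])
      fix y assume "y \<in> F ` carrier G"
      then obtain h where h: "h \<in> carrier G" "y = F h" by blast
      have "F (h \<otimes> c) = F h" if c: "c \<in> C" for c
      proof -
        have cc: "c \<in> carrier G" "commutator x c \<in> R" using c by (auto simp: C_def cent_def)
        define k where "k = h \<otimes> commutator x c \<otimes> inv h"
        have k: "k \<in> R" using normal_conj[OF nR cc(2) h(1)] by (simp add: k_def)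
        have e: "commutator x (h \<otimes> c) = commutator x h \<otimes> k"
          using x(1) h(1) cc(1) by (simp add: k_def commutator_def m_assoc inv_mult_group)
        have "(\<lambda>r. k \<otimes> r) ` R = R"
        proof
          show "(\<lambda>r. k \<otimes> r) ` R \<subseteq> R" using k by auto
          show "R \<subseteq> (\<lambda>r. k \<otimes> r) ` R"
          proof
            fix r assume r: "r \<in> R"
            then have "r = k \<otimes> (inv k \<otimes> r)" "inv k \<otimes> r \<in> R" using k by auto
            then show "r \<in> (\<lambda>r. k \<otimes> r) ` R" by blast
          qed
        qed
        moreover have "F (h \<otimes> c) = (\<lambda>r. commutator x h \<otimes> r) ` (\<lambda>r. k \<otimes> r) ` R"
          unfolding F_def image_image e using x(1) h(1) k R.subset by (intro image_cong) (auto simp: m_assoc)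
        ultimately show ?thesis by (simp add: F_def)
      qed
      then have "(\<lambda>c. h \<otimes> c) ` C \<subseteq> {z \<in> carrier G. F z = y}"
        using h subgroup.subset[OF sC] by auto
      moreover have "inj_on (\<lambda>c. h \<otimes> c) C"
        using h subgroup.subset[OF sC] by (intro inj_onI) (metis l_cancel subsetD)
      ultimately show "card C \<le> card {z \<in> carrier G. F z = y}"
        using fin by (metis (no_types, lifting) card_image card_mono finite_Collect_conjI finite_subset mem_Collect_eq subsetI)
    qed
    then have "card (F ` carrier G) * card C \<le> p * card C" using CG by (rule le_trans)
    then have Fp: "card (F ` carrier G) \<le> p" using card_subgroup_pos[OF sC] by simp
    have "D = \<Union> (F ` carrier G)" by (auto simp: D_def F_def)
    then have "card D \<le> (\<Sum>A\<in>F ` carrier G. card A)" by (simp only: card_Union_le_sum_card)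
    also have "\<dots> \<le> (\<Sum>A\<in>F ` carrier G. card R)"
      by (rule sum_mono) (use finite_subgroup[OF sR] in \<open>auto simp: F_def card_image_le\<close>)
    also have "\<dots> \<le> p * card R" using Fp by simp
    finally show ?thesis .
  qed
  define E where "E = ctr D"
  have sE: "subgroup E G" unfolding E_def by (rule normal_subgroup[OF ctr_normal[OF nD]])
  have "x \<in> E"
  proof -
    have "commutator x y \<in> D" if "y \<in> carrier G" for y
      using DI[OF that R.one_closed] x that by simp
    then show ?thesis using x by (simp add: E_def ctr_def)
  qed
  then have TE: "T \<subset> E" using Tctr ctr_mono[OF RD] x(2) by (auto simp: E_def)
  have "g \<in> E" if g: "g \<in> carrier G" for g
  proof (rule ccontr)
    assume ng: "g \<notin> E"
    \<comment> \<open>Every element commutes with itself, so \<open>cent D g\<close> contains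
      \<open>g\<close> as well as \<open>E\<close>. This gives
      \<open>T \<subset> E \<subset> cent D g\<close>, and \<open>full\<close> makes
      \<open>g\<close> central modulo \<open>D\<close> after all.\<close>
    have "g \<in> cent D g" using g subgroup.one_closed[OF sD] by (simp add: cent_def commutator_def m_assoc)
    then have "E \<subset> cent D g" using ng ctr_subset_cent[OF nD g] by (auto simp: E_def)
    then have "cent D g = carrier G" by (rule full[OF cent_subgroup[OF nD g] sE TE])
    then have "g \<in> E" using g by (auto simp: E_def ctr_def cent_def)
    then show False using ng by simp
  qed
  then have "lcs G 0 \<subseteq> ctr D" by (auto simp: E_def)
  then have "T \<subseteq> D" using lcs_Suc_subset_iff[OF sD, of 0] by (simp add: T_def)
  then have "card T \<le> card D" by (rule card_mono[OF finite_subgroup[OF sD]])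
  then show ?thesis using cardD by (simp add: T_def R_def)
qed

text \<open>The index of the kernel is at most the product of three indices:
  \<open>p\<^sup>2\<close> for \<open>lcs G 1\<close>, at most \<open>p\<close> for
  \<open>lcs G 2\<close> in it, and at most \<open>p\<close> for the kernel part of
  \<open>lcs G 2\<close>, on which \<open>scal\<close> takes only \<open>p\<close>-th roots of unity
  as values.\<close>

lemma card_le_layer_2:
  assumes idx: "card (carrier G) = p\<^sup>2 * card (lcs G 1)" and l: "layer 2 \<rho> n"
  shows "card (carrier G) \<le> p ^ 4 * card (finite_rep.rker G \<rho> n)"
proof -
  interpret finite_irr_rep G \<rho> n using l by (simp add: layer_def)
  have c1: "card (lcs G 1) \<le> p * card (lcs G 2)" by (rule card_lcs1_le[OF idx])
  have s1: "subgroup (lcs G 1) G" and s2: "subgroup (lcs G 2) G" using lcs_normal normal_subgroup by auto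
  have l21: "lcs G 2 \<subseteq> lcs G 1" by (rule lcs_antimono) simp
  have l2c: "lcs G 2 \<subseteq> rcenter" by (rule layer_subset_rcenter[OF l])
  have sZ: "subgroup rcenter G" by (rule normal_subgroup[OF rcenter_normal])
  \<comment> \<open>For \<open>u\<close> in \<open>lcs G 1\<close> the power \<open>u [^] p\<close>
    lies in \<open>lcs G 2\<close> and acts as a scalar, so the scalars of the commutators of
    \<open>u\<close> are \<open>p\<close>-th roots of unity. As \<open>U\<close> is a subgroup, it
    therefore contains all of \<open>lcs G 2\<close>.\<close>
  define U where "U = {z \<in> rcenter. scal z ^ p = 1}"
  have sU: "subgroup U G"
  proof (rule subgroup.intro)
    show "U \<subseteq> carrier G" using subgroup.subset[OF sZ] by (auto simp: U_def)
    show "\<one> \<in> U" using subgroup.one_closed[OF sZ] by (simp add: U_def scal_one)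
    show "y \<otimes> z \<in> U" if "y \<in> U" "z \<in> U" for y z
      using that subgroup.m_closed[OF sZ] by (simp add: U_def scal_mult power_mult_distrib)
    show "inv z \<in> U" if "z \<in> U" for z
    proof -
      have z: "z \<in> rcenter" "scal z ^ p = 1" "inv z \<in> rcenter"
        using that subgroup.m_inv_closed[OF sZ] by (auto simp: U_def)
      have "scal z * scal (inv z) = 1" using scal_mult[OF z(1,3)] z(1) by (simp add: rcenter_carrier scal_one)
      then have "scal z ^ p * scal (inv z) ^ p = 1" by (metis power_mult_distrib power_one)
      then show ?thesis using z by (simp add: U_def)
    qed
  qed
  have "lcs G 1 \<subseteq> ctr U"
  proof
    fix u assume u: "u \<in> lcs G 1"
    have uc: "u \<in> carrier G" using u lcs_subset by blast
    have up: "u [^] p \<in> rcenter"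
      using pow_p_in_subgroup[OF lcs_normal s1 l21 c1 u] l2c by blast
    have "commutator u g \<in> U" if g: "g \<in> carrier G" for g
    proof -
      have "lcs G 1 \<subseteq> ctr (lcs G 2)" using lcs_Suc_subset_iff[OF s2, of 1] by (simp add: numeral_2_eq_2)
      then have "commutator u g \<in> rcenter" using u g l2c ctrD by blast
      then show ?thesis using scal_commutator_pow[OF uc g _ up] by (simp add: U_def)
    qed
    then show "u \<in> ctr U" using uc by (simp add: ctr_def)
  qed
  then have "lcs G 2 \<subseteq> U" using lcs_Suc_subset_iff[OF sU, of 1] by (simp add: numeral_2_eq_2)
  then have "scal ` lcs G 2 \<subseteq> {w. w ^ p = 1}" by (auto simp: U_def)
  then have "card (scal ` lcs G 2) \<le> card {w::complex. w ^ p = 1}"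
    using p_gt_1 by (intro card_mono finite_nth_roots) auto
  also have "\<dots> = p" using p_gt_1 by (intro card_nth_roots) auto
  finally have "card (lcs G 2) \<le> p * card (lcs G 2 \<inter> rker)"
    using card_scal_image[OF s2 l2c] by simp
  also have "\<dots> \<le> p * card rker"
    using finite_subgroup[OF normal_subgroup[OF rker_normal]] by (intro mult_left_mono card_mono) auto
  finally have *: "card (lcs G 2) \<le> p * card rker" .
  have "card (carrier G) \<le> p\<^sup>2 * (p * card (lcs G 2))" using idx c1 by simp
  also have "\<dots> \<le> p\<^sup>2 * (p * (p * card rker))" using * by (intro mult_left_mono) auto
  also have "\<dots> = p ^ 4 * card rker" by (simp add: power2_eq_square power4_eq_xxxx ac_simps)
  finally show ?thesis .
qed

lemma four_codegrees_class_le_4: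
  assumes cod: "cod G \<subseteq> {1, real p, real p ^ b, real p ^ a}" and b: "2 \<le> b" "b < a"
    and hyp: "card (cd G) = 2 \<or> cd G \<subseteq> {1, of_nat p, of_nat (p ^ 2)}
         \<or> card (carrier G) = p ^ 2 * card (lcs G 1)"
  shows "lcs G 4 = {\<one>}"
proof (rule ccontr)
  assume "lcs G 4 \<noteq> {\<one>}"
  \<comment> \<open>Layers count from zero: \<open>\<rho>4\<close>, \<open>\<rho>3\<close>,
    \<open>\<rho>2\<close>, \<open>\<rho>1\<close> afford the characters called
    \<open>\<chi>\<close> with subscripts 5, 4, 3, 2 in the outline.\<close>
  then obtain \<rho>4 n4 where l4: "layer 4 \<rho>4 n4" by (rule layer_exists)
  then have "layer (Suc 3) \<rho>4 n4" by simp
  then obtain \<rho>3 n3 where l3: "layer 3 \<rho>3 n3" and s43: "finite_rep.rker G \<rho>4 n4 \<subset> finite_rep.rker G \<rho>3 n3"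
    by (rule layer_descend)
  then have "layer (Suc 2) \<rho>3 n3" by simp
  then obtain \<rho>2 n2 where l2: "layer 2 \<rho>2 n2" and s32: "finite_rep.rker G \<rho>3 n3 \<subset> finite_rep.rker G \<rho>2 n2"
    by (rule layer_descend)
  then have "layer (Suc 1) \<rho>2 n2" by (simp add: numeral_2_eq_2)
  then obtain \<rho>1 n1 where l1: "layer 1 \<rho>1 n1" and s21: "finite_rep.rker G \<rho>2 n2 \<subset> finite_rep.rker G \<rho>1 n1"
    by (rule layer_descend)
  obtain e4 f4 t4 where c4: "card (carrier G) = p ^ e4 * card (finite_rep.rker G \<rho>4 n4)" "n4 = p ^ f4"
    and x4: "1 \<le> f4" "e4 = f4 + t4" "t4 = a \<or> t4 = b" "2 * f4 < e4"
    by (rule layer_exponents[OF l4 _ cod]) auto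
  obtain e3 f3 t3 where c3: "card (carrier G) = p ^ e3 * card (finite_rep.rker G \<rho>3 n3)" "n3 = p ^ f3"
    and x3: "1 \<le> f3" "e3 = f3 + t3" "t3 = a \<or> t3 = b" "2 * f3 < e3"
    by (rule layer_exponents[OF l3 _ cod]) auto
  obtain e2 f2 t2 where c2: "card (carrier G) = p ^ e2 * card (finite_rep.rker G \<rho>2 n2)" "n2 = p ^ f2"
    and x2: "1 \<le> f2" "e2 = f2 + t2" "t2 = a \<or> t2 = b" "2 * f2 < e2"
    by (rule layer_exponents[OF l2 _ cod]) auto
  obtain e1 f1 t1 where c1: "card (carrier G) = p ^ e1 * card (finite_rep.rker G \<rho>1 n1)" "n1 = p ^ f1"
    and x1: "1 \<le> f1" "e1 = f1 + t1" "t1 = a \<or> t1 = b" "2 * f1 < e1"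
    by (rule layer_exponents[OF l1 _ cod]) auto
  have sk: "subgroup (finite_rep.rker G \<rho> n) G" if "layer i \<rho> n" for i \<rho> n
    using that finite_irr_rep.rker_normal normal_subgroup unfolding layer_def by blast
  have e43: "e3 < e4" by (rule exponent_less[OF sk[OF l4] sk[OF l3] s43 c4(1) c3(1)])
  have e32: "e2 < e3" by (rule exponent_less[OF sk[OF l3] sk[OF l2] s32 c3(1) c2(1)])
  have e21: "e1 < e2" by (rule exponent_less[OF sk[OF l2] sk[OF l1] s21 c2(1) c1(1)])
  have cd: "complex_of_nat (p ^ f) \<in> cd G" if "layer i \<rho> n" "n = p ^ f" for i \<rho> n f
    using that finite_irr_rep.dim_in_cd unfolding layer_def by blast
  note cds = cd[OF l4 c4(2)] cd[OF l3 c3(2)] cd[OF l2 c2(2)] cd[OF l1 c1(2)]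
  have inj: "complex_of_nat (p ^ f) = complex_of_nat (p ^ f') \<longleftrightarrow> f = f'" for f f'
    using p_gt_1 by (simp only: of_nat_eq_iff power_inject_exp)
  from hyp show False
  proof (elim disjE)
    assume "card (cd G) = 2"
    then obtain x y where xy: "cd G = {x, y}" by (auto simp: card_2_iff)
    define d where "d = (if x = 1 then y else x)"
    have d: "cd G = {1, d}" using one_in_cd[OF is_group fin] xy by (auto simp: d_def)
    have ne: "complex_of_nat (p ^ f) \<noteq> 1" if "1 \<le> f" for f using inj[of f 0] that by simp
    have "complex_of_nat (p ^ f4) = d" "complex_of_nat (p ^ f3) = d" "complex_of_nat (p ^ f2) = d"
      using cds d ne x4(1) x3(1) x2(1) by auto
    then have "f4 = f3" "f3 = f2" using inj by metis+
    \<comment> \<open>Equal degrees turn \<open>e2 < e3 < e4\<close> into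
      \<open>t2 < t3 < t4\<close>, three values in \<open>{a, b}\<close>.\<close>
    then show False using x4(2,3) x3(2,3) x2(2,3) e43 e32 b(2) by linarith
  next
    assume cd: "cd G \<subseteq> {1, of_nat p, of_nat (p ^ 2)}"
    have le: "f \<le> 2" if "complex_of_nat (p ^ f) \<in> cd G" for f
      using that cd inj[of f 0] inj[of f 1] inj[of f 2] by auto
    have f2s: "f4 \<le> 2" "f3 \<le> 2" "f2 \<le> 2" "f1 \<le> 2" using cds le by auto
    have e4: "e4 \<le> a + 2" using x4(2,3) f2s(1) b(2) by linarith
    \<comment> \<open>Otherwise \<open>e2 \<ge> a + 1\<close>, and two strict increases give
      \<open>e4 \<ge> a + 3\<close>. The same argument with one more step excludes
      \<open>t1 = a\<close>.\<close>
    have "t2 \<noteq> a" using e4 x2(1,2) e43 e32 by linarith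
    then have t2: "t2 = b" using x2(3) by blast
    have "t1 \<noteq> a" using e4 x1(1,2) e43 e32 e21 by linarith
    then have t1: "t1 = b" using x1(3) by blast
    \<comment> \<open>Both codegrees are now \<open>p ^ b\<close>, so \<open>e1 < e2\<close> means
      \<open>f1 < f2\<close>, with both between 1 and 2.\<close>
    have *: "f1 = 1 \<and> f2 = 2 \<and> e2 = Suc e1"
      using f2s(3) x2(1,2) x1(1,2) t1 t2 e21 by linarith
    have "p ^ e1 * card (finite_rep.rker G \<rho>1 n1) = p ^ e1 * (p * card (finite_rep.rker G \<rho>2 n2))"
    proof -
      have "p ^ e1 * card (finite_rep.rker G \<rho>1 n1) = p ^ Suc e1 * card (finite_rep.rker G \<rho>2 n2)"
        using c1(1) c2(1) * by metis
      then show ?thesis by (simp add: ac_simps)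
    qed
    then have "card (finite_rep.rker G \<rho>1 n1) = p * card (finite_rep.rker G \<rho>2 n2)"
      using p_gt_1 by simp
    moreover have "n1 = p" "n2 = p\<^sup>2" using c1(2) c2(2) * by auto
    ultimately show False using layer_chain_degrees_absurd l1 l2 s21 by blast
  next
    assume "card (carrier G) = p ^ 2 * card (lcs G 1)"
    then have "p ^ e2 * card (finite_rep.rker G \<rho>2 n2) \<le> p ^ 4 * card (finite_rep.rker G \<rho>2 n2)"
      using card_le_layer_2[OF _ l2] c2(1) by simp
    then have "p ^ e2 \<le> p ^ 4" using card_subgroup_pos[OF sk[OF l2]] by simp
    then have "e2 \<le> 4" by (rule power_le_imp_le_exp[OF p_gt_1])
    \<comment> \<open>From \<open>f1 \<ge> 1\<close> follows \<open>e1 \<ge> 3\<close>, hence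
      \<open>e1 = 3\<close> and \<open>e2 = 4\<close>; then \<open>2 * f < e\<close> leaves only
      degree \<open>p\<close> for both.\<close>
    then have e2: "e2 = 4" "e1 = 3" "f1 = 1" "f2 = 1" using x2(1,4) x1(1,4) e21 by linarith+
    then have "t2 = 3" using x2(2) by linarith
    then have "a = 3" using x2(3) x1(2,3) e2 b by linarith
    \<comment> \<open>Strict growth gives \<open>e4 \<ge> 6\<close>, while
      \<open>e4 \<le> f4 + 3\<close> forces \<open>f4 \<ge> 3\<close> and \<open>2 * f4 < e4\<close>
      forces \<open>f4 < 3\<close>.\<close>
    then show False using x4 e43 e32 e2(1) b by linarith
  qed
qed

end

theorem theorem1p1:
  fixes G :: "('g,'b) monoid_scheme" and p a b :: nat
  assumes "Factorial_Ring.prime p"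
    and "p_group p G"
    and "cod G = {1, real p, real p ^ b, real p ^ a}"
    and "2 \<le> b" and "b < a"
    and "card (cd G) = 2 \<or> cd G = {1, of_nat p, of_nat (p ^ 2)}
         \<or> card (carrier G) = p ^ 2 * card (derived G (carrier G))"
  shows "nilpotent_class_le G 4"
proof -
  interpret group G using assms(2) by (simp add: p_group_def)
  interpret finite_p_group G p
    by unfold_locales (use assms(1,2) in \<open>auto simp: p_group_def\<close>)
  have "lcs G 4 = {\<one>\<^bsub>G\<^esub>}"
    using assms(3-6) by (intro four_codegrees_class_le_4[of b a]) (auto simp: derived_eq_lcs)
  then show ?thesis by (simp add: nilpotent_class_le_def)
qed

end
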